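(* Let $T$ be a stable complete theory in a countable language $L$ and let $\mathfrak p$ be a strongly regular global type of $T$. Then $T$ has quasiminimal models of arbitrarily large cardinalities.
   Context: $\mathfrak C$ is a monster model of $T$; a global type is a complete type over $\mathfrak C$ and $\mathfrak p|_B$ its restriction to $B$. A global type $\mathfrak p(x)$ in one variable is strongly regular if it is invariant under $\mathrm{Aut}(\mathfrak C)$ and for every small $B\subseteq\mathfrak C$ and every $a\in\mathfrak C$, either $a$ realises $\mathfrak p|_B$ or $\mathfrak p|_B\vdash\mathfrak p|_{B\cup\{a\}}$. A structure is quasiminimal if it is uncountable and every subset of it definable with parameters is countable or co-countable.
   Formalization: The strongly regular type p is also required to be non-algebraic (every formula in p has infinitely many solutions); otherwise the type of a named constant would satisfy the definition and the claim would fail, e.g. for two infinite sorts in bijection with a constant. *)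

theory Defs
  imports Main "HOL-Library.Countable_Set"
begin

unbundle cardinal_syntax

section \<open>First-order languages, formulas and structures\<close>

record ('f, 'r) lang =
  Funs :: "'f set"
  Rels :: "'r set"
  fun_ar :: "'f \<Rightarrow> nat"
  rel_ar :: "'r \<Rightarrow> nat"

definition countable_lang :: "('f, 'r) lang \<Rightarrow> bool" where
  "countable_lang L \<longleftrightarrow> countable (Funs L) \<and> countable (Rels L)"

datatype 'f tm = Var nat | Fn 'f "'f tm list"

datatype ('f, 'r) fm =
    Eq "'f tm" "'f tm"
  | Rel 'r "'f tm list"
  | Neg "('f, 'r) fm"
  | Conj "('f, 'r) fm" "('f, 'r) fm"
  | Ex nat "('f, 'r) fm"

primrec wf_tm :: "('f, 'r) lang \<Rightarrow> 'f tm \<Rightarrow> bool" where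
  "wf_tm L (Var n) \<longleftrightarrow> True"
| "wf_tm L (Fn f ts) \<longleftrightarrow>
     f \<in> Funs L \<and> length ts = fun_ar L f \<and> list_all id (map (wf_tm L) ts)"

primrec wf_fm :: "('f, 'r) lang \<Rightarrow> ('f, 'r) fm \<Rightarrow> bool" where
  "wf_fm L (Eq s t) \<longleftrightarrow> wf_tm L s \<and> wf_tm L t"
| "wf_fm L (Rel r ts) \<longleftrightarrow>
     r \<in> Rels L \<and> length ts = rel_ar L r \<and> list_all (wf_tm L) ts"
| "wf_fm L (Neg \<phi>) \<longleftrightarrow> wf_fm L \<phi>"
| "wf_fm L (Conj \<phi> \<psi>) \<longleftrightarrow> wf_fm L \<phi> \<and> wf_fm L \<psi>"
| "wf_fm L (Ex n \<phi>) \<longleftrightarrow> wf_fm L \<phi>"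

primrec fv_tm :: "'f tm \<Rightarrow> nat set" where
  "fv_tm (Var n) = {n}"
| "fv_tm (Fn f ts) = \<Union> (set (map fv_tm ts))"

primrec fv :: "('f, 'r) fm \<Rightarrow> nat set" where
  "fv (Eq s t) = fv_tm s \<union> fv_tm t"
| "fv (Rel r ts) = \<Union> (fv_tm ` set ts)"
| "fv (Neg \<phi>) = fv \<phi>"
| "fv (Conj \<phi> \<psi>) = fv \<phi> \<union> fv \<psi>"
| "fv (Ex n \<phi>) = fv \<phi> - {n}"

record ('f, 'r, 'a) fo_struct =
  universe :: "'a set"
  fun_int :: "'f \<Rightarrow> 'a list \<Rightarrow> 'a"
  rel_int :: "'r \<Rightarrow> 'a list \<Rightarrow> bool"

definition is_struct :: "('f, 'r) lang \<Rightarrow> ('f, 'r, 'a) fo_struct \<Rightarrow> bool" where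
  "is_struct L M \<longleftrightarrow> universe M \<noteq> {} \<and>
     (\<forall>f\<in>Funs L. \<forall>as\<in>lists (universe M). length as = fun_ar L f \<longrightarrow> fun_int M f as \<in> universe M)"

primrec eval_tm :: "('f, 'r, 'a) fo_struct \<Rightarrow> (nat \<Rightarrow> 'a) \<Rightarrow> 'f tm \<Rightarrow> 'a" where
  "eval_tm M v (Var n) = v n"
| "eval_tm M v (Fn f ts) = fun_int M f (map (eval_tm M v) ts)"

primrec sat :: "('f, 'r, 'a) fo_struct \<Rightarrow> (nat \<Rightarrow> 'a) \<Rightarrow> ('f, 'r) fm \<Rightarrow> bool" where
  "sat M v (Eq s t) \<longleftrightarrow> eval_tm M v s = eval_tm M v t"
| "sat M v (Rel r ts) \<longleftrightarrow> rel_int M r (map (eval_tm M v) ts)"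
| "sat M v (Neg \<phi>) \<longleftrightarrow> \<not> sat M v \<phi>"
| "sat M v (Conj \<phi> \<psi>) \<longleftrightarrow> sat M v \<phi> \<and> sat M v \<psi>"
| "sat M v (Ex n \<phi>) \<longleftrightarrow> (\<exists>a\<in>universe M. sat M (v(n := a)) \<phi>)"


section \<open>Theories\<close>

definition sentences :: "('f, 'r) lang \<Rightarrow> ('f, 'r) fm set" where
  "sentences L = {\<sigma>. wf_fm L \<sigma> \<and> fv \<sigma> = {}}"

definition holds :: "('f, 'r, 'a) fo_struct \<Rightarrow> ('f, 'r) fm \<Rightarrow> bool" where
  "holds M \<sigma> \<longleftrightarrow> (\<forall>v. range v \<subseteq> universe M \<longrightarrow> sat M v \<sigma>)"

definition is_model :: "('f, 'r) lang \<Rightarrow> ('f, 'r) fm set \<Rightarrow> ('f, 'r, 'a) fo_struct \<Rightarrow> bool" where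
  "is_model L T M \<longleftrightarrow> is_struct L M \<and> (\<forall>\<sigma>\<in>T. holds M \<sigma>)"

text \<open>
  Logical consequence and satisfiability are tested on the structures whose universe is a
  (finite or infinite) set of natural numbers.  By the downward Loewenheim-Skolem theorem
  this is the usual notion when the language is countable, the only case in which it is used.
\<close>

definition entails :: "('f, 'r) lang \<Rightarrow> ('f, 'r) fm set \<Rightarrow> ('f, 'r) fm \<Rightarrow> bool" where
  "entails L T \<sigma> \<longleftrightarrow> (\<forall>M :: ('f, 'r, nat) fo_struct. is_model L T M \<longrightarrow> holds M \<sigma>)"

definition complete_theory :: "('f, 'r) lang \<Rightarrow> ('f, 'r) fm set \<Rightarrow> bool" where
  "complete_theory L T \<longleftrightarrow>
     T \<subseteq> sentences L \<and>
     (\<exists>M :: ('f, 'r, nat) fo_struct. is_model L T M) \<and>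
     (\<forall>\<sigma>\<in>sentences L. entails L T \<sigma> \<or> entails L T (Neg \<sigma>))"


section \<open>Parameters and types\<close>

text \<open>
  \<open>L(B)\<close>: the language \<open>L\<close> with a new constant symbol \<open>Inr b\<close> for every \<open>b \<in> B\<close>.
\<close>

definition lang_over :: "('f, 'r) lang \<Rightarrow> 'a set \<Rightarrow> ('f + 'a, 'r) lang" where
  "lang_over L B = \<lparr>Funs = Funs L <+> B, Rels = Rels L,
     fun_ar = case_sum (fun_ar L) (\<lambda>_. 0), rel_ar = rel_ar L\<rparr>"

definition with_params :: "('f, 'r, 'a) fo_struct \<Rightarrow> ('f + 'a, 'r, 'a) fo_struct" where
  "with_params M = \<lparr>universe = universe M,
     fun_int = case_sum (fun_int M) (\<lambda>b _. b), rel_int = rel_int M\<rparr>"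

definition map_params :: "('a \<Rightarrow> 'a) \<Rightarrow> ('f + 'a, 'r) fm \<Rightarrow> ('f + 'a, 'r) fm" where
  "map_params g = map_fm (map_sum id g) id"

text \<open>\<open>L(B)\<close>-formulas in the single free variable \<open>x = Var 0\<close>.\<close>

definition fmls1 :: "('f, 'r) lang \<Rightarrow> 'a set \<Rightarrow> ('f + 'a, 'r) fm set" where
  "fmls1 L B = {\<phi>. wf_fm (lang_over L B) \<phi> \<and> fv \<phi> \<subseteq> {0}}"

definition sat1 :: "('f, 'r, 'a) fo_struct \<Rightarrow> ('f + 'a, 'r) fm \<Rightarrow> 'a \<Rightarrow> bool" where
  "sat1 M \<phi> a \<longleftrightarrow> sat (with_params M) (\<lambda>_. a) \<phi>"

definition solutions :: "('f, 'r, 'a) fo_struct \<Rightarrow> ('f + 'a, 'r) fm \<Rightarrow> 'a set" where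
  "solutions M \<phi> = {a \<in> universe M. sat1 M \<phi> a}"

definition realises :: "('f, 'r, 'a) fo_struct \<Rightarrow> 'a \<Rightarrow> ('f + 'a, 'r) fm set \<Rightarrow> bool" where
  "realises M a q \<longleftrightarrow> a \<in> universe M \<and> (\<forall>\<phi>\<in>q. sat1 M \<phi> a)"

definition complete_type ::
    "('f, 'r) lang \<Rightarrow> ('f, 'r, 'a) fo_struct \<Rightarrow> 'a set \<Rightarrow> ('f + 'a, 'r) fm set \<Rightarrow> bool" where
  "complete_type L M B q \<longleftrightarrow>
     q \<subseteq> fmls1 L B \<and>
     (\<forall>F. finite F \<longrightarrow> F \<subseteq> q \<longrightarrow> (\<exists>a. realises M a F)) \<and>
     (\<forall>\<phi>\<in>fmls1 L B. \<phi> \<in> q \<or> Neg \<phi> \<in> q)"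

definition restrict_type ::
    "('f, 'r) lang \<Rightarrow> ('f + 'a, 'r) fm set \<Rightarrow> 'a set \<Rightarrow> ('f + 'a, 'r) fm set" where
  "restrict_type L p B = p \<inter> fmls1 L B"


section \<open>The monster model\<close>

definition is_aut :: "('f, 'r) lang \<Rightarrow> ('f, 'r, 'a) fo_struct \<Rightarrow> ('a \<Rightarrow> 'a) \<Rightarrow> bool" where
  "is_aut L M g \<longleftrightarrow>
     bij_betw g (universe M) (universe M) \<and>
     (\<forall>f\<in>Funs L. \<forall>as\<in>lists (universe M). length as = fun_ar L f \<longrightarrow>
        g (fun_int M f as) = fun_int M f (map g as)) \<and>
     (\<forall>r\<in>Rels L. \<forall>as\<in>lists (universe M). length as = rel_ar L r \<longrightarrow>
        rel_int M r as = rel_int M r (map g as))"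

definition elementary_map ::
    "('f, 'r) lang \<Rightarrow> ('f, 'r, 'a) fo_struct \<Rightarrow> 'a set \<Rightarrow> ('a \<Rightarrow> 'a) \<Rightarrow> bool" where
  "elementary_map L M A g \<longleftrightarrow>
     A \<subseteq> universe M \<and> g ` A \<subseteq> universe M \<and>
     (\<forall>\<sigma>\<in>sentences (lang_over L A).
        holds (with_params M) \<sigma> \<longleftrightarrow> holds (with_params M) (map_params g \<sigma>))"

definition small :: "'k rel \<Rightarrow> ('f, 'r, 'a) fo_struct \<Rightarrow> 'a set \<Rightarrow> bool" where
  "small \<kappa> M B \<longleftrightarrow> B \<subseteq> universe M \<and> |B| <o \<kappa>"

definition saturated :: "('f, 'r) lang \<Rightarrow> 'k rel \<Rightarrow> ('f, 'r, 'a) fo_struct \<Rightarrow> bool" where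
  "saturated L \<kappa> M \<longleftrightarrow>
     (\<forall>B q. small \<kappa> M B \<longrightarrow> complete_type L M B q \<longrightarrow> (\<exists>a. realises M a q))"

definition strongly_homogeneous :: "('f, 'r) lang \<Rightarrow> 'k rel \<Rightarrow> ('f, 'r, 'a) fo_struct \<Rightarrow> bool" where
  "strongly_homogeneous L \<kappa> M \<longleftrightarrow>
     (\<forall>A g. small \<kappa> M A \<longrightarrow> elementary_map L M A g \<longrightarrow>
        (\<exists>h. is_aut L M h \<and> (\<forall>a\<in>A. h a = g a)))"

text \<open>
  The cardinal \<open>\<kappa>\<close> bounds the size of small sets.  All that is asked of it, for a
  countable language, is to be uncountable, so that every usual choice is covered.
\<close>

definition monster ::
    "('f, 'r) lang \<Rightarrow> ('f, 'r) fm set \<Rightarrow> 'k rel \<Rightarrow> ('f, 'r, 'a) fo_struct \<Rightarrow> bool" where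
  "monster L T \<kappa> M \<longleftrightarrow>
     is_model L T M \<and> Card_order \<kappa> \<and> natLeq <o \<kappa> \<and>
     saturated L \<kappa> M \<and> strongly_homogeneous L \<kappa> M"

text \<open>
  Stability of \<open>T\<close>, read in its monster model \<open>M\<close>: no formula \<open>\<phi>(x; y)\<close> has the order
  property.  The tuple \<open>x\<close> consists of the variables with index in \<open>X\<close>, the tuple \<open>y\<close> of the
  others; only the finitely many free variables of \<open>\<phi>\<close> matter.
\<close>

definition stable_theory :: "('f, 'r) lang \<Rightarrow> ('f, 'r, 'a) fo_struct \<Rightarrow> bool" where
  "stable_theory L M \<longleftrightarrow>
     \<not> (\<exists>\<phi> X (a :: nat \<Rightarrow> nat \<Rightarrow> 'a) (b :: nat \<Rightarrow> nat \<Rightarrow> 'a).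
          wf_fm L \<phi> \<and>
          (\<forall>i n. a i n \<in> universe M \<and> b i n \<in> universe M) \<and>
          (\<forall>i j. sat M (\<lambda>n. if n \<in> X then a i n else b j n) \<phi> \<longleftrightarrow> i < j))"


section \<open>Strongly regular types and quasiminimal structures\<close>

definition global_type ::
    "('f, 'r) lang \<Rightarrow> ('f, 'r, 'a) fo_struct \<Rightarrow> ('f + 'a, 'r) fm set \<Rightarrow> bool" where
  "global_type L M p \<longleftrightarrow> complete_type L M (universe M) p"

definition aut_invariant ::
    "('f, 'r) lang \<Rightarrow> ('f, 'r, 'a) fo_struct \<Rightarrow> ('f + 'a, 'r) fm set \<Rightarrow> bool" where
  "aut_invariant L M p \<longleftrightarrow> (\<forall>g. is_aut L M g \<longrightarrow> map_params g ` p = p)"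

definition non_algebraic ::
    "('f, 'r, 'a) fo_struct \<Rightarrow> ('f + 'a, 'r) fm set \<Rightarrow> bool" where
  "non_algebraic M p \<longleftrightarrow> (\<forall>\<phi>\<in>p. infinite (solutions M \<phi>))"

text \<open>\<open>q \<turnstile> r\<close>, computed in the monster model; \<open>q\<close> and \<open>r\<close> are over small sets.\<close>

definition type_entails ::
    "('f, 'r, 'a) fo_struct \<Rightarrow> ('f + 'a, 'r) fm set \<Rightarrow> ('f + 'a, 'r) fm set \<Rightarrow> bool" where
  "type_entails M q r \<longleftrightarrow> (\<forall>c. realises M c q \<longrightarrow> realises M c r)"

text \<open>
  As always for regular types, \<open>p\<close> is non-algebraic; this is the same as reading ``either \<open>a\<close>
  realises \<open>p|B\<close> or \<open>p|B \<turnstile> p|B\<union>{a}\<close>'' exclusively.  The types excluded are those of the elements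
  of \<open>dcl(\<emptyset>)\<close>: such a type satisfies the inclusive condition trivially, for any theory
  that has a constant symbol.
\<close>

definition strongly_regular ::
    "('f, 'r) lang \<Rightarrow> 'k rel \<Rightarrow> ('f, 'r, 'a) fo_struct \<Rightarrow> ('f + 'a, 'r) fm set \<Rightarrow> bool" where
  "strongly_regular L \<kappa> M p \<longleftrightarrow>
     global_type L M p \<and> non_algebraic M p \<and> aut_invariant L M p \<and>
     (\<forall>B a. small \<kappa> M B \<longrightarrow> a \<in> universe M \<longrightarrow>
        realises M a (restrict_type L p B) \<or>
        type_entails M (restrict_type L p B) (restrict_type L p (insert a B)))"

definition quasiminimal :: "('f, 'r) lang \<Rightarrow> ('f, 'r, 'a) fo_struct \<Rightarrow> bool" where
  "quasiminimal L M \<longleftrightarrow>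
     uncountable (universe M) \<and>
     (\<forall>\<phi>\<in>fmls1 L (universe M).
        countable (solutions M \<phi>) \<or> countable (universe M - solutions M \<phi>))"

end

theory Submission
  imports Defs "HOL-Library.Countable" "HOL-Library.Multiset" "HOL-Library.Ramsey"
begin

text \<open>
  Say that \<open>q\<close> is in the closure of \<open>B\<close> if \<open>q\<close> does not realise \<open>p|B\<close>.  By stability, \<open>p\<close> is definable
  over a Morley sequence (an instance of a formula is in \<open>p\<close> iff it holds of all but a bounded number
  of its terms), so an ultrapower of the monster contains arbitrarily long Morley sequences over which
  \<open>p\<close> is still strongly regular.  Given such a sequence \<open>a\<close>, indexed by \<open>I\<close>, choose countable models \<open>N s\<close> for
  the finite subsets \<open>s\<close> of \<open>I\<close>, by induction on \<open>s\<close>: \<open>N s\<close> consists of \<open>a i\<close>, \<open>i \<in> s\<close>, of the models \<open>N t\<close>,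
  \<open>t \<subset> s\<close>, and of a sequence of elements each of which is locally isolated over the previous ones; these
  exist because a stable formula has no infinite binary tree.  Local isolation makes the system
  independent: relations between elements of different \<open>N s\<close> can be reflected to smaller index sets.
  Therefore an element of the union \<open>N\<close> in the closure of \<open>N s\<close> belongs to \<open>N s\<close>.  A definable subset of
  \<open>N\<close> with parameters in \<open>N s\<close> or its complement lies in this closure, hence is countable.
\<close>

section \<open>Renaming variables and exchanging them with parameters\<close>

text \<open>\<open>T\<close> is only stable, so over the sets arising here isolated types need not
  be dense. Local isolation asks for one formula per \<open>\<phi>\<close> rather than one for the
  whole type; with countably many formulas it is reached along a decreasing chain of definable sets,
  provided the ambient structure is countably compact. The monster may have fewer elements than
  wanted, since \<open>\<kappa>\<close> is only required to be uncountable, and \<open>p\<close>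
  comes with no extension to a larger structure. In the ultrapower \<open>p\<close> is therefore
  never named: \<open>generic\<close> replaces it by the average of the sequence, and strong
  regularity is pulled back to the monster through copies of countable sequences. Indexing countable
  models by finite sets gives every tuple a finite support, and independence reduces to two
  inductions, each of which trades a latest constructed element for the parameters of an isolating
  formula.\<close>

lemma finite_fv_tm: "finite (fv_tm t)"
  by (induction t) auto

lemma finite_fv: "finite (fv \<phi>)"
  by (induction \<phi>) (auto simp: finite_fv_tm)

lemma wf_tm_Fn [simp]:
  "wf_tm L (Fn f ts) \<longleftrightarrow> f \<in> Funs L \<and> length ts = fun_ar L f \<and> (\<forall>t\<in>set ts. wf_tm L t)"
  by (auto simp: list_all_iff)

declare wf_tm.simps(2) [simp del]

lemma wf_fm_Rel [simp]:
  "wf_fm L (Rel r ts) \<longleftrightarrow> r \<in> Rels L \<and> length ts = rel_ar L r \<and> (\<forall>t\<in>set ts. wf_tm L t)"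
  by (auto simp: list_all_iff)

declare wf_fm.simps(2) [simp del]

lemma eval_tm_in_universe:
  assumes "is_struct L M" "wf_tm L t" "range v \<subseteq> universe M"
  shows "eval_tm M v t \<in> universe M"
  using assms(2)
proof (induction t)
  case (Fn f ts)
  then have "map (eval_tm M v) ts \<in> lists (universe M)" by auto
  then show ?case using assms(1) Fn.prems by (auto simp: is_struct_def)
qed (use assms in auto)

lemma eval_tm_cong:
  assumes "\<And>n. n \<in> fv_tm t \<Longrightarrow> v n = v' n"
  shows "eval_tm M v t = eval_tm M v' t"
  using assms
proof (induction t)
  case (Fn f ts)
  then have "map (eval_tm M v) ts = map (eval_tm M v') ts" by fastforce
  then show ?case by (simp only: eval_tm.simps)
qed auto

lemma sat_cong:
  assumes "\<And>n. n \<in> fv \<phi> \<Longrightarrow> v n = v' n"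
  shows "sat M v \<phi> = sat M v' \<phi>"
  using assms
proof (induction \<phi> arbitrary: v v')
  case (Eq s t)
  then show ?case using eval_tm_cong[of s v v' M] eval_tm_cong[of t v v' M] by auto
next
  case (Rel r ts)
  then have "map (eval_tm M v) ts = map (eval_tm M v') ts"
    by (auto intro!: eval_tm_cong)
  then show ?case by (simp only: sat.simps)
next
  case (Conj \<phi> \<psi>)
  have "sat M v \<phi> = sat M v' \<phi>" by (rule Conj.IH) (use Conj.prems in simp)
  moreover have "sat M v \<psi> = sat M v' \<psi>" by (rule Conj.IH) (use Conj.prems in simp)
  ultimately show ?case by simp
next
  case (Ex n \<phi>)
  have "sat M (v(n := a)) \<phi> = sat M (v'(n := a)) \<phi>" for a
    by (rule Ex.IH) (use Ex.prems in auto)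
  then show ?case by simp
next
  case (Neg \<phi>)
  have "sat M v \<phi> = sat M v' \<phi>" by (rule Neg.IH) (use Neg.prems in simp)
  then show ?case by simp
qed

primrec ren_tm :: "(nat \<Rightarrow> nat) \<Rightarrow> 'f tm \<Rightarrow> 'f tm" where
  "ren_tm g (Var n) = Var (g n)"
| "ren_tm g (Fn f ts) = Fn f (map (ren_tm g) ts)"

text \<open>Capture is avoided by giving each bound variable an index outside the image of the other
  free variables, so \<open>g\<close> may be any map, injective or not.\<close>

primrec ren :: "('f, 'r) fm \<Rightarrow> (nat \<Rightarrow> nat) \<Rightarrow> ('f, 'r) fm" where
  "ren (Eq s t) g = Eq (ren_tm g s) (ren_tm g t)"
| "ren (Rel r ts) g = Rel r (map (ren_tm g) ts)"
| "ren (Neg \<phi>) g = Neg (ren \<phi> g)"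
| "ren (Conj \<phi> \<psi>) g = Conj (ren \<phi> g) (ren \<psi> g)"
| "ren (Ex n \<phi>) g =
     (let m = SOME m. m \<notin> g ` (fv \<phi> - {n}) in Ex m (ren \<phi> (g(n := m))))"

lemma eval_ren_tm: "eval_tm M v (ren_tm g t) = eval_tm M (v \<circ> g) t"
proof (induction t)
  case (Fn f ts)
  then have "map (eval_tm M v \<circ> ren_tm g) ts = map (eval_tm M (v \<circ> g)) ts"
    by (simp add: comp_def)
  then show ?case by (simp only: eval_tm.simps ren_tm.simps map_map)
qed auto

lemma wf_ren_tm: "wf_tm L (ren_tm g t) = wf_tm L t"
  by (induction t) auto

lemma fv_ren_tm: "fv_tm (ren_tm g t) = g ` fv_tm t"
  by (induction t) auto

lemma wf_ren: "wf_fm L (ren \<phi> g) = wf_fm L \<phi>"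
  by (induction \<phi> arbitrary: g) (auto simp: wf_ren_tm Let_def)

lemma fresh_var: "finite X \<Longrightarrow> (SOME m::nat. m \<notin> X) \<notin> X"
  by (rule someI_ex) (use ex_new_if_finite infinite_UNIV_nat in blast)

lemma fv_ren: "fv (ren \<phi> g) \<subseteq> g ` fv \<phi>"
proof (induction \<phi> arbitrary: g)
  case (Ex n \<phi>)
  define m where "m = (SOME m. m \<notin> g ` (fv \<phi> - {n}))"
  have "fv (ren \<phi> (g(n := m))) \<subseteq> (g(n := m)) ` fv \<phi>" by (rule Ex.IH)
  then show ?case by (auto simp: Let_def m_def[symmetric] split: if_splits)
next
  case (Conj \<phi> \<psi>)
  then show ?case by fastforce
qed (auto simp: fv_ren_tm)

lemma sat_ren: "sat M v (ren \<phi> g) = sat M (v \<circ> g) \<phi>"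
proof (induction \<phi> arbitrary: g v)
  case (Rel r ts)
  have "map (eval_tm M v) (map (ren_tm g) ts) = map (eval_tm M (v \<circ> g)) ts"
    by (auto simp: eval_ren_tm)
  then show ?case by (simp only: sat.simps ren.simps)
next
  case (Ex n \<phi>)
  define m where "m = (SOME m. m \<notin> g ` (fv \<phi> - {n}))"
  have m: "m \<notin> g ` (fv \<phi> - {n})"
    unfolding m_def by (rule fresh_var) (simp add: finite_fv)
  have "sat M (v(m := a) \<circ> g(n := m)) \<phi> = sat M ((v \<circ> g)(n := a)) \<phi>" for a
    by (rule sat_cong) (use m in auto)
  then show ?case
    by (simp only: ren.simps Let_def m_def[symmetric] sat.simps Ex.IH)
qed (auto simp: eval_ren_tm)

text \<open>Free variables \<open>n\<close> with \<open>w n = Some a\<close> become the parameter \<open>a\<close>.\<close>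

primrec inst_tm :: "(nat \<Rightarrow> 'a option) \<Rightarrow> 'f tm \<Rightarrow> ('f + 'a) tm" where
  "inst_tm w (Var n) = (case w n of None \<Rightarrow> Var n | Some a \<Rightarrow> Fn (Inr a) [])"
| "inst_tm w (Fn f ts) = Fn (Inl f) (map (inst_tm w) ts)"

primrec inst :: "('f, 'r) fm \<Rightarrow> (nat \<Rightarrow> 'a option) \<Rightarrow> ('f + 'a, 'r) fm" where
  "inst (Eq s t) w = Eq (inst_tm w s) (inst_tm w t)"
| "inst (Rel r ts) w = Rel r (map (inst_tm w) ts)"
| "inst (Neg \<phi>) w = Neg (inst \<phi> w)"
| "inst (Conj \<phi> \<psi>) w = Conj (inst \<phi> w) (inst \<psi> w)"
| "inst (Ex n \<phi>) w = Ex n (inst \<phi> (w(n := None)))"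

lemma with_params_simps [simp]:
  "universe (with_params M) = universe M"
  "fun_int (with_params M) (Inl f) = fun_int M f"
  "fun_int (with_params M) (Inr a) xs = a"
  "rel_int (with_params M) = rel_int M"
  by (auto simp: with_params_def)

lemma lang_over_simps [simp]:
  "Inl f \<in> Funs (lang_over L B) \<longleftrightarrow> f \<in> Funs L"
  "Inr a \<in> Funs (lang_over L B) \<longleftrightarrow> a \<in> B"
  "fun_ar (lang_over L B) (Inl f) = fun_ar L f"
  "fun_ar (lang_over L B) (Inr a) = 0"
  "Rels (lang_over L B) = Rels L" "rel_ar (lang_over L B) = rel_ar L"
  by (auto simp: lang_over_def)

lemma eval_inst_tm:
  "eval_tm (with_params M) v (inst_tm w t) =
   eval_tm M (\<lambda>n. case w n of None \<Rightarrow> v n | Some a \<Rightarrow> a) t"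
proof (induction t)
  case (Fn f ts)
  then have "map (eval_tm (with_params M) v \<circ> inst_tm w) ts =
     map (eval_tm M (\<lambda>n. case w n of None \<Rightarrow> v n | Some a \<Rightarrow> a)) ts"
    by auto
  then show ?case by (simp only: eval_tm.simps inst_tm.simps map_map with_params_simps)
qed (auto split: option.split)

lemma sat_inst:
  "sat (with_params M) v (inst \<phi> w) =
   sat M (\<lambda>n. case w n of None \<Rightarrow> v n | Some a \<Rightarrow> a) \<phi>"
proof (induction \<phi> arbitrary: v w)
  case (Rel r ts)
  have "map (eval_tm (with_params M) v) (map (inst_tm w) ts) =
     map (eval_tm M (\<lambda>n. case w n of None \<Rightarrow> v n | Some a \<Rightarrow> a)) ts"
    by (auto simp: eval_inst_tm)
  then show ?case by (simp only: sat.simps inst.simps with_params_simps)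
next
  case (Ex n \<phi>)
  have "(\<lambda>k. case (w(n := None)) k of None \<Rightarrow> (v(n := a)) k | Some b \<Rightarrow> b) =
    (\<lambda>k. case w k of None \<Rightarrow> v k | Some a \<Rightarrow> a)(n := a)" for a
    by (rule ext) (auto split: option.split)
  then show ?case by (simp only: inst.simps sat.simps Ex.IH with_params_simps)
qed (auto simp: eval_inst_tm)

lemma wf_inst_tm:
  "wf_tm L t \<Longrightarrow> (\<And>n a. n \<in> fv_tm t \<Longrightarrow> w n = Some a \<Longrightarrow> a \<in> B) \<Longrightarrow>
   wf_tm (lang_over L B) (inst_tm w t)"
  by (induction t) (auto split: option.split)

lemma wf_inst:
  "wf_fm L \<phi> \<Longrightarrow> (\<And>n a. n \<in> fv \<phi> \<Longrightarrow> w n = Some a \<Longrightarrow> a \<in> B) \<Longrightarrow>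
   wf_fm (lang_over L B) (inst \<phi> w)"
proof (induction \<phi> arbitrary: w)
  case (Ex n \<phi>)
  then show ?case
    by (auto intro!: Ex.IH split: if_splits)
next
  case (Rel r ts)
  then show ?case
    by (auto intro!: wf_inst_tm)
qed (auto intro!: wf_inst_tm)

lemma fv_inst_tm: "fv_tm (inst_tm w t) = {n \<in> fv_tm t. w n = None}"
  by (induction t) (auto split: option.split)

lemma fv_inst: "fv (inst \<phi> w) = {n \<in> fv \<phi>. w n = None}"
  by (induction \<phi> arbitrary: w) (auto simp: fv_inst_tm split: if_splits)

text \<open>
  Conversely, the parameter \<open>a\<close> becomes the variable \<open>f a\<close>; the indices below \<open>K\<close> are
  reserved for this by shifting the variables.
\<close>

primrec unparam_tm :: "nat \<Rightarrow> ('a \<Rightarrow> nat) \<Rightarrow> ('f + 'a) tm \<Rightarrow> 'f tm" where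
  "unparam_tm K f (Var n) = Var (n + K)"
| "unparam_tm K f (Fn h ts) =
     (case h of Inl h \<Rightarrow> Fn h (map (unparam_tm K f) ts) | Inr a \<Rightarrow> Var (f a))"

primrec unparam :: "nat \<Rightarrow> ('a \<Rightarrow> nat) \<Rightarrow> ('f + 'a, 'r) fm \<Rightarrow> ('f, 'r) fm" where
  "unparam K f (Eq s t) = Eq (unparam_tm K f s) (unparam_tm K f t)"
| "unparam K f (Rel r ts) = Rel r (map (unparam_tm K f) ts)"
| "unparam K f (Neg \<phi>) = Neg (unparam K f \<phi>)"
| "unparam K f (Conj \<phi> \<psi>) = Conj (unparam K f \<phi>) (unparam K f \<psi>)"
| "unparam K f (Ex n \<phi>) = Ex (n + K) (unparam K f \<phi>)"

primrec params_tm :: "('f + 'a) tm \<Rightarrow> 'a set" where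
  "params_tm (Var n) = {}"
| "params_tm (Fn h ts) = (case h of Inl h \<Rightarrow> \<Union> (set (map params_tm ts)) | Inr a \<Rightarrow> {a})"

primrec params :: "('f + 'a, 'r) fm \<Rightarrow> 'a set" where
  "params (Eq s t) = params_tm s \<union> params_tm t"
| "params (Rel r ts) = \<Union> (params_tm ` set ts)"
| "params (Neg \<phi>) = params \<phi>"
| "params (Conj \<phi> \<psi>) = params \<phi> \<union> params \<psi>"
| "params (Ex n \<phi>) = params \<phi>"

lemma finite_params_tm: "finite (params_tm t)"
  by (induction t) (auto split: sum.split)

lemma finite_params: "finite (params \<phi>)"
  by (induction \<phi>) (auto simp: finite_params_tm)

lemma params_tm_subset: "wf_tm (lang_over L B) t \<Longrightarrow> params_tm t \<subseteq> B"
proof (induction t)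
  case (Fn h ts)
  then show ?case by (cases h) auto
qed auto

lemma params_subset: "wf_fm (lang_over L B) \<phi> \<Longrightarrow> params \<phi> \<subseteq> B"
  by (induction \<phi>) (auto dest: params_tm_subset)

lemma wf_unparam_tm: "wf_tm (lang_over L B) t \<Longrightarrow> wf_tm L (unparam_tm K f t)"
proof (induction t)
  case (Fn h ts)
  then show ?case by (cases h) auto
qed auto

lemma wf_unparam: "wf_fm (lang_over L B) \<phi> \<Longrightarrow> wf_fm L (unparam K f \<phi>)"
  by (induction \<phi>) (auto simp: wf_unparam_tm)

lemma fv_unparam_tm: "fv_tm (unparam_tm K f t) \<subseteq> (\<lambda>n. n + K) ` fv_tm t \<union> f ` params_tm t"
proof (induction t)
  case (Fn h ts)
  show ?case
  proof (cases h)
    case (Inl h')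
    have "fv_tm (unparam_tm K f t) \<subseteq> (\<lambda>n. n + K) ` fv_tm (Fn h ts) \<union> f ` params_tm (Fn h ts)"
      if "t \<in> set ts" for t
      using Fn.IH[OF that] that Inl by (auto; blast)
    then show ?thesis by (auto simp: Inl)
  qed auto
qed auto

lemma fv_unparam:
  assumes "\<And>a. a \<in> params \<phi> \<Longrightarrow> f a < K"
  shows "fv (unparam K f \<phi>) \<subseteq> (\<lambda>n. n + K) ` fv \<phi> \<union> f ` params \<phi>"
  using assms
proof (induction \<phi>)
  case (Eq s t)
  then show ?case using fv_unparam_tm[of K f s] fv_unparam_tm[of K f t] by auto
next
  case (Rel r ts)
  show ?case
  proof
    fix n assume "n \<in> fv (unparam K f (Rel r ts))"
    then obtain t where "t \<in> set ts" "n \<in> fv_tm (unparam_tm K f t)" by auto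
    then show "n \<in> (\<lambda>n. n + K) ` fv (Rel r ts) \<union> f ` params (Rel r ts)"
      using fv_unparam_tm[of K f t] by (auto; blast)
  qed
next
  case (Conj \<phi> \<psi>)
  then show ?case by (simp add: image_Un) blast
next
  case (Ex n \<phi>)
  have "f a \<noteq> n + K" if "a \<in> params \<phi>" for a
    using Ex.prems[of a] that by simp
  then show ?case using Ex.IH Ex.prems by (simp; blast)
qed auto

lemma eval_unparam_tm:
  assumes "\<And>a. a \<in> params_tm t \<Longrightarrow> f a < K \<and> w (f a) = g a"
  shows "eval_tm (with_params M) v (map_tm (map_sum (\<lambda>x. x) g) t) =
     eval_tm M (\<lambda>k. if k < K then w k else v (k - K)) (unparam_tm K f t)"
  using assms
proof (induction t)
  case (Fn h ts)
  show ?case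
  proof (cases h)
    case (Inl h')
    have "map (eval_tm (with_params M) v \<circ> map_tm (map_sum (\<lambda>x. x) g)) ts =
        map (eval_tm M (\<lambda>k. if k < K then w k else v (k - K)) \<circ> unparam_tm K f) ts"
      using Fn Inl by auto
    then show ?thesis by (simp add: Inl del: comp_apply map_eq_conv)
  qed (use Fn in auto)
qed auto

text \<open>The map \<open>g\<close> lets one translation serve both the formula
  (\<open>g = id\<close>) and its image under an automorphism or elementary map: only the assignment
  \<open>w\<close> changes.\<close>

lemma sat_unparam:
  assumes "\<And>a. a \<in> params \<phi> \<Longrightarrow> f a < K \<and> w (f a) = g a"
  shows "sat (with_params M) v (map_params g \<phi>) =
     sat M (\<lambda>k. if k < K then w k else v (k - K)) (unparam K f \<phi>)"
  using assms unfolding map_params_def id_def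
proof (induction \<phi> arbitrary: v)
  case (Eq s t)
  have "eval_tm (with_params M) v (map_tm (map_sum (\<lambda>x. x) g) s) =
      eval_tm M (\<lambda>k. if k < K then w k else v (k - K)) (unparam_tm K f s)"
    by (rule eval_unparam_tm) (use Eq in auto)
  moreover have "eval_tm (with_params M) v (map_tm (map_sum (\<lambda>x. x) g) t) =
      eval_tm M (\<lambda>k. if k < K then w k else v (k - K)) (unparam_tm K f t)"
    by (rule eval_unparam_tm) (use Eq in auto)
  ultimately show ?case by simp
next
  case (Rel r ts)
  then have "map (eval_tm (with_params M) v \<circ> map_tm (map_sum (\<lambda>x. x) g)) ts =
        map (eval_tm M (\<lambda>k. if k < K then w k else v (k - K)) \<circ> unparam_tm K f) ts"
    by (auto intro!: eval_unparam_tm)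
  then show ?case by (simp del: comp_apply map_eq_conv)
next
  case (Ex n \<phi>)
  have "(\<lambda>k. if k < K then w k else (v(n := a)) (k - K)) =
    (\<lambda>k. if k < K then w k else v (k - K))(n + K := a)" for a
    by (rule ext) (auto simp: fun_upd_def)
  moreover have "sat (with_params M) (v(n := a)) (map_fm (map_sum (\<lambda>x. x) g) (\<lambda>x. x) \<phi>) =
      sat M (\<lambda>k. if k < K then w k else (v(n := a)) (k - K)) (unparam K f \<phi>)" for a
    by (rule Ex.IH) (use Ex.prems in simp)
  ultimately show ?case by simp
qed auto

lemma map_params_id: "map_params id \<phi> = \<phi>"
  by (simp add: map_params_def fm.map_id0 sum.map_id0)

instance tm :: (countable) countable
  by countable_datatype

instance fm :: (countable, countable) countable
  by countable_datatype

text \<open>The types \<open>'f\<close> and \<open>'r\<close> may be uncountable; numbering the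
  symbols of \<open>L\<close> embeds the well-formed formulas into the countable type of formulas
  over \<open>nat\<close>.\<close>

lemma countable_wf_fm:
  assumes "countable_lang L"
  shows "countable {\<phi>. wf_fm L \<phi>}"
proof -
  have cF: "countable (Funs L)" and cR: "countable (Rels L)"
    using assms by (auto simp: countable_lang_def)
  define \<iota> where "\<iota> = map_fm (to_nat_on (Funs L)) (to_nat_on (Rels L))"
  have sub_tm: "set_tm t \<subseteq> Funs L" if "wf_tm L t" for t
    using that by (induction t) auto
  have sub: "set1_fm \<phi> \<subseteq> Funs L \<and> set2_fm \<phi> \<subseteq> Rels L" if "wf_fm L \<phi>" for \<phi>
    using that by (induction \<phi>) (auto dest!: sub_tm)
  have "inj_on \<iota> {\<phi>. wf_fm L \<phi>}"
  proof (rule inj_onI)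
    fix \<phi> \<psi> assume a: "\<phi> \<in> {\<phi>. wf_fm L \<phi>}" "\<psi> \<in> {\<phi>. wf_fm L \<phi>}" "\<iota> \<phi> = \<iota> \<psi>"
    show "\<phi> = \<psi>"
    proof (rule fm.inj_map_strong[OF _ _ a(3)[unfolded \<iota>_def]])
      fix x y assume "x \<in> set1_fm \<phi>" "y \<in> set1_fm \<psi>" "to_nat_on (Funs L) x = to_nat_on (Funs L) y"
      then show "x = y"
        using a sub[of \<phi>] sub[of \<psi>] cF by (metis mem_Collect_eq subsetD to_nat_on_inj)
    next
      fix x y assume "x \<in> set2_fm \<phi>" "y \<in> set2_fm \<psi>" "to_nat_on (Rels L) x = to_nat_on (Rels L) y"
      then show "x = y"
        using a sub[of \<phi>] sub[of \<psi>] cR by (metis mem_Collect_eq subsetD to_nat_on_inj)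
    qed
  qed
  then show ?thesis
    by (metis countableI_type countable_image_inj_on)
qed

section \<open>Definable predicates of assignments\<close>

text \<open>
  The coordinates are indexed by an arbitrary type, so that quantifying and substituting them needs
  no care about bound variables.
\<close>

definition dfn ::
    "('f, 'r) lang \<Rightarrow> ('f, 'r, 'a) fo_struct \<Rightarrow> 'x set \<Rightarrow> (('x \<Rightarrow> 'a) \<Rightarrow> bool) \<Rightarrow> bool" where
  "dfn L M F Q \<longleftrightarrow> (\<exists>\<phi> g. wf_fm L \<phi> \<and> g ` fv \<phi> \<subseteq> F \<and> Q = (\<lambda>v. sat M (v \<circ> g) \<phi>))"

lemma dfn_sat: "wf_fm L \<phi> \<Longrightarrow> g ` fv \<phi> \<subseteq> F \<Longrightarrow> dfn L M F (\<lambda>v. sat M (v \<circ> g) \<phi>)"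
  by (auto simp: dfn_def)

lemma dfn_mono: "dfn L M F Q \<Longrightarrow> F \<subseteq> G \<Longrightarrow> dfn L M G Q"
  unfolding dfn_def by blast

lemma dfn_cong:
  assumes "dfn L M F Q" "\<And>x. x \<in> F \<Longrightarrow> v x = v' x"
  shows "Q v = Q v'"
proof -
  obtain \<phi> g where "g ` fv \<phi> \<subseteq> F" "Q = (\<lambda>v. sat M (v \<circ> g) \<phi>)"
    using assms(1) by (auto simp: dfn_def)
  then show ?thesis using assms(2) by (auto intro!: sat_cong)
qed

lemma dfn_neg: "dfn L M F Q \<Longrightarrow> dfn L M F (\<lambda>v. \<not> Q v)"
  unfolding dfn_def
proof (elim exE conjE)
  fix \<phi> g assume "wf_fm L \<phi>" "g ` fv \<phi> \<subseteq> F" "Q = (\<lambda>v. sat M (v \<circ> g) \<phi>)"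
  then show "\<exists>\<phi> g. wf_fm L \<phi> \<and> g ` fv \<phi> \<subseteq> F \<and> (\<lambda>v. \<not> Q v) = (\<lambda>v. sat M (v \<circ> g) \<phi>)"
    by (intro exI[of _ "Neg \<phi>"] exI[of _ g]) auto
qed

lemma dfn_conj:
  fixes M :: "('f, 'r, 'a) fo_struct" and Q :: "('x \<Rightarrow> 'a) \<Rightarrow> bool"
  assumes "dfn L M F Q" "dfn L M F' Q'"
  shows "dfn L M (F \<union> F') (\<lambda>v. Q v \<and> Q' v)"
proof -
  obtain \<phi> g where 1: "wf_fm L \<phi>" "g ` fv \<phi> \<subseteq> F" "Q = (\<lambda>v. sat M (v \<circ> g) \<phi>)"
    using assms(1) by (auto simp: dfn_def)
  obtain \<psi> h where 2: "wf_fm L \<psi>" "h ` fv \<psi> \<subseteq> F'" "Q' = (\<lambda>v. sat M (v \<circ> h) \<psi>)"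
    using assms(2) by (auto simp: dfn_def)
  \<comment> \<open>The two formulas may send the same variable to different coordinates, so their
    variables are separated into even and odd ones.\<close>
  define k where "k n = (if even n then g (n div 2) else h (n div 2))" for n
  define \<chi> where "\<chi> = Conj (ren \<phi> (\<lambda>n. 2 * n)) (ren \<psi> (\<lambda>n. 2 * n + 1))"
  have "v \<circ> k \<circ> (\<lambda>n. 2 * n) = v \<circ> g" "v \<circ> k \<circ> (\<lambda>n. 2 * n + 1) = v \<circ> h" for v :: "'x \<Rightarrow> 'a"
    by (simp_all add: k_def fun_eq_iff)
  then have "(\<lambda>v. Q v \<and> Q' v) = (\<lambda>v. sat M (v \<circ> k) \<chi>)"
    by (simp add: 1 2 \<chi>_def sat_ren del: comp_apply)
  moreover have "k ` fv \<chi> \<subseteq> F \<union> F'"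
  proof -
    have "fv \<chi> \<subseteq> (\<lambda>n. 2 * n) ` fv \<phi> \<union> (\<lambda>n. 2 * n + 1) ` fv \<psi>"
      using fv_ren[of \<phi> "\<lambda>n. 2 * n"] fv_ren[of \<psi> "\<lambda>n. 2 * n + 1"] by (auto simp: \<chi>_def)
    then have "k ` fv \<chi> \<subseteq> k ` (\<lambda>n. 2 * n) ` fv \<phi> \<union> k ` (\<lambda>n. 2 * n + 1) ` fv \<psi>"
      by (metis image_mono image_Un)
    also have "\<dots> = g ` fv \<phi> \<union> h ` fv \<psi>"
      by (simp only: image_image) (simp add: k_def)
    finally show ?thesis using 1 2 by blast
  qed
  moreover have "wf_fm L \<chi>" by (simp add: \<chi>_def wf_ren 1 2)
  ultimately show ?thesis unfolding dfn_def by blast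
qed

lemma dfn_imp:
  assumes "dfn L M F Q" "dfn L M F' Q'"
  shows "dfn L M (F \<union> F') (\<lambda>v. Q v \<longrightarrow> Q' v)"
  using dfn_neg[OF dfn_conj[OF assms(1) dfn_neg[OF assms(2)]]] by simp

text \<open>Several variables may be sent to the coordinate \<open>x\<close>, or none; collapsing
  them to variable 0 gives the one-variable shape used by \<open>sol\<close>,
  \<open>isolated\<close> and \<open>generic\<close>.\<close>

lemma dfn_coord:
  fixes M :: "('f, 'r, 'a) fo_struct" and Q :: "('x \<Rightarrow> 'a) \<Rightarrow> bool"
  assumes "dfn L M F Q"
  shows "\<exists>\<phi> g. wf_fm L \<phi> \<and> g ` (fv \<phi> - {0}) \<subseteq> F - {x} \<and>
    (\<forall>v a. Q (v(x := a)) \<longleftrightarrow> sat M ((v \<circ> g)(0 := a)) \<phi>)"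
proof -
  obtain \<phi> g where 1: "wf_fm L \<phi>" "g ` fv \<phi> \<subseteq> F" "Q = (\<lambda>v. sat M (v \<circ> g) \<phi>)"
    using assms(1) by (auto simp: dfn_def)
  define \<pi> where "\<pi> n = (if g n = x then 0 else Suc n)" for n
  define h where "h n = g (n - 1)" for n
  have "(v \<circ> h)(0 := a) \<circ> \<pi> = v(x := a) \<circ> g" for v :: "'x \<Rightarrow> 'a" and a
    by (auto simp: \<pi>_def h_def)
  then have "\<forall>v a. Q (v(x := a)) \<longleftrightarrow> sat M ((v \<circ> h)(0 := a)) (ren \<phi> \<pi>)"
    by (simp add: 1 sat_ren del: comp_apply)
  moreover have "h ` (fv (ren \<phi> \<pi>) - {0}) \<subseteq> F - {x}"
  proof (rule image_subsetI)
    fix n assume n: "n \<in> fv (ren \<phi> \<pi>) - {0}"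
    then obtain m where "m \<in> fv \<phi>" "n = \<pi> m" using fv_ren[of \<phi> \<pi>] by blast
    then show "h n \<in> F - {x}"
      using n 1 by (auto simp: \<pi>_def h_def split: if_splits)
  qed
  moreover have "wf_fm L (ren \<phi> \<pi>)" by (simp add: 1 wf_ren)
  ultimately show ?thesis by blast
qed

lemma dfn_ex:
  assumes "dfn L M F Q"
  shows "dfn L M (F - {x}) (\<lambda>v. \<exists>a\<in>universe M. Q (v(x := a)))"
proof -
  obtain \<phi> g where "wf_fm L \<phi>" "g ` (fv \<phi> - {0}) \<subseteq> F - {x}"
    "\<forall>v a. Q (v(x := a)) \<longleftrightarrow> sat M ((v \<circ> g)(0 := a)) \<phi>"
    using dfn_coord[OF assms, of x] by blast
  then show ?thesis
    unfolding dfn_def by (intro exI[of _ "Ex 0 \<phi>"] exI[of _ g]) (simp del: comp_apply)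
qed

lemma dfn_all:
  assumes "dfn L M F Q"
  shows "dfn L M (F - {x}) (\<lambda>v. \<forall>a\<in>universe M. Q (v(x := a)))"
  using dfn_neg[OF dfn_ex[OF dfn_neg[OF assms]]] by simp

lemma dfn_reindex:
  assumes "dfn L M F Q"
  shows "dfn L M (h ` F) (\<lambda>v. Q (v \<circ> h))"
proof -
  obtain \<phi> g where 1: "wf_fm L \<phi>" "g ` fv \<phi> \<subseteq> F" "Q = (\<lambda>v. sat M (v \<circ> g) \<phi>)"
    using assms(1) by (auto simp: dfn_def)
  then show ?thesis
    unfolding dfn_def by (intro exI[of _ \<phi>] exI[of _ "h \<circ> g"]) (auto simp: comp_assoc)
qed

lemma dfn_eq: "dfn L M {x, y} (\<lambda>v. v x = v y)"
  unfolding dfn_def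
  by (intro exI[of _ "Eq (Var 0) (Var 1)"] exI[of _ "\<lambda>n. if n = 0 then x else y"]) auto

lemma dfn_subst:
  fixes M :: "('f, 'r, 'a) fo_struct" and Q :: "('x \<Rightarrow> 'a) \<Rightarrow> bool"
  assumes "dfn L M F Q"
  shows "dfn L M (insert y (F - {x})) (\<lambda>v. Q (v(x := v y)))"
proof -
  have "dfn L M (id(x := y) ` F) (\<lambda>v. Q (v \<circ> id(x := y)))"
    by (rule dfn_reindex[OF assms])
  moreover have "v \<circ> id(x := y) = v(x := v y)" for v :: "'x \<Rightarrow> 'a" by auto
  ultimately show ?thesis by (auto elim!: dfn_mono split: if_splits)
qed

section \<open>The strongly regular type in the monster model\<close>

lemma eval_tm_aut:
  assumes "is_struct L M" "is_aut L M g" "range v \<subseteq> universe M" "wf_tm L t"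
  shows "eval_tm M (g \<circ> v) t = g (eval_tm M v t)"
  using assms(4)
proof (induction t)
  case (Fn f ts)
  have "map (eval_tm M v) ts \<in> lists (universe M)"
    using Fn.prems eval_tm_in_universe[OF assms(1) _ assms(3)] by auto
  then have "g (fun_int M f (map (eval_tm M v) ts)) = fun_int M f (map g (map (eval_tm M v) ts))"
    using assms(2) Fn.prems unfolding is_aut_def by (metis length_map wf_tm_Fn)
  moreover have "map g (map (eval_tm M v) ts) = map (eval_tm M (g \<circ> v)) ts"
    using Fn by (auto simp: comp_def)
  ultimately show ?case by (simp only: eval_tm.simps)
qed auto

lemma sat_aut:
  assumes "is_struct L M" "is_aut L M g" "range v \<subseteq> universe M" "wf_fm L \<phi>"
  shows "sat M (g \<circ> v) \<phi> = sat M v \<phi>"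
  using assms(3,4)
proof (induction \<phi> arbitrary: v)
  case (Eq s t)
  have "inj_on g (universe M)" using assms(2) by (auto simp: is_aut_def bij_betw_def)
  moreover have "eval_tm M v s \<in> universe M" "eval_tm M v t \<in> universe M"
    using Eq eval_tm_in_universe[OF assms(1)] by auto
  ultimately have "g (eval_tm M v s) = g (eval_tm M v t) \<longleftrightarrow> eval_tm M v s = eval_tm M v t"
    by (auto dest: inj_onD)
  moreover have "eval_tm M (g \<circ> v) s = g (eval_tm M v s)" "eval_tm M (g \<circ> v) t = g (eval_tm M v t)"
    using Eq by (auto intro!: eval_tm_aut[OF assms(1,2)] simp del: comp_apply)
  ultimately show ?case by (simp only: sat.simps)
next
  case (Rel r ts)
  have "map (eval_tm M v) ts \<in> lists (universe M)"
    using Rel.prems eval_tm_in_universe[OF assms(1) _ Rel.prems(1)] by auto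
  then have "rel_int M r (map (eval_tm M v) ts) = rel_int M r (map g (map (eval_tm M v) ts))"
    using assms(2) Rel.prems unfolding is_aut_def by (metis length_map wf_fm_Rel)
  moreover have "map g (map (eval_tm M v) ts) = map (eval_tm M (g \<circ> v)) ts"
    using Rel eval_tm_aut[OF assms(1,2) Rel.prems(1)] by (auto simp: comp_def)
  ultimately show ?case by (simp only: sat.simps)
next
  case (Ex n \<phi>)
  have g: "g ` universe M = universe M"
    using assms(2) by (auto simp: is_aut_def bij_betw_def)
  have "sat M ((g \<circ> v)(n := g a)) \<phi> = sat M (v(n := a)) \<phi>" if "a \<in> universe M" for a
  proof -
    have "(g \<circ> v)(n := g a) = g \<circ> v(n := a)" by (simp add: fun_upd_comp)
    then show ?thesis using Ex that by (simp del: comp_apply) (subst Ex.IH; auto)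
  qed
  then have "(\<exists>b\<in>g ` universe M. sat M ((g \<circ> v)(n := b)) \<phi>) \<longleftrightarrow>
      (\<exists>a\<in>universe M. sat M (v(n := a)) \<phi>)"
    by (auto simp del: comp_apply)
  then show ?case unfolding g by (simp del: comp_apply)
qed auto

section \<open>Sets definable with parameters\<close>

definition sol :: "('f, 'r, 'a) fo_struct \<Rightarrow> ('f, 'r) fm \<Rightarrow> (nat \<Rightarrow> 'a) \<Rightarrow> 'a set" where
  "sol M \<phi> w = {x \<in> universe M. sat M (w(0 := x)) \<phi>}"

lemma sol_cong: "(\<And>n. n \<in> fv \<phi> - {0} \<Longrightarrow> w n = w' n) \<Longrightarrow> sol M \<phi> w = sol M \<phi> w'"
  unfolding sol_def by (intro Collect_cong conj_cong refl sat_cong) auto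

definition Def :: "('f, 'r) lang \<Rightarrow> ('f, 'r, 'a) fo_struct \<Rightarrow> 'a set \<Rightarrow> 'a set set" where
  "Def L M B = solutions M ` fmls1 L B"

lemma sol_Def:
  assumes "wf_fm L \<phi>" "w ` (fv \<phi> - {0}) \<subseteq> B"
  shows "sol M \<phi> w \<in> Def L M B"
proof -
  define u where "u n = (if n = 0 then None else Some (w n))" for n :: nat
  have "inst \<phi> u \<in> fmls1 L B"
    using assms by (auto simp: fmls1_def fv_inst u_def image_subset_iff intro!: wf_inst split: if_splits)
  moreover have "(\<lambda>n. case u n of None \<Rightarrow> x | Some a \<Rightarrow> a) = w(0 := x)" for x
    by (auto simp: u_def)
  then have "solutions M (inst \<phi> u) = sol M \<phi> w"
    by (simp add: solutions_def sat1_def sat_inst sol_def)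
  ultimately show ?thesis unfolding Def_def by blast
qed

lemma params_assignment:
  assumes "wf_fm (lang_over L B) \<chi>" "u \<in> U" "B \<subseteq> U"
  obtains K :: nat and f w where "\<forall>a\<in>params \<chi>. f a < K \<and> w (f a) = a" "range w \<subseteq> U"
proof -
  define f where "f = to_nat_on (params \<chi>)"
  have inj: "inj_on f (params \<chi>)"
    unfolding f_def by (rule inj_on_to_nat_on) (simp add: countable_finite finite_params)
  define w where "w k = (if k \<in> f ` params \<chi> then the_inv_into (params \<chi>) f k else u)" for k
  have wf: "w (f a) = a" if "a \<in> params \<chi>" for a
    using that inj by (simp add: w_def the_inv_into_f_f)
  have "f a < Suc (Max (f ` params \<chi>))" if "a \<in> params \<chi>" for a
    using that by (simp add: finite_params less_Suc_eq_le)
  then have "\<forall>a\<in>params \<chi>. f a < Suc (Max (f ` params \<chi>)) \<and> w (f a) = a" using wf by blast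
  moreover have "w k \<in> U" for k
    using assms(2,3) params_subset[OF assms(1)] wf by (auto simp: w_def)
  then have "range w \<subseteq> U" by blast
  ultimately show ?thesis by (rule that)
qed

text \<open>From here on parameters are values of variables other than 0 in a formula of
  \<open>L\<close>. The default \<open>u\<close> keeps the whole assignment inside \<open>U\<close>,
  as automorphisms and ultrapowers require.\<close>

lemma fmls1_assignment:
  assumes "\<chi> \<in> fmls1 L B" "u \<in> U" "B \<subseteq> U"
  shows "\<exists>\<phi> w. wf_fm L \<phi> \<and> w ` (fv \<phi> - {0}) \<subseteq> B \<and> range w \<subseteq> U \<and>
    (\<forall>x. sat1 M \<chi> x \<longleftrightarrow> sat M (w(0 := x)) \<phi>)"
proof -
  have wfc: "wf_fm (lang_over L B) \<chi>" "fv \<chi> \<subseteq> {0}" using assms by (auto simp: fmls1_def)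
  have pB: "params \<chi> \<subseteq> B" using params_subset[OF wfc(1)] .
  obtain K :: nat and f w0 where fw: "\<forall>a\<in>params \<chi>. f a < K \<and> w0 (f a) = a" and w0U: "range w0 \<subseteq> U"
    by (rule params_assignment[OF wfc(1) assms(2,3)])
  have K: "f a < K" and w0f: "w0 (f a) = a" if "a \<in> params \<chi>" for a
    using fw that by blast+
  define \<pi> where "\<pi> k = (if k < K then Suc k else 0)" for k
  define \<phi> where "\<phi> = ren (unparam K f \<chi>) \<pi>"
  define w where "w k = w0 (k - 1)" for k
  have "sat1 M \<chi> x \<longleftrightarrow> sat M (w(0 := x)) \<phi>" for x
  proof -
    have "sat1 M \<chi> x \<longleftrightarrow> sat M (\<lambda>k. if k < K then w0 k else x) (unparam K f \<chi>)"
      using sat_unparam[of \<chi> f K w0 id M "\<lambda>_. x"] K w0f by (simp add: sat1_def map_params_id)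
    moreover have "(w(0 := x)) \<circ> \<pi> = (\<lambda>k. if k < K then w0 k else x)"
      by (auto simp: w_def \<pi>_def)
    ultimately show ?thesis by (simp add: \<phi>_def sat_ren del: comp_apply)
  qed
  moreover have "w ` (fv \<phi> - {0}) \<subseteq> B"
  proof (rule image_subsetI)
    fix n assume n: "n \<in> fv \<phi> - {0}"
    then obtain m where "m \<in> fv (unparam K f \<chi>)" "n = \<pi> m"
      using fv_ren[of "unparam K f \<chi>" \<pi>] by (auto simp: \<phi>_def)
    moreover have "m < K" using n calculation by (auto simp: \<pi>_def split: if_splits)
    ultimately obtain a where "a \<in> params \<chi>" "m = f a"
      using fv_unparam[of \<chi> f K] K by fastforce
    then show "w n \<in> B" using \<open>n = \<pi> m\<close> \<open>m < K\<close> w0f pB by (auto simp: w_def \<pi>_def)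
  qed
  moreover have "wf_fm L \<phi>" by (simp add: \<phi>_def wf_ren wf_unparam[OF wfc(1)])
  moreover have "range w \<subseteq> U" using w0U by (auto simp: w_def)
  ultimately show ?thesis by blast
qed

lemma Def_sol:
  assumes "D \<in> Def L M B" "B \<subseteq> universe M" "universe M \<noteq> {}"
  shows "\<exists>\<phi> w. wf_fm L \<phi> \<and> w ` (fv \<phi> - {0}) \<subseteq> B \<and> range w \<subseteq> universe M \<and> D = sol M \<phi> w"
proof -
  obtain \<chi> where "\<chi> \<in> fmls1 L B" "D = solutions M \<chi>" using assms(1) by (auto simp: Def_def)
  moreover obtain u where "u \<in> universe M" using assms(3) by blast
  ultimately obtain \<phi> w where *: "wf_fm L \<phi>" "w ` (fv \<phi> - {0}) \<subseteq> B" "range w \<subseteq> universe M"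
      "\<forall>x. sat1 M \<chi> x \<longleftrightarrow> sat M (w(0 := x)) \<phi>"
    using fmls1_assignment[OF _ _ assms(2)] by metis
  then have "D = sol M \<phi> w" using \<open>D = solutions M \<chi>\<close> by (auto simp: solutions_def sol_def)
  with * show ?thesis by blast
qed

lemma fmls1_mono:
  assumes "B \<subseteq> B'"
  shows "fmls1 L B \<subseteq> fmls1 L B'"
proof -
  have tm: "wf_tm (lang_over L B) t \<Longrightarrow> wf_tm (lang_over L B') t" for t
  proof (induction t)
    case (Fn h ts)
    then show ?case using assms by (cases h) auto
  qed auto
  have "wf_fm (lang_over L B) \<chi> \<Longrightarrow> wf_fm (lang_over L B') \<chi>" for \<chi>
    by (induction \<chi>) (auto simp: tm)
  then show ?thesis by (auto simp: fmls1_def)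
qed

lemma Def_mono: "B \<subseteq> B' \<Longrightarrow> Def L M B \<subseteq> Def L M B'"
  unfolding Def_def by (rule image_mono) (rule fmls1_mono)

lemma Def_compl: "D \<in> Def L M B \<Longrightarrow> universe M - D \<in> Def L M B"
proof -
  assume "D \<in> Def L M B"
  then obtain \<chi> where "\<chi> \<in> fmls1 L B" "D = solutions M \<chi>" by (auto simp: Def_def)
  then have "Neg \<chi> \<in> fmls1 L B" "universe M - D = solutions M (Neg \<chi>)"
    by (auto simp: fmls1_def solutions_def sat1_def)
  then show ?thesis unfolding Def_def by blast
qed

lemma countable_card_less:
  fixes \<kappa> :: "'k rel"
  assumes "countable A" "natLeq <o \<kappa>"
  shows "|A| <o \<kappa>"
proof -
  have "|A| \<le>o |UNIV :: nat set|"
    using assms(1) by (auto simp: countable_def card_of_ordLeq[symmetric])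
  also have "|UNIV :: nat set| =o natLeq" by (rule card_of_nat)
  finally show ?thesis using assms(2) by (rule ordLeq_ordLess_trans)
qed

section \<open>The monster and its type, with membership in \<open>p\<close> read as a property of
  definable sets\<close>

locale regular_type =
  fixes L :: "('f, 'r) lang" and T :: "('f, 'r) fm set" and \<kappa> :: "'k rel"
    and C :: "('f, 'r, 'm) fo_struct" and p :: "('f + 'm, 'r) fm set"
  assumes countable_L: "countable_lang L"
    and monster: "monster L T \<kappa> C"
    and stable: "stable_theory L C"
    and regular: "strongly_regular L \<kappa> C p"
begin

abbreviation U where "U \<equiv> universe C"

lemma is_struct_C: "is_struct L C"
  using monster by (simp add: monster_def is_model_def)

lemma U_ne: "U \<noteq> {}"
  using is_struct_C by (simp add: is_struct_def)

lemma small_countable: "countable B \<Longrightarrow> B \<subseteq> U \<Longrightarrow> small \<kappa> C B"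
  using monster countable_card_less unfolding small_def monster_def by blast

text \<open>Strong homogeneity concerns maps on sets; this form compares sequences, which may have
  repetitions. The function \<open>f\<close> selects one position for each value.\<close>

lemma homogeneous:
  assumes w: "range w \<subseteq> U" and w': "range w' \<subseteq> U"
    and eq: "\<And>\<phi>. wf_fm L \<phi> \<Longrightarrow> fv \<phi> \<subseteq> Z \<Longrightarrow> sat C w \<phi> = sat C w' \<phi>"
  shows "\<exists>g. is_aut L C g \<and> (\<forall>i\<in>Z. g (w i) = w' i)"
proof -
  define f where "f a = (SOME i. i \<in> Z \<and> w i = a)" for a
  have f: "f a \<in> Z \<and> w (f a) = a" if "a \<in> w ` Z" for a
    unfolding f_def by (rule someI_ex) (use that in blast)
  have key: "holds (with_params C) (map_params h \<sigma>) \<longleftrightarrow> sat C u (unparam (Suc (Max (f ` params \<sigma>))) f \<sigma>)"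
    if \<sigma>: "\<sigma> \<in> sentences (lang_over L (w ` Z))" and u: "range u \<subseteq> U"
      and h: "\<And>a. a \<in> w ` Z \<Longrightarrow> u (f a) = h a" for \<sigma> :: "('f + 'm, 'r) fm" and u h
  proof -
    define K where "K = Suc (Max (f ` params \<sigma>))"
    have \<sigma>': "wf_fm (lang_over L (w ` Z)) \<sigma>" "fv \<sigma> = {}" using \<sigma> by (auto simp: sentences_def)
    have pZ: "params \<sigma> \<subseteq> w ` Z" by (rule params_subset[OF \<sigma>'(1)])
    have K: "f a < K" if "a \<in> params \<sigma>" for a
      using that by (simp add: K_def finite_params less_Suc_eq_le)
    have fvK: "n < K" if "n \<in> fv (unparam K f \<sigma>)" for n
      using that fv_unparam[of \<sigma> f K] K \<sigma>' by auto
    have "sat (with_params C) v (map_params h \<sigma>) = sat C u (unparam K f \<sigma>)" for v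
    proof -
      have "sat (with_params C) v (map_params h \<sigma>) =
          sat C (\<lambda>k. if k < K then u k else v (k - K)) (unparam K f \<sigma>)"
        by (rule sat_unparam) (use K h pZ in auto)
      also have "\<dots> = sat C u (unparam K f \<sigma>)"
        by (rule sat_cong) (use fvK in auto)
      finally show ?thesis .
    qed
    then show ?thesis using u unfolding holds_def K_def by auto
  qed
  have "elementary_map L C (w ` Z) (w' \<circ> f)"
    unfolding elementary_map_def
  proof (intro conjI ballI)
    fix \<sigma> :: "('f + 'm, 'r) fm" assume \<sigma>: "\<sigma> \<in> sentences (lang_over L (w ` Z))"
    let ?\<psi> = "unparam (Suc (Max (f ` params \<sigma>))) f \<sigma>"
    have \<sigma>': "wf_fm (lang_over L (w ` Z)) \<sigma>" "fv \<sigma> = {}" using \<sigma> by (auto simp: sentences_def)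
    have "fv ?\<psi> \<subseteq> f ` params \<sigma>"
      using fv_unparam[of \<sigma> f "Suc (Max (f ` params \<sigma>))"] \<sigma>'
      by (simp add: finite_params less_Suc_eq_le)
    then have "fv ?\<psi> \<subseteq> Z" using f params_subset[OF \<sigma>'(1)] by blast
    then have "sat C w ?\<psi> = sat C w' ?\<psi>" by (rule eq[OF wf_unparam[OF \<sigma>'(1)]])
    then show "holds (with_params C) \<sigma> = holds (with_params C) (map_params (w' \<circ> f) \<sigma>)"
      using key[OF \<sigma> w, of id] key[OF \<sigma> w', of "w' \<circ> f"] f by (simp add: map_params_id)
  qed (use w w' in auto)
  moreover have "small \<kappa> C (w ` Z)"
  proof (rule small_countable)
    have "countable Z" by (rule countableI_type)
    then show "countable (w ` Z)" by (rule countable_image)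
  qed (use w in auto)
  ultimately obtain g where g: "is_aut L C g" "\<forall>a\<in>w ` Z. g a = w' (f a)"
    using monster unfolding monster_def strongly_homogeneous_def by fastforce
  have "g (w i) = w' i" if i: "i \<in> Z" for i
  proof -
    have fi: "f (w i) \<in> Z" "w (f (w i)) = w i" using f[of "w i"] i by auto
    \<comment> \<open>The position selected for the value \<open>w i\<close> need not be
      \<open>i\<close>, but the equation between the two variables transfers to
      \<open>w'\<close>.\<close>
    have "sat C w (Eq (Var (f (w i))) (Var i)) = sat C w' (Eq (Var (f (w i))) (Var i))"
      by (rule eq) (use i fi in auto)
    then show ?thesis using g(2) i fi by simp
  qed
  then show ?thesis using g(1) by blast
qed

text \<open>\<open>pp D\<close>: a formula defining \<open>D\<close> belongs to \<open>p\<close>; \<open>R a B\<close>: \<open>a\<close> realises \<open>p|B\<close>.\<close>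

definition pp :: "'m set \<Rightarrow> bool" where
  "pp D \<longleftrightarrow> D \<in> solutions C ` p"

definition R :: "'m \<Rightarrow> 'm set \<Rightarrow> bool" where
  "R a B \<longleftrightarrow> a \<in> U \<and> (\<forall>D\<in>Def L C B. pp D \<longrightarrow> a \<in> D)"

lemma p_complete: "complete_type L C U p"
  using regular by (simp add: strongly_regular_def global_type_def)

lemma pp_cases: "D \<in> Def L C U \<Longrightarrow> pp D \<or> pp (U - D)"
proof -
  assume "D \<in> Def L C U"
  then obtain \<chi> where \<chi>: "\<chi> \<in> fmls1 L U" "D = solutions C \<chi>" by (auto simp: Def_def)
  then have "\<chi> \<in> p \<or> Neg \<chi> \<in> p" using p_complete by (auto simp: complete_type_def)
  moreover have "U - D = solutions C (Neg \<chi>)"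
    using \<chi> by (auto simp: solutions_def sat1_def)
  ultimately show ?thesis using \<chi> unfolding pp_def by blast
qed

lemma pp_meet: "pp D \<Longrightarrow> pp E \<Longrightarrow> D \<inter> E \<noteq> {}"
proof -
  assume "pp D" "pp E"
  then obtain \<chi> \<psi> where *: "\<chi> \<in> p" "\<psi> \<in> p" "D = solutions C \<chi>" "E = solutions C \<psi>"
    by (auto simp: pp_def)
  then have "finite {\<chi>, \<psi>}" "{\<chi>, \<psi>} \<subseteq> p" by auto
  then obtain a where "realises C a {\<chi>, \<psi>}"
    using p_complete unfolding complete_type_def by blast
  then have "a \<in> D \<inter> E" using * by (auto simp: realises_def solutions_def)
  then show ?thesis by blast
qed

lemma pp_compl: "D \<in> Def L C U \<Longrightarrow> pp (U - D) \<longleftrightarrow> \<not> pp D"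
  using pp_cases[of D] pp_meet[of D "U - D"] by blast

lemma pp_infinite: "pp D \<Longrightarrow> infinite D"
  using regular by (auto simp: strongly_regular_def non_algebraic_def pp_def)

lemma pp_aut:
  assumes "is_aut L C g" "pp D"
  shows "pp (g ` D)"
proof -
  obtain \<chi> where \<chi>: "\<chi> \<in> p" "D = solutions C \<chi>" using assms by (auto simp: pp_def)
  have g: "g ` U = U" "bij_betw g U U" using assms(1) by (auto simp: is_aut_def bij_betw_def)
  have "map_params g \<chi> \<in> p"
    using regular assms(1) \<chi>(1) by (auto simp: strongly_regular_def aut_invariant_def)
  moreover have "solutions C (map_params g \<chi>) = g ` D"
  proof -
    have wfc: "wf_fm (lang_over L U) \<chi>"
      using p_complete \<chi> by (auto simp: complete_type_def fmls1_def)
    obtain u where u: "u \<in> U" using U_ne by blast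
    obtain K :: nat and f w where fw: "\<forall>a\<in>params \<chi>. f a < K \<and> w (f a) = a" and wr: "range w \<subseteq> U"
      by (rule params_assignment[OF wfc u order_refl])
    have K: "f a < K" and wf: "w (f a) = a" if "a \<in> params \<chi>" for a
      using fw that by blast+
    have wU: "w k \<in> U" for k using wr by auto
    have "sat1 C (map_params g \<chi>) (g x) = sat1 C \<chi> x" if x: "x \<in> U" for x
    proof -
      have "sat1 C (map_params g \<chi>) (g x) =
          sat C (\<lambda>k. if k < K then g (w k) else g x) (unparam K f \<chi>)"
        unfolding sat1_def by (rule sat_unparam[where v = "\<lambda>_. g x" and w = "\<lambda>k. g (w k)"]) (use K wf in auto)
      also have "(\<lambda>k. if k < K then g (w k) else g x) = g \<circ> (\<lambda>k. if k < K then w k else x)"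
        by auto
      also have "sat C (g \<circ> (\<lambda>k. if k < K then w k else x)) (unparam K f \<chi>) =
          sat C (\<lambda>k. if k < K then w k else x) (unparam K f \<chi>)"
        by (rule sat_aut[OF is_struct_C assms(1) _ wf_unparam[OF wfc]]) (use wU x in auto)
      also have "\<dots> = sat1 C (map_params id \<chi>) x"
        unfolding sat1_def by (rule sat_unparam[where v = "\<lambda>_. x" and w = w, symmetric]) (use K wf in auto)
      finally show ?thesis by (simp add: map_params_id)
    qed
    then have "{y \<in> g ` U. sat1 C (map_params g \<chi>) y} = g ` {x \<in> U. sat1 C \<chi> x}"
      by blast
    then show ?thesis unfolding g(1) \<chi>(2) solutions_def .
  qed
  ultimately show ?thesis unfolding pp_def by blast
qed

text \<open>\<open>pp\<close> sees solution sets, not formulas. Nothing is lost: a formula outside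
  \<open>p\<close> with the solution set of a formula in \<open>p\<close> would put a set and its
  complement into \<open>p\<close>.\<close>

lemma R_iff_realises: "B \<subseteq> U \<Longrightarrow> R a B \<longleftrightarrow> realises C a (restrict_type L p B)"
proof -
  assume B: "B \<subseteq> U"
  have "\<chi> \<in> p" if "\<chi> \<in> fmls1 L B" "pp (solutions C \<chi>)" for \<chi>
  proof (rule ccontr)
    assume "\<chi> \<notin> p"
    have "\<chi> \<in> fmls1 L U" using that(1) fmls1_mono[OF B] by blast
    then have "Neg \<chi> \<in> p" using p_complete \<open>\<chi> \<notin> p\<close> by (auto simp: complete_type_def)
    moreover have "solutions C (Neg \<chi>) = U - solutions C \<chi>"
      by (auto simp: solutions_def sat1_def)
    ultimately have "pp (U - solutions C \<chi>)" unfolding pp_def by (metis image_eqI)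
    then show False using pp_meet[OF that(2)] by blast
  qed
  then show ?thesis
    unfolding R_def Def_def realises_def restrict_type_def pp_def by (auto simp: solutions_def)
qed

lemma R_mono: "R a B \<Longrightarrow> B' \<subseteq> B \<Longrightarrow> R a B'"
  using Def_mono[of B' B L C] by (auto simp: R_def)

lemma R_ex: 
  assumes "countable B" "B \<subseteq> U"
  shows "\<exists>a. R a B"
proof -
  have "fmls1 L B \<subseteq> fmls1 L U" by (rule fmls1_mono[OF assms(2)])
  moreover have "Neg \<chi> \<in> fmls1 L B" if "\<chi> \<in> fmls1 L B" for \<chi>
    using that by (auto simp: fmls1_def)
  ultimately have "complete_type L C B (restrict_type L p B)"
    using p_complete unfolding complete_type_def restrict_type_def by (auto; blast)
  then obtain a where "realises C a (restrict_type L p B)"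
    using monster small_countable[OF assms] unfolding monster_def saturated_def by blast
  then show ?thesis using R_iff_realises[OF assms(2)] by blast
qed

lemma R_strongly_regular:
  assumes "countable B" "B \<subseteq> U" "q \<in> U" "\<not> R q B" "R c B"
  shows "R c (insert q B)"
  using regular small_countable[OF assms(1,2)] assms R_iff_realises[of B] R_iff_realises[of "insert q B"]
  unfolding strongly_regular_def type_entails_def by (metis insert_subset)

lemma R_sat:
  assumes "R a B" "wf_fm L \<phi>" "w ` (fv \<phi> - {0}) \<subseteq> B" "B \<subseteq> U"
  shows "sat C (w(0 := a)) \<phi> \<longleftrightarrow> pp (sol C \<phi> w)"
proof -
  have D: "sol C \<phi> w \<in> Def L C B" by (rule sol_Def[OF assms(2,3)])
  then have DU: "sol C \<phi> w \<in> Def L C U" using Def_mono[OF assms(4)] by blast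
  have "a \<in> U" using assms(1) by (simp add: R_def)
  have "a \<in> sol C \<phi> w \<longleftrightarrow> pp (sol C \<phi> w)"
    using D assms(1) Def_compl[OF D] pp_cases[OF DU] unfolding R_def by blast
  then show ?thesis using \<open>a \<in> U\<close> by (simp add: sol_def)
qed

text \<open>Invariance directly gives one direction; applied to the negated formula it also gives
  the converse, without passing to the inverse of \<open>g\<close>.\<close>

lemma pp_sol_aut:
  assumes "is_aut L C g" "wf_fm L \<phi>" "range w \<subseteq> U"
  shows "pp (sol C \<phi> (g \<circ> w)) \<longleftrightarrow> pp (sol C \<phi> w)"
proof -
  have g: "g ` U = U" using assms(1) by (auto simp: is_aut_def bij_betw_def)
  have im: "sol C \<psi> (g \<circ> w) = g ` sol C \<psi> w" if "wf_fm L \<psi>" for \<psi>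
  proof -
    have "sat C ((g \<circ> w)(0 := g x)) \<psi> = sat C (w(0 := x)) \<psi>" if "x \<in> U" for x
    proof -
      have "(g \<circ> w)(0 := g x) = g \<circ> w(0 := x)" by (simp add: fun_upd_comp)
      then show ?thesis
        using sat_aut[OF is_struct_C assms(1) _ \<open>wf_fm L \<psi>\<close>, of "w(0 := x)"] assms(3) that
        by (auto simp del: comp_apply)
    qed
    then have "{y \<in> g ` U. sat C ((g \<circ> w)(0 := y)) \<psi>} = g ` {x \<in> U. sat C (w(0 := x)) \<psi>}"
      by blast
    then show ?thesis unfolding g sol_def .
  qed
  have 1: "pp (sol C \<psi> w) \<Longrightarrow> pp (sol C \<psi> (g \<circ> w))" if "wf_fm L \<psi>" for \<psi>
    unfolding im[OF that] by (rule pp_aut[OF assms(1)])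
  have neg: "sol C (Neg \<phi>) u = U - sol C \<phi> u" for u by (auto simp: sol_def)
  have DU: "sol C \<phi> u \<in> Def L C U" if "range u \<subseteq> U" for u
    by (rule sol_Def[OF assms(2)]) (use that in auto)
  have gw: "range (g \<circ> w) \<subseteq> U" using assms(3) g by fastforce
  show ?thesis
    using 1[OF assms(2)] 1[of "Neg \<phi>"] assms(2) pp_compl[OF DU[OF gw]] pp_compl[OF DU[OF assms(3)]]
    by (auto simp: neg)
qed

end

section \<open>Morley sequences\<close>

text \<open>Dependent choice where each step sees all earlier terms; the second hypothesis says that
  \<open>Q n f\<close> looks at \<open>f\<close> only below \<open>n\<close>.\<close>

lemma seq_choice:
  fixes Q :: "nat \<Rightarrow> (nat \<Rightarrow> 'a) \<Rightarrow> 'a \<Rightarrow> bool"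
  assumes "\<And>n f. (\<And>m. m < n \<Longrightarrow> Q m f (f m)) \<Longrightarrow> \<exists>x. Q n f x"
    and "\<And>n f g x. (\<And>m. m < n \<Longrightarrow> f m = g m) \<Longrightarrow> Q n f x = Q n g x"
  shows "\<exists>f. \<forall>n. Q n f (f n)"
proof (rule dependent_wf_choice[of less_than "\<lambda>f n. Q n f"])
  show "\<And>f g x r. (\<And>z. (z, x) \<in> less_than \<Longrightarrow> f z = g z) \<Longrightarrow> Q x f r = Q x g r"
    by (rule assms(2)) simp
  show "\<And>x f. (\<And>y. (y, x) \<in> less_than \<Longrightarrow> Q y f (f y)) \<Longrightarrow> \<exists>r. Q x f r"
    by (rule assms(1)) simp
qed simp

lemma sol_Neg: "sol M (Neg \<phi>) w = universe M - sol M \<phi> w"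
  by (auto simp: sol_def)

context regular_type
begin

lemma no_order_property:
  fixes a b :: "nat \<Rightarrow> nat \<Rightarrow> 'm"
  assumes "wf_fm L \<phi>" "\<And>i n. a i n \<in> U" "\<And>i n. b i n \<in> U"
    and "\<And>i j. sat C (\<lambda>n. if n \<in> X then a i n else b j n) \<phi> \<longleftrightarrow> i < j"
  shows False
proof -
  have "\<exists>\<phi> X (a :: nat \<Rightarrow> nat \<Rightarrow> 'm) (b :: nat \<Rightarrow> nat \<Rightarrow> 'm). wf_fm L \<phi> \<and>
      (\<forall>i n. a i n \<in> U \<and> b i n \<in> U) \<and>
      (\<forall>i j. sat C (\<lambda>n. if n \<in> X then a i n else b j n) \<phi> \<longleftrightarrow> i < j)"
    by (intro exI[of _ \<phi>] exI[of _ X] exI[of _ a] exI[of _ b]) (use assms in simp)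
  then show False using stable by (simp add: stable_theory_def)
qed

abbreviation P where "P \<phi> w \<equiv> pp (sol C \<phi> w)"

lemma P_Neg: "wf_fm L \<phi> \<Longrightarrow> range w \<subseteq> U \<Longrightarrow> P (Neg \<phi>) w \<longleftrightarrow> \<not> P \<phi> w"
  unfolding sol_Neg by (rule pp_compl) (rule sol_Def; auto)

definition morley :: "(nat \<Rightarrow> 'm) \<Rightarrow> bool" where
  "morley a \<longleftrightarrow> (\<forall>n. R (a n) (a ` {..<n}))"

lemma morley_in_U: "morley a \<Longrightarrow> a n \<in> U"
  by (simp add: morley_def R_def)

lemma morley_over:
  assumes "countable B" "B \<subseteq> U"
  shows "\<exists>a :: nat \<Rightarrow> 'm. \<forall>n. R (a n) (B \<union> a ` {..<n})"
proof (rule seq_choice[of "\<lambda>n a x. R x (B \<union> a ` {..<n})"])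
  fix n and f :: "nat \<Rightarrow> 'm"
  assume "\<And>m. m < n \<Longrightarrow> R (f m) (B \<union> f ` {..<m})"
  then have "B \<union> f ` {..<n} \<subseteq> U" using assms by (auto simp: R_def)
  then show "\<exists>x. R x (B \<union> f ` {..<n})" using assms by (intro R_ex) auto
next
  fix n and f g :: "nat \<Rightarrow> 'm" and x
  assume "\<And>m. m < n \<Longrightarrow> f m = g m"
  then have "f ` {..<n} = g ` {..<n}" by (intro image_cong) auto
  then show "R x (B \<union> f ` {..<n}) = R x (B \<union> g ` {..<n})" by simp
qed

lemma morley_ex: "\<exists>a. morley a"
  using morley_over[of "{}"] by (auto simp: morley_def)

lemma morley_strict_mono:
  assumes "morley a" "strict_mono f"
  shows "morley (a \<circ> f)"
  unfolding morley_def
proof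
  fix n
  have "(a \<circ> f) ` {..<n} \<subseteq> a ` {..<f n}"
    using assms(2) by (auto simp: strict_mono_def)
  then show "R ((a \<circ> f) n) ((a \<circ> f) ` {..<n})"
    using assms(1) R_mono unfolding morley_def comp_def by blast
qed

text \<open>By induction an automorphism carries the first \<open>n\<close> terms of
  \<open>a\<close> to those of \<open>b\<close>; as \<open>p\<close> is invariant, the next terms
  satisfy corresponding formulas over them.\<close>

lemma morley_same_type:
  assumes "morley a" "morley b" "wf_fm L \<phi>"
  shows "sat C a \<phi> = sat C b \<phi>"
proof -
  have *: "sat C a \<phi> = sat C b \<phi>" if "wf_fm L \<phi>" "fv \<phi> \<subseteq> {..<n}" for n \<phi>
    using that
  proof (induction n arbitrary: \<phi>)
    case 0
    then show ?case by (intro sat_cong) auto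
  next
    case (Suc n)
    define \<pi> where "\<pi> k = (if k = n then 0 else Suc k)" for k
    define \<psi> where "\<psi> = ren \<phi> \<pi>"
    define shift where "shift c k = c (k - 1)" for c :: "nat \<Rightarrow> 'm" and k :: nat
    have wf: "wf_fm L \<psi>" by (simp add: \<psi>_def wf_ren Suc)
    have fv\<psi>: "k - 1 < n" if "k \<in> fv \<psi> - {0}" for k
    proof -
      have "k \<in> \<pi> ` fv \<phi>" using fv_ren[of \<phi> \<pi>] that unfolding \<psi>_def by blast
      then obtain m where "m \<in> fv \<phi>" "k = \<pi> m" by blast
      then show ?thesis using that Suc.prems by (auto simp: \<pi>_def split: if_splits)
    qed
    have eq: "sat C c \<phi> \<longleftrightarrow> P \<psi> (shift c)" if c: "morley c" for c
    proof -
      have "(shift c)(0 := c n) \<circ> \<pi> = c" by (auto simp: shift_def \<pi>_def)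
      then have "sat C c \<phi> \<longleftrightarrow> sat C ((shift c)(0 := c n)) \<psi>"
        by (simp add: \<psi>_def sat_ren del: comp_apply)
      also have "\<dots> \<longleftrightarrow> P \<psi> (shift c)"
      proof (rule R_sat[OF _ wf])
        show "R (c n) (c ` {..<n})" using c by (simp add: morley_def)
        show "shift c ` (fv \<psi> - {0}) \<subseteq> c ` {..<n}" using fv\<psi> by (auto simp: shift_def)
      qed (use morley_in_U[OF c] in auto)
      finally show ?thesis .
    qed
    have ra: "range a \<subseteq> U" and rb: "range b \<subseteq> U" using assms morley_in_U by auto
    obtain g where g: "is_aut L C g" "\<forall>i\<in>{..<n}. g (a i) = b i"
      using homogeneous[OF ra rb Suc.IH] by auto
    have "sol C \<psi> (shift b) = sol C \<psi> (g \<circ> shift a)"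
      by (rule sol_cong) (use g(2) fv\<psi> in \<open>auto simp: shift_def\<close>)
    moreover have "P \<psi> (g \<circ> shift a) \<longleftrightarrow> P \<psi> (shift a)"
      by (rule pp_sol_aut[OF g(1) wf]) (use ra in \<open>auto simp: shift_def\<close>)
    ultimately show ?case using eq assms by simp
  qed
  obtain n where "fv \<phi> \<subseteq> {..<n}" using finite_nat_bounded[OF finite_fv] by blast
  then show ?thesis using * assms(3) by blast
qed

lemma morley_aut:
  assumes "morley a" "morley b"
  shows "\<exists>g. is_aut L C g \<and> (\<forall>i. g (a i) = b i)"
  using homogeneous[of a b UNIV] morley_same_type[OF assms] morley_in_U assms by auto

text \<open>
  If \<open>p\<close> contained instances of \<open>\<phi>\<close> failing at arbitrarily many terms of \<open>a\<close>, then moving these terms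
  to the front and replacing the others by a Morley sequence over everything would order \<open>\<phi>\<close>.
\<close>

lemma morley_bound:
  assumes a: "morley a" and \<phi>: "wf_fm L \<phi>"
  shows "\<exists>n. \<forall>w. range w \<subseteq> U \<longrightarrow> P \<phi> w \<longrightarrow>
    finite {i. \<not> sat C (w(0 := a i)) \<phi>} \<and> card {i. \<not> sat C (w(0 := a i)) \<phi>} \<le> n"
proof (rule ccontr)
  assume contr: "\<not> ?thesis"
  have "\<exists>b. range b \<subseteq> U \<and> (\<forall>k. sat C (b(0 := a k)) \<phi> \<longleftrightarrow> n \<le> k)" for n
  proof -
    obtain w where w: "range w \<subseteq> U" "P \<phi> w"
      "\<not> (finite {i. \<not> sat C (w(0 := a i)) \<phi>} \<and> card {i. \<not> sat C (w(0 := a i)) \<phi>} \<le> n)"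
      using contr by blast
    obtain E where E: "E \<subseteq> {i. \<not> sat C (w(0 := a i)) \<phi>}" "finite E" "card E = n"
    proof (cases "finite {i. \<not> sat C (w(0 := a i)) \<phi>}")
      case True
      then show ?thesis using w(3) that obtain_subset_with_card_n
        by (metis linorder_linear)
    next
      case False
      then show ?thesis using that infinite_arbitrarily_large by metis
    qed
    define e where "e k = sorted_list_of_set E ! k" for k
    have eE: "e k \<in> E" if "k < n" for k
      using that E by (metis e_def length_sorted_list_of_set nth_mem set_sorted_list_of_set)
    have emono: "e k < e l" if "k < l" "l < n" for k l
    proof -
      have "sorted_wrt (<) (sorted_list_of_set E)" by simp
      then show ?thesis unfolding e_def
        by (rule sorted_wrt_nth_less) (use that E in auto)
    qed
    have ctb: "countable (range a \<union> range w)" "range a \<union> range w \<subseteq> U"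
      using w(1) morley_in_U[OF a] by auto
    obtain a' where a': "\<And>k :: nat. R (a' k) ((range a \<union> range w) \<union> a' ` {..<k})"
      using morley_over[OF ctb] by blast
    \<comment> \<open>The exceptional terms come first, followed by terms generic over everything,
      so \<open>\<phi>\<close> fails along \<open>c\<close> exactly below \<open>n\<close>. Moving
      \<open>c\<close> back to \<open>a\<close> by an automorphism makes one sequence serve all
      \<open>n\<close>.\<close>
    define c where "c k = (if k < n then a (e k) else a' (k - n))" for k
    have "morley c" unfolding morley_def
    proof
      fix k
      show "R (c k) (c ` {..<k})"
      proof (cases "k < n")
        case True
        then have "c ` {..<k} \<subseteq> a ` {..<e k}" using emono by (auto simp: c_def)
        moreover have "R (c k) (a ` {..<e k})" using a True by (simp add: morley_def c_def)
        ultimately show ?thesis by (rule R_mono[rotated])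
      next
        case False
        then have "c ` {..<k} \<subseteq> (range a \<union> range w) \<union> a' ` {..<k - n}" by (auto simp: c_def)
        then show ?thesis using R_mono[OF a'[of "k - n"]] False by (simp add: c_def)
      qed
    qed
    then obtain g where g: "is_aut L C g" "\<And>i. g (c i) = a i" using morley_aut a by blast
    have gU: "g x \<in> U" if "x \<in> U" for x
      using g(1) that by (auto simp: is_aut_def bij_betw_def)
    have sc: "sat C (w(0 := c k)) \<phi> \<longleftrightarrow> n \<le> k" for k
    proof (cases "k < n")
      case True
      then show ?thesis using E eE[OF True] by (auto simp: c_def)
    next
      case False
      have "sat C (w(0 := a' (k - n))) \<phi> \<longleftrightarrow> P \<phi> w"
      proof (rule R_sat[OF _ \<phi>])
        show "R (a' (k - n)) (range a \<union> range w)" using R_mono[OF a'[of "k - n"]] by blast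
      qed (use ctb in auto)
      then show ?thesis using False w(2) by (simp add: c_def)
    qed
    have "sat C ((g \<circ> w)(0 := a k)) \<phi> \<longleftrightarrow> n \<le> k" for k
    proof -
      have "(g \<circ> w)(0 := a k) = g \<circ> w(0 := c k)" by (simp add: fun_upd_comp g)
      moreover have "c k \<in> U" by (rule morley_in_U[OF \<open>morley c\<close>])
      ultimately show ?thesis
        using sat_aut[OF is_struct_C g(1) _ \<phi>, of "w(0 := c k)"] w(1) sc
        by (auto simp del: comp_apply)
    qed
    moreover have "range (g \<circ> w) \<subseteq> U" using w(1) gU by auto
    ultimately show ?thesis by blast
  qed
  then obtain b where b: "\<And>n. range (b n) \<subseteq> U" "\<And>n k. sat C ((b n)(0 := a k)) \<phi> \<longleftrightarrow> n \<le> k"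
    by metis
  have upd: "(\<lambda>n. if n \<in> {0} then a i else b j n) = (b j)(0 := a i)" for i j by auto
  have "sat C (\<lambda>n. if n \<in> {0} then a i else b j n) (Neg \<phi>) \<longleftrightarrow> i < j" for i j
    unfolding upd using b(2) by (simp add: not_le)
  moreover have "a i \<in> U" "b i n \<in> U" for i n
    using b(1) morley_in_U[OF a] by auto
  moreover have "wf_fm L (Neg \<phi>)" using \<phi> by simp
  ultimately show False
    using no_order_property[of "Neg \<phi>" "\<lambda>i _. a i" b "{0}"] by blast
qed

text \<open>By construction a term is generic over the earlier ones only; stability extends this to
  all other terms. If the later terms are spread apart, \<open>d + 1\<close> terms fit into the
  place of \<open>a i\<close>, and all would be exceptions to an instance in \<open>p\<close> that
  admits at most \<open>d\<close>.\<close>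

lemma morley_symmetric:
  assumes a: "morley a" and \<phi>: "wf_fm L \<phi>" and i: "i \<notin> h ` (fv \<phi> - {0})"
  shows "sat C ((a \<circ> h)(0 := a i)) \<phi> \<longleftrightarrow> P \<phi> (a \<circ> h)"
proof -
  have aU: "range a \<subseteq> U" using morley_in_U[OF a] by auto
  have *: "sat C ((a \<circ> h)(0 := a i)) \<phi>"
    if \<phi>: "wf_fm L \<phi>" and i: "i \<notin> h ` (fv \<phi> - {0})" and P: "P \<phi> (a \<circ> h)" for \<phi>
  proof (rule ccontr)
    assume neg: "\<not> sat C ((a \<circ> h)(0 := a i)) \<phi>"
    obtain d where d: "\<And>w. range w \<subseteq> U \<Longrightarrow> P \<phi> w \<Longrightarrow>
        finite {i. \<not> sat C (w(0 := a i)) \<phi>} \<and> card {i. \<not> sat C (w(0 := a i)) \<phi>} \<le> d"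
      using morley_bound[OF a \<phi>] by blast
    \<comment> \<open>The maps \<open>f e\<close> agree away from \<open>i\<close>, and
      \<open>f e\<close> puts the term \<open>i + e\<close> in place \<open>i\<close>. The later
      places move up by \<open>d\<close>, so that \<open>f e\<close> is increasing for each
      \<open>e \<le> d\<close>.\<close>
    define f where "f e m = (if m < i then m else if m = i then i + e else m + d)" for e m
    have mf: "morley (a \<circ> f e)" if "e \<le> d" for e
      by (rule morley_strict_mono[OF a]) (use that in \<open>auto simp: strict_mono_def f_def\<close>)
    let ?w = "a \<circ> f d \<circ> h"
    have wU: "range ?w \<subseteq> U" using aU by auto
    obtain g where g: "is_aut L C g" "\<And>k. g (a k) = (a \<circ> f d) k"
      using morley_aut[OF a mf[of d]] by auto
    have "g \<circ> (a \<circ> h) = ?w" using g(2) by auto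
    then have "P \<phi> ?w" using pp_sol_aut[OF g(1) \<phi>, of "a \<circ> h"] P aU by auto
    then have fin: "finite {k. \<not> sat C (?w(0 := a k)) \<phi>}" "card {k. \<not> sat C (?w(0 := a k)) \<phi>} \<le> d"
      using d[OF wU] by auto
    have "\<not> sat C (?w(0 := a (i + e))) \<phi>" if e: "e \<le> d" for e
    proof -
      have "sat C (?w(0 := a (i + e))) \<phi> = sat C (a \<circ> f e \<circ> h(0 := i)) \<phi>"
        by (rule sat_cong) (use i in \<open>auto simp: f_def\<close>)
      also have "\<dots> = sat C (a \<circ> f e) (ren \<phi> (h(0 := i)))"
        by (simp add: sat_ren)
      also have "\<dots> = sat C a (ren \<phi> (h(0 := i)))"
        by (rule morley_same_type[OF mf[OF e] a]) (simp add: wf_ren \<phi>)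
      also have "\<dots> = sat C ((a \<circ> h)(0 := a i)) \<phi>"
        by (simp add: sat_ren fun_upd_comp)
      finally show ?thesis using neg by simp
    qed
    then have "(\<lambda>e. i + e) ` {..d} \<subseteq> {k. \<not> sat C (?w(0 := a k)) \<phi>}" by auto
    then have "card ((\<lambda>e. i + e) ` {..d}) \<le> d" using fin card_mono le_trans by metis
    then show False by (simp add: card_image)
  qed
  have "range (a \<circ> h) \<subseteq> U" using aU by auto
  then show ?thesis using *[OF \<phi> i] *[of "Neg \<phi>"] \<phi> i P_Neg[OF \<phi>] by auto
qed

text \<open>Hence \<open>p\<close> is definable over the sequence: the majority among any
  \<open>2 * n + 1\<close> terms decides \<open>P \<phi> w\<close>.\<close>

lemma morley_definition:
  assumes a: "morley a" and \<phi>: "wf_fm L \<phi>"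
  shows "\<exists>n. \<forall>w. range w \<subseteq> U \<longrightarrow>
    (P \<phi> w \<longrightarrow> finite {i. \<not> sat C (w(0 := a i)) \<phi>} \<and> card {i. \<not> sat C (w(0 := a i)) \<phi>} \<le> n) \<and>
    (\<not> P \<phi> w \<longrightarrow> finite {i. sat C (w(0 := a i)) \<phi>} \<and> card {i. sat C (w(0 := a i)) \<phi>} \<le> n)"
proof -
  obtain n where n: "\<And>w. range w \<subseteq> U \<Longrightarrow> P \<phi> w \<Longrightarrow>
        finite {i. \<not> sat C (w(0 := a i)) \<phi>} \<and> card {i. \<not> sat C (w(0 := a i)) \<phi>} \<le> n"
    using morley_bound[OF a \<phi>] by blast
  obtain m where m: "\<And>w. range w \<subseteq> U \<Longrightarrow> P (Neg \<phi>) w \<Longrightarrow>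
        finite {i. sat C (w(0 := a i)) \<phi>} \<and> card {i. sat C (w(0 := a i)) \<phi>} \<le> m"
    using morley_bound[OF a, of "Neg \<phi>"] \<phi> by auto
  show ?thesis
    using n m P_Neg[OF \<phi>] by (intro exI[of _ "max n m"]) (auto simp: le_max_iff_disj)
qed

lemma morley_inj: "morley a \<Longrightarrow> inj a"
proof (rule injI, rule ccontr)
  fix i j assume a: "morley a" "a i = a j" "i \<noteq> j"
  have ne: "a k \<noteq> a l" if "k < l" for k l
  proof
    assume eq: "a k = a l"
    have "R (a l) (a ` {..<l})" using a by (simp add: morley_def)
    then have "sat C ((\<lambda>_. a k)(0 := a l)) (Eq (Var 0) (Var 1)) \<longleftrightarrow> P (Eq (Var 0) (Var 1)) (\<lambda>_. a k)"
      by (rule R_sat) (use that morley_in_U[OF a(1)] in auto)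
    then have "P (Eq (Var 0) (Var 1)) (\<lambda>_. a k)" using eq by simp
    then have "infinite (sol C (Eq (Var 0) (Var 1)) (\<lambda>_. a k))" by (rule pp_infinite)
    moreover have "sol C (Eq (Var 0) (Var 1)) (\<lambda>_. a k) \<subseteq> {a k}" by (auto simp: sol_def)
    ultimately show False using finite_subset by blast
  qed
  then show False using a ne[of i j] ne[of j i] by (cases "i < j") auto
qed

end

section \<open>Ultrapowers\<close>

text \<open>A minimal proper filter below \<open>F\<close> is an ultrafilter. The infimum of a chain
  stays proper because falsity would already be eventual in one of its members.\<close>

lemma ultrafilter_ex:
  assumes "F \<noteq> bot"
  shows "\<exists>W\<le>F. W \<noteq> bot \<and> (\<forall>P. eventually P W \<or> eventually (\<lambda>x. \<not> P x) W)"
proof -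
  define A where "A = {W. W \<noteq> bot \<and> W \<le> F}"
  have lower: "\<exists>u\<in>A. \<forall>a\<in>C. u \<le> a" if C: "C \<subseteq> A" "\<And>x y. x \<in> C \<Longrightarrow> y \<in> C \<Longrightarrow> x \<le> y \<or> y \<le> x" for C
  proof (cases "C = {}")
    case True
    then show ?thesis using assms by (auto simp: A_def)
  next
    case False
    have "eventually (\<lambda>x. False) (Inf C) \<longleftrightarrow> (\<exists>b\<in>C. eventually (\<lambda>x. False) b)"
    proof (rule eventually_Inf_base[OF False])
      fix F G assume "F \<in> C" "G \<in> C"
      then show "\<exists>x\<in>C. x \<le> inf F G" using C(2)[of F G] by (auto intro: bexI[of _ F] bexI[of _ G])
    qed
    then have "Inf C \<noteq> bot"
      using C(1) by (auto simp: A_def trivial_limit_def)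
    moreover have "Inf C \<le> F"
      using False C(1) by (auto simp: A_def intro: Inf_lower2)
    ultimately show ?thesis by (auto simp: A_def intro!: bexI[of _ "Inf C"] intro: Inf_lower)
  qed
  have "\<exists>m\<in>A. \<forall>a\<in>A. a \<le> m \<longrightarrow> a = m"
  proof (rule predicate_Zorn[of A "\<lambda>x y. y \<le> x"])
    show "partial_order_on A (relation_of (\<lambda>x y. y \<le> x) A)"
      by (rule partial_order_on_relation_ofI) auto
    fix C assume C: "C \<in> Chains (relation_of (\<lambda>x y. y \<le> x) A)"
    show "\<exists>u\<in>A. \<forall>a\<in>C. u \<le> a"
      by (rule lower) (use C in \<open>auto simp: Chains_def relation_of_def\<close>)
  qed
  then obtain W where W: "W \<in> A" "\<And>V. V \<in> A \<Longrightarrow> V \<le> W \<Longrightarrow> V = W" by metis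
  have "eventually P W" if "\<not> eventually (\<lambda>x. \<not> P x) W" for P
  proof -
    let ?V = "inf W (principal {x. P x})"
    have "?V \<noteq> bot"
      using that by (simp add: trivial_limit_def eventually_inf_principal)
    then have "?V = W" using W by (intro W(2)) (auto simp: A_def intro: le_infI1)
    then have "W \<le> principal {x. P x}" by (metis inf_le2)
    then show ?thesis by (simp add: le_principal)
  qed
  then show ?thesis using W(1) by (auto simp: A_def)
qed

definition ucls :: "'s filter \<Rightarrow> ('f, 'r, 'a) fo_struct \<Rightarrow> ('s \<Rightarrow> 'a) \<Rightarrow> ('s \<Rightarrow> 'a) set" where
  "ucls W C f = {g. range g \<subseteq> universe C \<and> eventually (\<lambda>s. f s = g s) W}"

definition urep :: "('s \<Rightarrow> 'a) set \<Rightarrow> 's \<Rightarrow> 'a" where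
  "urep X = (SOME g. g \<in> X)"

definition upow :: "'s filter \<Rightarrow> ('f, 'r, 'a) fo_struct \<Rightarrow> ('f, 'r, ('s \<Rightarrow> 'a) set) fo_struct" where
  "upow W C = \<lparr>universe = ucls W C ` {f. range f \<subseteq> universe C},
     fun_int = (\<lambda>h Xs. ucls W C (\<lambda>s. fun_int C h (map (\<lambda>X. urep X s) Xs))),
     rel_int = (\<lambda>r Xs. eventually (\<lambda>s. rel_int C r (map (\<lambda>X. urep X s) Xs)) W)\<rparr>"

locale ultrapower =
  fixes W :: "'s filter" and L :: "('f, 'r) lang" and C :: "('f, 'r, 'a) fo_struct"
  assumes ultra: "eventually P W \<or> eventually (\<lambda>x. \<not> P x) W"
    and proper: "W \<noteq> bot"
    and struct: "is_struct L C"
begin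

lemma eventually_not: "eventually (\<lambda>x. \<not> P x) W \<longleftrightarrow> \<not> eventually P W"
proof
  assume "eventually (\<lambda>x. \<not> P x) W"
  show "\<not> eventually P W"
  proof
    assume "eventually P W"
    then have "eventually (\<lambda>x. False) W"
      using \<open>eventually (\<lambda>x. \<not> P x) W\<close> by eventually_elim simp
    then show False using proper by (simp add: trivial_limit_def)
  qed
qed (use ultra in blast)

abbreviation cls where "cls \<equiv> ucls W C"
abbreviation Us where "Us \<equiv> universe (upow W C)"

lemma Us_eq: "Us = cls ` {f. range f \<subseteq> universe C}"
  by (simp add: upow_def)

lemma cls_in: "range f \<subseteq> universe C \<Longrightarrow> cls f \<in> Us"
  by (auto simp: Us_eq)

lemma cls_eq: 
  assumes "range f \<subseteq> universe C" "range g \<subseteq> universe C"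
  shows "cls f = cls g \<longleftrightarrow> eventually (\<lambda>s. f s = g s) W"
proof
  assume "cls f = cls g"
  moreover have "g \<in> cls g" using assms by (auto simp: ucls_def)
  ultimately show "eventually (\<lambda>s. f s = g s) W" by (auto simp: ucls_def)
next
  assume e: "eventually (\<lambda>s. f s = g s) W"
  have "eventually (\<lambda>s. f s = h s) W \<longleftrightarrow> eventually (\<lambda>s. g s = h s) W" for h
    by (rule eventually_cong[OF e]) auto
  then show "cls f = cls g" by (simp add: ucls_def)
qed

lemma urep_cls:
  assumes "range f \<subseteq> universe C"
  shows "range (urep (cls f)) \<subseteq> universe C" "eventually (\<lambda>s. urep (cls f) s = f s) W"
proof -
  have "f \<in> cls f" using assms by (auto simp: ucls_def)
  then have "urep (cls f) \<in> cls f" unfolding urep_def by (rule someI[of "\<lambda>g. g \<in> cls f"])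
  then show "range (urep (cls f)) \<subseteq> universe C" "eventually (\<lambda>s. urep (cls f) s = f s) W"
    by (auto simp: ucls_def eq_commute)
qed

lemma urep_Us: "X \<in> Us \<Longrightarrow> urep X s \<in> universe C"
  using urep_cls(1) by (auto simp: Us_eq)

lemma cls_urep: "X \<in> Us \<Longrightarrow> cls (urep X) = X"
proof -
  assume "X \<in> Us"
  then obtain f where "range f \<subseteq> universe C" "X = cls f" by (auto simp: Us_eq)
  then show ?thesis using urep_cls[of f] cls_eq[of "urep (cls f)" f] by blast
qed

lemma struct_upow: "is_struct L (upow W C)"
  unfolding is_struct_def
proof (intro conjI ballI impI)
  show "Us \<noteq> {}" using struct by (auto simp: Us_eq is_struct_def)
next
  fix h Xs assume h: "h \<in> Funs L" "Xs \<in> lists Us" "length Xs = fun_ar L h"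
  have "fun_int C h (map (\<lambda>X. urep X s) Xs) \<in> universe C" for s
  proof -
    have "map (\<lambda>X. urep X s) Xs \<in> lists (universe C)" using h(2) urep_Us by auto
    then show ?thesis using struct h by (auto simp: is_struct_def)
  qed
  then have "cls (\<lambda>s. fun_int C h (map (\<lambda>X. urep X s) Xs)) \<in> Us" by (intro cls_in) auto
  then show "fun_int (upow W C) h Xs \<in> Us" by (simp add: upow_def)
qed

lemma los_tm:
  assumes "range V \<subseteq> Us" "wf_tm L t"
  shows "eventually (\<lambda>s. urep (eval_tm (upow W C) V t) s = eval_tm C (\<lambda>n. urep (V n) s) t) W"
  using assms(2)
proof (induction t)
  case (Fn h ts)
  let ?Xs = "map (eval_tm (upow W C) V) ts"
  have Xs: "set ?Xs \<subseteq> Us" using eval_tm_in_universe[OF struct_upow _ assms(1)] Fn.prems by auto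
  have "fun_int C h (map (\<lambda>X. urep X s) ?Xs) \<in> universe C" for s
  proof -
    have "map (\<lambda>X. urep X s) ?Xs \<in> lists (universe C)"
      using Xs by (auto simp del: map_map intro!: urep_Us simp: subset_iff)
    then show ?thesis using struct Fn.prems by (auto simp: is_struct_def simp del: map_map)
  qed
  then have 1: "eventually (\<lambda>s. urep (cls (\<lambda>s. fun_int C h (map (\<lambda>X. urep X s) ?Xs))) s =
      fun_int C h (map (\<lambda>X. urep X s) ?Xs)) W"
    by (intro urep_cls) auto
  have "eventually (\<lambda>s. \<forall>t\<in>set ts. urep (eval_tm (upow W C) V t) s = eval_tm C (\<lambda>n. urep (V n) s) t) W"
    using Fn by (intro eventually_ball_finite) auto
  then show ?case
    using 1
  proof eventually_elim
    case (elim s)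
    have "map (\<lambda>X. urep X s) ?Xs = map (eval_tm C (\<lambda>n. urep (V n) s)) ts"
      using elim(1) by auto
    then show ?case using elim(2) by (simp add: upow_def del: map_map)
  qed
qed auto

lemma los:
  assumes "range V \<subseteq> Us" "wf_fm L \<phi>"
  shows "sat (upow W C) V \<phi> \<longleftrightarrow> eventually (\<lambda>s. sat C (\<lambda>n. urep (V n) s) \<phi>) W"
  using assms
proof (induction \<phi> arbitrary: V)
  case (Eq t u)
  let ?x = "eval_tm (upow W C) V t" and ?y = "eval_tm (upow W C) V u"
  have xy: "?x \<in> Us" "?y \<in> Us" using Eq eval_tm_in_universe[OF struct_upow] by auto
  then have "?x = ?y \<longleftrightarrow> cls (urep ?x) = cls (urep ?y)" by (simp add: cls_urep)
  also have "\<dots> \<longleftrightarrow> eventually (\<lambda>s. urep ?x s = urep ?y s) W"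
    by (rule cls_eq) (use xy urep_Us in auto)
  also have "\<dots> \<longleftrightarrow> eventually (\<lambda>s. eval_tm C (\<lambda>n. urep (V n) s) t = eval_tm C (\<lambda>n. urep (V n) s) u) W"
    by (rule eventually_cong[OF eventually_conj[OF los_tm[of V t] los_tm[of V u]]])
      (use Eq in auto)
  finally show ?case by simp
next
  case (Rel r ts)
  have "eventually (\<lambda>s. \<forall>t\<in>set ts. urep (eval_tm (upow W C) V t) s = eval_tm C (\<lambda>n. urep (V n) s) t) W"
    using Rel los_tm by (intro eventually_ball_finite) auto
  then have "eventually (\<lambda>s. map (\<lambda>X. urep X s) (map (eval_tm (upow W C) V) ts) =
      map (eval_tm C (\<lambda>n. urep (V n) s)) ts) W"
    by eventually_elim auto
  then have "eventually (\<lambda>s. rel_int C r (map (\<lambda>X. urep X s) (map (eval_tm (upow W C) V) ts))) W \<longleftrightarrow>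
      eventually (\<lambda>s. rel_int C r (map (eval_tm C (\<lambda>n. urep (V n) s)) ts)) W"
    by (rule eventually_cong) (simp del: map_map)
  then show ?case by (simp add: upow_def del: map_map)
next
  case (Neg \<phi>)
  then show ?case by (simp add: eventually_not)
next
  case (Conj \<phi> \<psi>)
  then show ?case by (simp add: eventually_conj_iff)
next
  case (Ex n \<phi>)
  have IH: "sat (upow W C) (V(n := cls f)) \<phi> \<longleftrightarrow>
      eventually (\<lambda>s. sat C ((\<lambda>n. urep (V n) s)(n := f s)) \<phi>) W" if f: "range f \<subseteq> universe C" for f
  proof -
    have "sat (upow W C) (V(n := cls f)) \<phi> \<longleftrightarrow>
        eventually (\<lambda>s. sat C (\<lambda>k. urep ((V(n := cls f)) k) s) \<phi>) W"
      by (rule Ex.IH) (use Ex.prems f cls_in in auto)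
    also have "\<dots> \<longleftrightarrow> eventually (\<lambda>s. sat C ((\<lambda>n. urep (V n) s)(n := f s)) \<phi>) W"
    proof (rule eventually_cong[OF urep_cls(2)[OF f]])
      fix s assume "urep (cls f) s = f s"
      then have "(\<lambda>k. urep ((V(n := cls f)) k) s) = (\<lambda>n. urep (V n) s)(n := f s)" by auto
      then show "sat C (\<lambda>k. urep ((V(n := cls f)) k) s) \<phi> = sat C ((\<lambda>n. urep (V n) s)(n := f s)) \<phi>"
        by (simp only:)
    qed
    finally show ?thesis .
  qed
  show ?case
  proof
    assume "sat (upow W C) V (fm.Ex n \<phi>)"
    then obtain f where f: "range f \<subseteq> universe C" "sat (upow W C) (V(n := cls f)) \<phi>"
      by (auto simp: Us_eq)
    have "eventually (\<lambda>s. sat C ((\<lambda>n. urep (V n) s)(n := f s)) \<phi>) W"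
      using IH[OF f(1)] f(2) by blast
    then show "eventually (\<lambda>s. sat C (\<lambda>n. urep (V n) s) (fm.Ex n \<phi>)) W"
      by eventually_elim (use f(1) in auto)
  next
    assume e: "eventually (\<lambda>s. sat C (\<lambda>n. urep (V n) s) (fm.Ex n \<phi>)) W"
    obtain u where u: "u \<in> universe C" using struct by (auto simp: is_struct_def)
    define f where "f s = (if \<exists>a\<in>universe C. sat C ((\<lambda>n. urep (V n) s)(n := a)) \<phi>
      then SOME a. a \<in> universe C \<and> sat C ((\<lambda>n. urep (V n) s)(n := a)) \<phi> else u)" for s
    have f: "f s \<in> universe C \<and> sat C ((\<lambda>n. urep (V n) s)(n := f s)) \<phi>"
      if "\<exists>a\<in>universe C. sat C ((\<lambda>n. urep (V n) s)(n := a)) \<phi>" for s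
      using someI_ex[of "\<lambda>a. a \<in> universe C \<and> sat C ((\<lambda>n. urep (V n) s)(n := a)) \<phi>"] that
      by (auto simp: f_def)
    have fU: "range f \<subseteq> universe C"
    proof (rule image_subsetI)
      fix s show "f s \<in> universe C"
        using f[of s] u by (cases "\<exists>a\<in>universe C. sat C ((\<lambda>n. urep (V n) s)(n := a)) \<phi>") (auto simp: f_def)
    qed
    have "eventually (\<lambda>s. sat C ((\<lambda>n. urep (V n) s)(n := f s)) \<phi>) W"
      using e by eventually_elim (use f in auto)
    then have "sat (upow W C) (V(n := cls f)) \<phi>" using IH[OF fU] by blast
    then show "sat (upow W C) V (fm.Ex n \<phi>)" using cls_in[OF fU] by auto
  qed
qed

lemma los_cls:
  assumes "\<And>n. range (v n) \<subseteq> universe C" "wf_fm L \<phi>"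
  shows "sat (upow W C) (\<lambda>n. cls (v n)) \<phi> \<longleftrightarrow> eventually (\<lambda>s. sat C (\<lambda>n. v n s) \<phi>) W"
proof -
  have "sat (upow W C) (\<lambda>n. cls (v n)) \<phi> \<longleftrightarrow> eventually (\<lambda>s. sat C (\<lambda>n. urep (cls (v n)) s) \<phi>) W"
    by (rule los) (use assms cls_in in auto)
  also have "eventually (\<lambda>s. \<forall>n\<in>fv \<phi>. urep (cls (v n)) s = v n s) W"
    using assms urep_cls by (intro eventually_ball_finite) (auto simp: finite_fv)
  then have "eventually (\<lambda>s. sat C (\<lambda>n. urep (cls (v n)) s) \<phi>) W \<longleftrightarrow>
      eventually (\<lambda>s. sat C (\<lambda>n. v n s) \<phi>) W"
    by (rule eventually_cong) (auto intro!: sat_cong)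
  finally show ?thesis .
qed

lemma los_upd:
  assumes f: "range f \<subseteq> universe C" and w: "range w \<subseteq> Us" and \<phi>: "wf_fm L \<phi>"
  shows "sat (upow W C) (w(0 := cls f)) \<phi> \<longleftrightarrow>
    eventually (\<lambda>s. sat C ((\<lambda>k. urep (w k) s)(0 := f s)) \<phi>) W"
proof -
  have eq: "w(0 := cls f) = (\<lambda>n. cls (if n = 0 then f else urep (w n)))"
    using cls_urep w by (auto simp: fun_eq_iff subset_iff)
  have eq': "(\<lambda>n. (if n = 0 then f else urep (w n)) s) = (\<lambda>k. urep (w k) s)(0 := f s)" for s
    by auto
  have "range (if n = 0 then f else urep (w n)) \<subseteq> universe C" for n
    using f urep_Us[of "w n"] w by (auto simp: subset_iff)
  then have "sat (upow W C) (\<lambda>n. cls (if n = 0 then f else urep (w n))) \<phi> \<longleftrightarrow>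
      eventually (\<lambda>s. sat C (\<lambda>n. (if n = 0 then f else urep (w n)) s) \<phi>) W"
    by (rule los_cls[OF _ \<phi>])
  then show ?thesis unfolding eq eq' .
qed

text \<open>At \<open>s\<close> only the conditions up to \<open>J s\<close> are solved, where
  \<open>J s\<close> is the largest number up to \<open>N s\<close> for which they are jointly
  solvable. Since \<open>N\<close> eventually reaches every \<open>m\<close>, so does
  \<open>J\<close>, and the pointwise solutions together solve all conditions.\<close>

lemma countably_compact:
  fixes \<psi> :: "nat \<Rightarrow> ('f, 'r) fm"
  assumes N: "\<And>k::nat. eventually (\<lambda>s. k \<le> N s) W"
    and \<psi>: "\<And>n. wf_fm L (\<psi> n)" and u: "\<And>n. range (u n) \<subseteq> Us"
    and fin: "\<And>n. \<exists>x\<in>Us. \<forall>m\<le>n. sat (upow W C) ((u m)(0 := x)) (\<psi> m)"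
  shows "\<exists>x\<in>Us. \<forall>m. sat (upow W C) ((u m)(0 := x)) (\<psi> m)"
proof -
  define S where "S m s x \<longleftrightarrow> sat C ((\<lambda>k. urep (u m k) s)(0 := x)) (\<psi> m)" for m s x
  have los_S: "sat (upow W C) ((u m)(0 := cls f)) (\<psi> m) \<longleftrightarrow> eventually (\<lambda>s. S m s (f s)) W"
    if f: "range f \<subseteq> universe C" for m f
    unfolding S_def by (rule los_upd[OF f u \<psi>])
  define K where "K n s \<longleftrightarrow> (\<exists>x\<in>universe C. \<forall>m\<le>n. S m s x)" for n s
  have K: "eventually (K n) W" for n
  proof -
    obtain f where f: "range f \<subseteq> universe C" "\<forall>m\<le>n. sat (upow W C) ((u m)(0 := cls f)) (\<psi> m)"
      using fin[of n] by (auto simp: Us_eq)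
    have "eventually (\<lambda>s. \<forall>m\<in>{..n}. S m s (f s)) W"
      using f los_S by (intro eventually_ball_finite) auto
    then show ?thesis
    proof eventually_elim
      case (elim s)
      have "f s \<in> universe C" using f(1) by auto
      then show ?case using elim unfolding K_def by blast
    qed
  qed
  obtain c where c: "c \<in> universe C" using struct by (auto simp: is_struct_def)
  define J where "J s = Max {n. n \<le> N s \<and> K n s}" for s
  \<comment> \<open>If no number qualifies, \<open>J s\<close> is the maximum of the empty set and
    means nothing; solvability is therefore tested, with default \<open>c\<close>.\<close>
  define f where "f s = (if \<exists>x\<in>universe C. \<forall>m\<le>J s. S m s x
      then SOME x. x \<in> universe C \<and> (\<forall>m\<le>J s. S m s x) else c)" for s
  have f: "f s \<in> universe C \<and> (\<forall>m\<le>J s. S m s (f s))" if "K (J s) s" for s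
    using someI_ex[of "\<lambda>x. x \<in> universe C \<and> (\<forall>m\<le>J s. S m s x)"] that
    unfolding f_def K_def by (auto split: if_splits)
  have fU: "range f \<subseteq> universe C"
  proof (rule image_subsetI)
    fix s show "f s \<in> universe C"
      using f[of s] c by (cases "K (J s) s") (auto simp: f_def K_def)
  qed
  have "eventually (\<lambda>s. S m s (f s)) W" for m
    using N[of m] K[of m]
  proof eventually_elim
    case (elim s)
    have fin: "finite {n. n \<le> N s \<and> K n s}" by simp
    have "J s \<in> {n. n \<le> N s \<and> K n s}"
      unfolding J_def by (rule Max_in[OF fin]) (use elim in auto)
    moreover have "m \<le> J s" unfolding J_def by (rule Max_ge[OF fin]) (use elim in auto)
    ultimately show ?case using f by auto
  qed
  then show ?thesis using los_S[OF fU] cls_in[OF fU] by blast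
qed

end

section \<open>Countable types of tuples\<close>

context regular_type
begin

text \<open>The copy is found element by element, each realising a complete type over the previous ones.\<close>

lemma copy_in_monster:
  fixes M :: "('f, 'r, 'b) fo_struct"
  assumes M: "is_struct L M" and W: "range W \<subseteq> universe M"
    and ee: "\<And>\<phi> V v. wf_fm L \<phi> \<Longrightarrow> fv \<phi> = {} \<Longrightarrow> sat M V \<phi> = sat C v \<phi>"
  shows "\<exists>W'. range W' \<subseteq> U \<and> (\<forall>\<phi>. wf_fm L \<phi> \<longrightarrow> sat M W \<phi> = sat C W' \<phi>)"
proof -
  define Q where "Q n w x \<longleftrightarrow> x \<in> U \<and>
    (\<forall>\<phi>. wf_fm L \<phi> \<longrightarrow> fv \<phi> \<subseteq> {..n} \<longrightarrow> sat M W \<phi> = sat C (w(n := x)) \<phi>)" for n w x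
  have "\<exists>W'. \<forall>n. Q n W' (W' n)"
  proof (rule seq_choice)
    fix n and f g :: "nat \<Rightarrow> 'm" and x
    assume eq: "\<And>m. m < n \<Longrightarrow> f m = g m"
    have "sat C (f(n := x)) \<phi> = sat C (g(n := x)) \<phi>" if "fv \<phi> \<subseteq> {..n}" for \<phi>
      by (rule sat_cong) (use that eq in \<open>auto simp: le_less\<close>)
    then show "Q n f x = Q n g x" unfolding Q_def by blast
  next
    fix n and w :: "nat \<Rightarrow> 'm"
    assume IH: "\<And>m. m < n \<Longrightarrow> Q m w (w m)"
    have inv: "sat M W \<phi> = sat C w \<phi>" if "wf_fm L \<phi>" "fv \<phi> \<subseteq> {..<n}" for \<phi>
    proof (cases n)
      case 0
      then show ?thesis using ee that by auto
    next
      case (Suc k)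
      then have "fv \<phi> \<subseteq> {..k}" using that by auto
      then show ?thesis using IH[of k] Suc that by (simp add: Q_def)
    qed
    let ?B = "w ` {..<n}"
    \<comment> \<open>The type that the copy of \<open>W n\<close> must realise: a formula with
      parameters enters if some equivalent formula of \<open>L\<close> with variables up to
      \<open>n\<close> holds of \<open>W\<close>.\<close>
    define q where "q = {\<chi> \<in> fmls1 L ?B. \<exists>\<phi>. wf_fm L \<phi> \<and> fv \<phi> \<subseteq> {..n} \<and> sat M W \<phi> \<and>
       (\<forall>x\<in>U. sat1 C \<chi> x \<longleftrightarrow> sat C (w(n := x)) \<phi>)}"
    have BU: "?B \<subseteq> U" using IH by (auto simp: Q_def)
    have "complete_type L C ?B q"
      unfolding complete_type_def
    proof (intro conjI allI impI ballI)
      show "q \<subseteq> fmls1 L ?B" by (auto simp: q_def)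
    next
      fix F assume F: "finite F" "F \<subseteq> q"
      have "\<exists>\<phi>. wf_fm L \<phi> \<and> fv \<phi> \<subseteq> {..n} \<and> sat M W \<phi> \<and>
         (\<forall>x\<in>U. sat C (w(n := x)) \<phi> \<longrightarrow> (\<forall>\<chi>\<in>F. sat1 C \<chi> x))"
        using F
      proof (induction F)
        case empty
        show ?case by (intro exI[of _ "Eq (Var n) (Var n)"]) auto
      next
        case (insert \<chi> F)
        then obtain \<phi> where "wf_fm L \<phi>" "fv \<phi> \<subseteq> {..n}" "sat M W \<phi>"
          "\<forall>x\<in>U. sat C (w(n := x)) \<phi> \<longrightarrow> (\<forall>\<chi>\<in>F. sat1 C \<chi> x)" by blast
        moreover obtain \<psi> where "wf_fm L \<psi>" "fv \<psi> \<subseteq> {..n}" "sat M W \<psi>"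
          "\<forall>x\<in>U. sat1 C \<chi> x \<longleftrightarrow> sat C (w(n := x)) \<psi>" using insert.prems by (auto simp: q_def)
        ultimately show ?case
          by (intro exI[of _ "Conj \<phi> \<psi>"]) (simp del: fun_upd_apply)
      qed
      then obtain \<phi> where \<phi>: "wf_fm L \<phi>" "fv \<phi> \<subseteq> {..n}" "sat M W \<phi>"
          "\<forall>x\<in>U. sat C (w(n := x)) \<phi> \<longrightarrow> (\<forall>\<chi>\<in>F. sat1 C \<chi> x)" by blast
      have "W n \<in> universe M" "sat M (W(n := W n)) \<phi>" using \<phi>(3) W by auto
      \<comment> \<open>Quantifying the variable \<open>n\<close> leaves a formula about the earlier
        terms, whose copies are already correct.\<close>
      then have "sat M W (fm.Ex n \<phi>)" unfolding sat.simps by blast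
      moreover have "fv (fm.Ex n \<phi>) \<subseteq> {..<n}" using \<phi>(2) lessThan_Suc_atMost[of n] by (auto simp: lessThan_Suc)
      moreover have "wf_fm L (fm.Ex n \<phi>)" using \<phi>(1) by simp
      ultimately have "sat C w (fm.Ex n \<phi>)" using inv by blast
      then obtain x where "x \<in> U" "sat C (w(n := x)) \<phi>" unfolding sat.simps by blast
      then have "realises C x F" using \<phi>(4) unfolding realises_def by blast
      then show "\<exists>a. realises C a F" by blast
    next
      fix \<chi> assume \<chi>: "\<chi> \<in> fmls1 L ?B"
      define f where "f b = (SOME i. i < n \<and> w i = b)" for b
      have f: "f b < n \<and> w (f b) = b" if "b \<in> ?B" for b
        unfolding f_def by (rule someI_ex) (use that in blast)
      have \<chi>': "wf_fm (lang_over L ?B) \<chi>" "fv \<chi> \<subseteq> {0}" using \<chi> by (auto simp: fmls1_def)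
      have pB: "params \<chi> \<subseteq> ?B" by (rule params_subset[OF \<chi>'(1)])
      let ?\<phi> = "unparam n f \<chi>"
      have fv: "fv ?\<phi> \<subseteq> {..n}"
      proof -
        have f': "f a < n" if "a \<in> params \<chi>" for a using f pB that by blast
        have "fv ?\<phi> \<subseteq> (\<lambda>m. m + n) ` fv \<chi> \<union> f ` params \<chi>"
          by (rule fv_unparam) (rule f')
        moreover have "(\<lambda>m. m + n) ` fv \<chi> \<subseteq> {..n}" using \<chi>'(2) by auto
        moreover have "f ` params \<chi> \<subseteq> {..n}" using f' by (auto intro: less_imp_le)
        ultimately show ?thesis by blast
      qed
      have eq: "sat1 C \<chi> x \<longleftrightarrow> sat C (w(n := x)) ?\<phi>" for x
      proof -
        have "sat1 C \<chi> x \<longleftrightarrow> sat C (\<lambda>k. if k < n then w k else x) ?\<phi>"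
          unfolding sat1_def
          by (subst (1) map_params_id[symmetric], rule sat_unparam) (use f pB in auto)
        also have "\<dots> \<longleftrightarrow> sat C (w(n := x)) ?\<phi>"
          by (rule sat_cong) (use fv in auto)
        finally show ?thesis .
      qed
      have wf: "wf_fm L ?\<phi>" by (rule wf_unparam[OF \<chi>'(1)])
      show "\<chi> \<in> q \<or> Neg \<chi> \<in> q"
      proof (cases "sat M W ?\<phi>")
        case True
        then show ?thesis using \<chi> fv eq wf unfolding q_def by blast
      next
        case False
        have "Neg \<chi> \<in> fmls1 L ?B" using \<chi> by (auto simp: fmls1_def)
        moreover have "sat1 C (Neg \<chi>) x \<longleftrightarrow> sat C (w(n := x)) (Neg ?\<phi>)" for x
          using eq by (simp add: sat1_def)
        ultimately show ?thesis using False fv wf unfolding q_def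
          by (intro disjI2 CollectI conjI exI[of _ "Neg ?\<phi>"]) auto
      qed
    qed
    moreover have "small \<kappa> C ?B" by (rule small_countable) (use BU in auto)
    ultimately obtain x where x: "realises C x q"
      using monster unfolding monster_def saturated_def by blast
    have imp: "sat C (w(n := x)) \<phi>" if "wf_fm L \<phi>" "fv \<phi> \<subseteq> {..n}" "sat M W \<phi>" for \<phi>
    proof -
      define \<pi> where "\<pi> k = (if k = n then 0 else Suc k)" for k
      define u where "u k = (if k = 0 then None else Some (w (k - 1)))" for k
      define \<chi> where "\<chi> = inst (ren \<phi> \<pi>) u"
      have fvr: "k - 1 < n" if k: "k \<in> fv (ren \<phi> \<pi>)" "k \<noteq> 0" for k
      proof -
        have "k \<in> \<pi> ` fv \<phi>" using fv_ren[of \<phi> \<pi>] k by blast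
        then show ?thesis using k \<open>fv \<phi> \<subseteq> {..n}\<close> by (auto simp: \<pi>_def split: if_splits)
      qed
      have "wf_fm (lang_over L ?B) \<chi>"
        unfolding \<chi>_def by (rule wf_inst) (use that fvr in \<open>auto simp: wf_ren u_def split: if_splits\<close>)
      then have "\<chi> \<in> fmls1 L ?B" by (auto simp: fmls1_def \<chi>_def fv_inst u_def split: if_splits)
      moreover have eq: "sat1 C \<chi> y \<longleftrightarrow> sat C (w(n := y)) \<phi>" for y
      proof -
        have "(\<lambda>k. case u k of None \<Rightarrow> y | Some a \<Rightarrow> a) \<circ> \<pi> = w(n := y)"
          by (auto simp: u_def \<pi>_def)
        then show ?thesis by (simp add: sat1_def \<chi>_def sat_inst sat_ren del: comp_apply)
      qed
      ultimately have "\<chi> \<in> q" using that unfolding q_def by blast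
      then show ?thesis using x eq by (auto simp: realises_def)
    qed
    have "sat M W \<phi> = sat C (w(n := x)) \<phi>" if "wf_fm L \<phi>" "fv \<phi> \<subseteq> {..n}" for \<phi>
      using imp[OF that] imp[of "Neg \<phi>"] that by auto
    then show "\<exists>x. Q n w x" using x unfolding Q_def realises_def by blast
  qed
  then obtain W' where W': "\<And>n. Q n W' (W' n)" by blast
  have "sat M W \<phi> = sat C W' \<phi>" if "wf_fm L \<phi>" for \<phi>
  proof -
    obtain n where "fv \<phi> \<subseteq> {..<n}" using finite_nat_bounded[OF finite_fv] by blast
    then have "fv \<phi> \<subseteq> {..n}" by auto
    then show ?thesis using W'[of n] that by (simp add: Q_def)
  qed
  moreover have "range W' \<subseteq> U" using W' by (auto simp: Q_def)
  ultimately show ?thesis by blast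
qed

end

section \<open>Locally isolated elements over sets of indiscernibles\<close>

text \<open>Local isolation: every \<open>\<phi>\<close>-type of \<open>e\<close> over \<open>B\<close> is isolated by a formula over \<open>B\<close>.\<close>

definition isolated ::
    "('f, 'r) lang \<Rightarrow> ('f, 'r, 'b) fo_struct \<Rightarrow> 'b \<Rightarrow> 'b set \<Rightarrow> bool" where
  "isolated L M e B \<longleftrightarrow> (\<forall>\<phi>. wf_fm L \<phi> \<longrightarrow> (\<exists>\<psi> u. wf_fm L \<psi> \<and> range u \<subseteq> B \<and> sat M (u(0 := e)) \<psi> \<and>
     (\<forall>w. range w \<subseteq> B \<longrightarrow>
        (\<forall>x\<in>universe M. sat M (u(0 := x)) \<psi> \<longrightarrow> sat M (w(0 := x)) \<phi>) \<or>
        (\<forall>x\<in>universe M. sat M (u(0 := x)) \<psi> \<longrightarrow> \<not> sat M (w(0 := x)) \<phi>))))"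

text \<open>For a Morley sequence \<open>a\<close> of \<open>p\<close> this means that \<open>e\<close> realises \<open>p|B\<close>.\<close>

definition generic ::
    "('f, 'r) lang \<Rightarrow> ('f, 'r, 'b) fo_struct \<Rightarrow> ('x \<Rightarrow> 'b) \<Rightarrow> 'b \<Rightarrow> 'b set \<Rightarrow> bool" where
  "generic L M a e B \<longleftrightarrow> (\<forall>\<phi> w. wf_fm L \<phi> \<longrightarrow> range w \<subseteq> universe M \<longrightarrow>
     w ` (fv \<phi> - {0}) \<subseteq> B \<longrightarrow> finite {x. \<not> sat M (w(0 := a x)) \<phi>} \<longrightarrow> sat M (w(0 := e)) \<phi>)"

lemma generic_mono: "generic L M a e B \<Longrightarrow> B' \<subseteq> B \<Longrightarrow> generic L M a e B'"
  unfolding generic_def by (meson order_trans)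

lemma dfn_ball:
  assumes "finite S" "\<And>j. j \<in> S \<Longrightarrow> dfn L M (F j) (Q j)"
  shows "S \<noteq> {} \<Longrightarrow> dfn L M (\<Union>j\<in>S. F j) (\<lambda>v. \<forall>j\<in>S. Q j v)"
  using assms
proof (induction S rule: finite_induct)
  case (insert j S)
  show ?case
  proof (cases "S = {}")
    case False
    then have "dfn L M (F j \<union> (\<Union>j\<in>S. F j)) (\<lambda>v. Q j v \<and> (\<forall>j\<in>S. Q j v))"
      using insert by (intro dfn_conj) auto
    then show ?thesis by simp
  qed (use insert in simp)
qed simp

text \<open>
  \<open>Lf x\<close> is the code of \<open>a x\<close>, and \<open>Wt s n\<close> that of the \<open>n\<close>th element added to the model for the finite
  set \<open>s\<close>.  The terms \<open>a (Inl j)\<close> belong to all models; they form the base over which \<open>p\<close> is defined.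
\<close>

datatype 'i code = Lf "nat + 'i" | Wt "'i set" nat

primrec supp :: "'i code \<Rightarrow> 'i set" where
  "supp (Lf x) = (case x of Inl _ \<Rightarrow> {} | Inr i \<Rightarrow> {i})"
| "supp (Wt s n) = s"

text \<open>The predecessors of \<open>Wt s n\<close> in the construction; local isolation of the
  new element is demanded over their values.\<close>

definition Bel :: "'i set \<Rightarrow> nat \<Rightarrow> 'i code set" where
  "Bel s n = {Lf x | x. supp (Lf x) \<subseteq> s} \<union> {Wt t m | t m. t \<subset> s} \<union> {Wt s m | m. m < n}"

lemma Wt_notin_Bel: "Wt s n \<notin> Bel s n"
  by (auto simp: Bel_def)

lemma supp_Bel: "d \<in> Bel s n \<Longrightarrow> supp d \<subseteq> s"
  by (auto simp: Bel_def)

lemma countable_supp: 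
  assumes "finite s"
  shows "countable {d :: 'i code. supp d \<subseteq> s}"
proof -
  have "{d. supp d \<subseteq> s} \<subseteq> Lf ` (range Inl \<union> Inr ` s) \<union> (\<lambda>(t, n). Wt t n) ` (Pow s \<times> UNIV)"
  proof
    fix d assume "d \<in> {d. supp d \<subseteq> s}"
    then show "d \<in> Lf ` (range Inl \<union> Inr ` s) \<union> (\<lambda>(t, n). Wt t n) ` (Pow s \<times> UNIV)"
      by (cases d) (auto split: sum.splits)
  qed
  moreover have "countable (Lf ` (range Inl \<union> Inr ` s) \<union> (\<lambda>(t, n). Wt t n) ` (Pow s \<times> (UNIV :: nat set)))"
    using countable_finite[OF assms] countable_finite[of "Pow s"] assms by simp
  ultimately show ?thesis by (rule countable_subset)
qed

text \<open>What is used of the ultrapower. The bound in \<open>definition_a\<close> is uniform in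
  the parameters, so finitely many terms can test a formula; \<open>indiscernible\<close> exchanges
  terms that avoid the parameters; \<open>regular\<close> is required only over sets containing the
  base \<open>range (a \<circ> Inl)\<close>.\<close>

locale ambient =
  fixes L :: "('f, 'r) lang" and M :: "('f, 'r, 'b) fo_struct" and a :: "nat + 'i \<Rightarrow> 'b"
  assumes countable_L: "countable_lang L"
    and struct: "is_struct L M"
    and a_in: "a i \<in> universe M"
    and a_inj: "inj a"
    and isolated_ex: "\<lbrakk>B \<subseteq> universe M; wf_fm L \<chi>; range u \<subseteq> B; x \<in> universe M; sat M (u(0 := x)) \<chi>\<rbrakk>
      \<Longrightarrow> \<exists>e\<in>universe M. sat M (u(0 := e)) \<chi> \<and> isolated L M e B"
    and definition_a: "wf_fm L \<phi> \<Longrightarrow> \<exists>n. \<forall>w. range w \<subseteq> universe M \<longrightarrow>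
      (finite {x. \<not> sat M (w(0 := a x)) \<phi>} \<and> card {x. \<not> sat M (w(0 := a x)) \<phi>} \<le> n) \<or>
      (finite {x. sat M (w(0 := a x)) \<phi>} \<and> card {x. sat M (w(0 := a x)) \<phi>} \<le> n)"
    and indiscernible: "\<lbrakk>wf_fm L \<phi>; i \<notin> h ` (fv \<phi> - {0}); j \<notin> h ` (fv \<phi> - {0})\<rbrakk> \<Longrightarrow>
      sat M ((a \<circ> h)(0 := a i)) \<phi> = sat M ((a \<circ> h)(0 := a j)) \<phi>"
    and regular: "\<lbrakk>range (a \<circ> Inl) \<subseteq> B; B \<subseteq> universe M; q \<in> universe M; c \<in> universe M;
      generic L M a c B; \<not> generic L M a q B\<rbrakk> \<Longrightarrow> generic L M a c (insert q B)"
begin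

abbreviation U where "U \<equiv> universe M"
abbreviation gen where "gen \<equiv> generic L M a"

lemma gen_dfn:
  fixes Q :: "('x \<Rightarrow> 'b) \<Rightarrow> bool"
  assumes "gen e B" "dfn L M F Q" "range v \<subseteq> U" "v ` (F - {y}) \<subseteq> B" "finite {x. \<not> Q (v(y := a x))}"
  shows "Q (v(y := e))"
proof -
  obtain \<phi> g where \<phi>: "wf_fm L \<phi>" "g ` (fv \<phi> - {0}) \<subseteq> F - {y}"
    "\<And>v a. Q (v(y := a)) \<longleftrightarrow> sat M ((v \<circ> g)(0 := a)) \<phi>"
    using dfn_coord[OF assms(2), of y] by blast
  have "(v \<circ> g) ` (fv \<phi> - {0}) \<subseteq> B" using \<phi>(2) assms(4) by (auto simp: image_subset_iff)
  moreover have "range (v \<circ> g) \<subseteq> U" using assms(3) by auto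
  ultimately show ?thesis using assms(1,5) \<phi>(1) unfolding \<phi>(3) generic_def by blast
qed

lemma definition_dfn:
  fixes Q :: "('x \<Rightarrow> 'b) \<Rightarrow> bool"
  assumes "dfn L M F Q"
  shows "\<exists>n. \<forall>v. range v \<subseteq> U \<longrightarrow>
      (finite {x. \<not> Q (v(y := a x))} \<and> card {x. \<not> Q (v(y := a x))} \<le> n) \<or>
      (finite {x. Q (v(y := a x))} \<and> card {x. Q (v(y := a x))} \<le> n)"
proof -
  obtain \<phi> g where \<phi>: "wf_fm L \<phi>" "\<And>v a. Q (v(y := a)) \<longleftrightarrow> sat M ((v \<circ> g)(0 := a)) \<phi>"
    using dfn_coord[OF assms, of y] by blast
  obtain n where n: "\<And>w. range w \<subseteq> U \<Longrightarrow>
      (finite {x. \<not> sat M (w(0 := a x)) \<phi>} \<and> card {x. \<not> sat M (w(0 := a x)) \<phi>} \<le> n) \<or>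
      (finite {x. sat M (w(0 := a x)) \<phi>} \<and> card {x. sat M (w(0 := a x)) \<phi>} \<le> n)"
    using definition_a[OF \<phi>(1)] by blast
  show ?thesis
  proof (intro exI[of _ n] allI impI)
    fix v :: "'x \<Rightarrow> 'b" assume "range v \<subseteq> U"
    then have "range (v \<circ> g) \<subseteq> U" by auto
    then show "(finite {x. \<not> Q (v(y := a x))} \<and> card {x. \<not> Q (v(y := a x))} \<le> n) \<or>
      (finite {x. Q (v(y := a x))} \<and> card {x. Q (v(y := a x))} \<le> n)"
      unfolding \<phi>(2) by (rule n)
  qed
qed

lemma indiscernible_dfn:
  fixes Q :: "('x \<Rightarrow> 'b) \<Rightarrow> bool"
  assumes "dfn L M F Q" "x \<notin> h ` (F - {y})" "x' \<notin> h ` (F - {y})"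
  shows "Q ((a \<circ> h)(y := a x)) = Q ((a \<circ> h)(y := a x'))"
proof -
  obtain \<phi> g where \<phi>: "wf_fm L \<phi>" "g ` (fv \<phi> - {0}) \<subseteq> F - {y}"
    "\<And>v a. Q (v(y := a)) \<longleftrightarrow> sat M ((v \<circ> g)(0 := a)) \<phi>"
    using dfn_coord[OF assms(1), of y] by blast
  have "(h \<circ> g) ` (fv \<phi> - {0}) \<subseteq> h ` (F - {y})"
    unfolding image_comp[symmetric] by (rule image_mono[OF \<phi>(2)])
  then have "x \<notin> (h \<circ> g) ` (fv \<phi> - {0})" "x' \<notin> (h \<circ> g) ` (fv \<phi> - {0})"
    using assms(2,3) by blast+
  then show ?thesis
    unfolding \<phi>(3) comp_assoc by (rule indiscernible[OF \<phi>(1)])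
qed

text \<open>Some term that satisfies the formula avoids its parameters, and indiscernibility carries
  the formula from it to \<open>a x\<close>.\<close>

lemma a_generic: "gen (a x) (a ` (UNIV - {x}))"
  unfolding generic_def
proof (intro allI impI)
  fix \<phi> w assume \<phi>: "wf_fm L \<phi>" and w: "w ` (fv \<phi> - {0}) \<subseteq> a ` (UNIV - {x})"
    and fin: "finite {x. \<not> sat M (w(0 := a x)) \<phi>}"
  have "\<exists>y. y \<noteq> x \<and> a y = w n" if "n \<in> fv \<phi> - {0}" for n
  proof -
    have "w n \<in> a ` (UNIV - {x})" using w that by blast
    then show ?thesis by auto
  qed
  then obtain h where h: "\<And>n. n \<in> fv \<phi> - {0} \<Longrightarrow> h n \<noteq> x \<and> a (h n) = w n" by metis
  have eq: "sat M (w(0 := e)) \<phi> = sat M ((a \<circ> h)(0 := e)) \<phi>" for e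
    by (rule sat_cong) (use h in auto)
  have "infinite (UNIV :: (nat + 'i) set)" by simp
  then obtain y where y: "y \<notin> h ` (fv \<phi> - {0}) \<union> {x. \<not> sat M (w(0 := a x)) \<phi>}"
    using fin ex_new_if_finite[of "h ` (fv \<phi> - {0}) \<union> {x. \<not> sat M (w(0 := a x)) \<phi>}"]
    by (auto simp: finite_fv)
  have "x \<notin> h ` (fv \<phi> - {0})" using h by blast
  then have "sat M ((a \<circ> h)(0 := a x)) \<phi> = sat M ((a \<circ> h)(0 := a y)) \<phi>"
    using indiscernible[OF \<phi>, of x h y] y by blast
  then show "sat M (w(0 := a x)) \<phi>" using y unfolding eq by blast
qed

text \<open>An element in the closure of \<open>B\<close> is in the closure of every larger set, so
  strong regularity adds such elements one at a time; a formula has only finitely many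
  parameters.\<close>

lemma gen_absorb:
  assumes "gen c B" "range (a \<circ> Inl) \<subseteq> B" "B \<subseteq> U" "c \<in> U" "\<And>b. b \<in> X \<Longrightarrow> b \<in> U \<and> \<not> gen b B"
  shows "gen c (B \<union> X)"
proof -
  have fin: "gen c (B \<union> Y)" if "finite Y" "Y \<subseteq> X" for Y
    using that
  proof (induction Y)
    case (insert b Y)
    then have "gen c (insert b (B \<union> Y))"
      using assms generic_mono[of L M a b "B \<union> Y" B]
      by (intro regular) (auto simp: subset_iff)
    then show ?case by simp
  qed (use assms in simp)
  show ?thesis
    unfolding generic_def
  proof (intro allI impI)
    fix \<phi> w assume \<phi>: "wf_fm L \<phi>" "range w \<subseteq> U" "w ` (fv \<phi> - {0}) \<subseteq> B \<union> X"
      "finite {x. \<not> sat M (w(0 := a x)) \<phi>}"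
    have "gen c (B \<union> (w ` (fv \<phi> - {0}) \<inter> X))"
      by (rule fin) (auto simp: finite_fv)
    moreover have "w ` (fv \<phi> - {0}) \<subseteq> B \<union> (w ` (fv \<phi> - {0}) \<inter> X)" using \<phi>(3) by blast
    ultimately show "sat M (w(0 := c)) \<phi>" using \<phi> unfolding generic_def by blast
  qed
qed

text \<open>Isolation is applied to equality. A formula that holds of a generic element holds of
  almost all terms, hence of two distinct base terms in \<open>B\<close>, and cannot decide whether
  \<open>x\<close> equals one of them.\<close>

lemma isolated_not_generic:
  assumes "isolated L M e B" "range (a \<circ> Inl) \<subseteq> B" "B \<subseteq> U"
  shows "\<not> gen e B"
proof
  assume g: "gen e B"
  obtain \<psi> u where \<psi>: "wf_fm L \<psi>" "range u \<subseteq> B" "sat M (u(0 := e)) \<psi>"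
    and dec: "\<And>w. range w \<subseteq> B \<Longrightarrow>
        (\<forall>x\<in>U. sat M (u(0 := x)) \<psi> \<longrightarrow> sat M (w(0 := x)) (Eq (Var 0) (Var 1))) \<or>
        (\<forall>x\<in>U. sat M (u(0 := x)) \<psi> \<longrightarrow> \<not> sat M (w(0 := x)) (Eq (Var 0) (Var 1)))"
    using assms(1) unfolding isolated_def by (metis wf_fm.simps(1) wf_tm.simps(1))
  have uU: "range u \<subseteq> U" using \<psi>(2) assms(3) by blast
  have "infinite {x. sat M (u(0 := a x)) \<psi>}"
  proof
    assume "finite {x. sat M (u(0 := a x)) \<psi>}"
    then have "sat M (u(0 := e)) (Neg \<psi>)"
      using g \<psi> uU unfolding generic_def by (auto dest!: spec[of _ "Neg \<psi>"] spec[of _ u])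
    then show False using \<psi>(3) by simp
  qed
  then have "finite {x. \<not> sat M (u(0 := a x)) \<psi>}"
    using definition_a[OF \<psi>(1)] uU by blast
  then have "finite (Inl -` {x. \<not> sat M (u(0 := a x)) \<psi>} :: nat set)"
    by (rule finite_vimageI) simp
  then obtain j where j: "j \<notin> Inl -` {x. \<not> sat M (u(0 := a x)) \<psi>}"
    using ex_new_if_finite[OF infinite_UNIV_nat] by blast
  obtain k where k: "k \<notin> insert j (Inl -` {x. \<not> sat M (u(0 := a x)) \<psi>})"
    using ex_new_if_finite[OF infinite_UNIV_nat]
      \<open>finite (Inl -` {x. \<not> sat M (u(0 := a x)) \<psi>})\<close> by (meson finite_insert)
  have "range (\<lambda>_. a (Inl j)) \<subseteq> B" using assms(2) by auto
  then have "a (Inl k) = a (Inl j)" using dec[of "\<lambda>_. a (Inl j)"] a_in j k by auto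
  then show False using a_inj k by (auto dest: injD)
qed

text \<open>
  Every formula over \<open>B \<union> range e\<close> is a task at infinitely many stages, hence at one that comes after
  all its parameters.
\<close>

lemma constructible_ex:
  assumes B: "countable B" "B \<noteq> {}" "B \<subseteq> U"
  shows "\<exists>e :: nat \<Rightarrow> 'b. (\<forall>n. e n \<in> U \<and> isolated L M (e n) (B \<union> e ` {..<n})) \<and>
    (\<forall>\<phi> w. wf_fm L \<phi> \<longrightarrow> range w \<subseteq> B \<union> range e \<longrightarrow> (\<exists>x\<in>U. sat M (w(0 := x)) \<phi>) \<longrightarrow>
      (\<exists>y\<in>B \<union> range e. sat M (w(0 := y)) \<phi>))"
proof -
  define b where "b = from_nat_into B"
  have b: "range b = B" unfolding b_def by (rule range_from_nat_into[OF B(2,1)])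
  define T where "T = {\<phi>. wf_fm L \<phi>} \<times> (UNIV :: nat list set)"
  have T: "countable T" "T \<noteq> {}"
    using countable_wf_fm[OF countable_L] by (auto simp: T_def intro!: exI[of _ "Eq (Var 0) (Var 0)"])
  define task where "task n = from_nat_into T (fst (prod_decode n))" for n
  have taskT: "fst (task n) \<in> {\<phi>. wf_fm L \<phi>}" for n
    using from_nat_into[OF T(2)] by (auto simp: task_def T_def mem_Times_iff)
  define y where "y f r = (if even r then b (r div 2) else f (r div 2))" for f :: "nat \<Rightarrow> 'b" and r :: nat
  \<comment> \<open>A task lists its parameters by positions, even ones for \<open>B\<close> and odd
    ones for new elements. Positions not yet constructed and variables beyond the list get the
    default \<open>b 0\<close>.\<close>
  define w where "w n f m = (let l = snd (task n) in
      if m < length l \<and> (even (l ! m) \<or> (l ! m) div 2 < n) then y f (l ! m) else b 0)" for n f m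
  define Q where "Q n f x \<longleftrightarrow> x \<in> U \<and> isolated L M x (B \<union> f ` {..<n}) \<and>
    ((\<exists>z\<in>U. sat M ((w n f)(0 := z)) (fst (task n))) \<longrightarrow> sat M ((w n f)(0 := x)) (fst (task n)))" for n f x
  have "\<exists>e. \<forall>n. Q n e (e n)"
  proof (rule seq_choice)
    fix n and f :: "nat \<Rightarrow> 'b"
    assume "\<And>m. m < n \<Longrightarrow> Q m f (f m)"
    then have BU: "B \<union> f ` {..<n} \<subseteq> U" using B(3) by (auto simp: Q_def)
    have wB: "range (w n f) \<subseteq> B \<union> f ` {..<n}"
      using b by (auto simp: w_def y_def Let_def)
    show "\<exists>x. Q n f x"
    proof (cases "\<exists>z\<in>U. sat M ((w n f)(0 := z)) (fst (task n))")
      case True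
      then obtain z where z: "z \<in> U" "sat M ((w n f)(0 := z)) (fst (task n))" by blast
      then show ?thesis using isolated_ex[OF BU _ wB z] taskT by (auto simp: Q_def)
    next
      case False
      obtain z where "z \<in> U" using B by blast
      \<comment> \<open>A task without solution still adds a locally isolated element, so the
        sequence never stops.\<close>
      then have "\<exists>e\<in>U. sat M ((w n f)(0 := e)) (Eq (Var 0) (Var 0)) \<and> isolated L M e (B \<union> f ` {..<n})"
        by (intro isolated_ex[OF BU _ wB]) auto
      then show ?thesis using False by (auto simp: Q_def)
    qed
  next
    fix n and f g :: "nat \<Rightarrow> 'b" and x
    assume eq: "\<And>m. m < n \<Longrightarrow> f m = g m"
    then have "f ` {..<n} = g ` {..<n}" by (intro image_cong) auto
    moreover have "w n f = w n g" using eq by (auto simp: w_def y_def Let_def)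
    ultimately show "Q n f x = Q n g x" by (simp add: Q_def)
  qed
  then obtain e where e: "\<And>n. Q n e (e n)" by blast
  have "\<exists>z\<in>B \<union> range e. sat M (v(0 := z)) \<phi>"
    if \<phi>: "wf_fm L \<phi>" and v: "range v \<subseteq> B \<union> range e" and x: "x \<in> U" "sat M (v(0 := x)) \<phi>" for \<phi> v x
  proof -
    have "\<exists>r. y e r = v m" for m
    proof -
      consider i where "v m = b i" | i where "v m = e i" using v b by blast
      then show ?thesis
      proof cases
        case 1
        then show ?thesis by (intro exI[of _ "2 * i"]) (simp add: y_def)
      next
        case 2
        then show ?thesis by (intro exI[of _ "2 * i + 1"]) (simp add: y_def)
      qed
    qed
    then obtain r where r: "\<And>m. y e (r m) = v m" by metis
    obtain K where K: "fv \<phi> \<subseteq> {..<K}" using finite_nat_bounded[OF finite_fv] by blast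
    have "(\<phi>, map r [0..<K]) \<in> T" using \<phi> by (simp add: T_def)
    then obtain k where k: "from_nat_into T k = (\<phi>, map r [0..<K])"
      using T from_nat_into_surj by metis
    define n where "n = prod_encode (k, Suc (\<Sum>m<K. r m))"
    have tn: "task n = (\<phi>, map r [0..<K])" by (simp add: task_def n_def k)
    have rn: "r m div 2 < n" if "m < K" for m
    proof -
      have "r m \<le> (\<Sum>m<K. r m)" using that by (intro member_le_sum) auto
      also have "\<dots> < n" unfolding n_def using le_prod_encode_2 Suc_le_lessD by blast
      finally show ?thesis by (meson div_le_dividend le_less_trans)
    qed
    have wv: "sat M ((w n e)(0 := z)) \<phi> = sat M (v(0 := z)) \<phi>" for z
      by (rule sat_cong) (use K rn r in \<open>auto simp: w_def tn Let_def\<close>)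
    then have "sat M ((w n e)(0 := e n)) \<phi>" using e[of n] x by (auto simp: Q_def tn)
    then show ?thesis using wv by blast
  qed
  then show ?thesis using e by (intro exI[of _ e]) (auto simp: Q_def)
qed

end

section \<open>The system of countable models\<close>

locale system = ambient L M a for L :: "('f, 'r) lang" and M :: "('f, 'r, 'b) fo_struct"
    and a :: "nat + 'i \<Rightarrow> 'b" +
  fixes val :: "'i code \<Rightarrow> 'b"
  assumes val_Lf: "val (Lf i) = a i"
    and val_in: "val d \<in> universe M"
    and val_isolated: "finite s \<Longrightarrow> isolated L M (val (Wt s n)) (val ` Bel s n)"
    and val_elementary: "\<lbrakk>finite s; wf_fm L \<phi>; range w \<subseteq> val ` {d. supp d \<subseteq> s}; x \<in> universe M;
      sat M (w(0 := x)) \<phi>\<rbrakk> \<Longrightarrow> \<exists>d. supp d \<subseteq> s \<and> sat M (w(0 := val d)) \<phi>"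

text \<open>Recursion on finite sets under strict inclusion, since the base of \<open>s\<close> uses
  only the models of its proper subsets. Codes with an infinite first component get the harmless
  value \<open>a (Inl 0)\<close>, which makes \<open>val\<close> total.\<close>

lemma (in ambient) system_ex: "\<exists>val. system L M a val"
proof -
  define Base where "Base E s = a ` {x. supp (Lf x) \<subseteq> s} \<union> (\<Union>t\<in>{t. t \<subset> s}. range (E t))"
    for E :: "'i set \<Rightarrow> nat \<Rightarrow> 'b" and s
  define con where "con B e \<longleftrightarrow> (\<forall>n. e n \<in> U \<and> isolated L M (e n) (B \<union> e ` {..<n})) \<and>
    (\<forall>\<phi> w. wf_fm L \<phi> \<longrightarrow> range w \<subseteq> B \<union> range e \<longrightarrow> (\<exists>x\<in>U. sat M (w(0 := x)) \<phi>) \<longrightarrow>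
      (\<exists>y\<in>B \<union> range e. sat M (w(0 := y)) \<phi>))" for B and e :: "nat \<Rightarrow> 'b"
  have "\<exists>E. \<forall>s. finite s \<longrightarrow> con (Base E s) (E s)"
  proof (rule dependent_wf_choice[of finite_psubset "\<lambda>E s e. finite s \<longrightarrow> con (Base E s) e"])
    fix f g :: "'i set \<Rightarrow> nat \<Rightarrow> 'b" and s r
    assume eq: "\<And>t. (t, s) \<in> finite_psubset \<Longrightarrow> f t = g t"
    have "Base f s = Base g s" if "finite s"
      using eq that unfolding Base_def by (intro arg_cong2[where f = "(\<union>)"] refl SUP_cong) auto
    then show "(finite s \<longrightarrow> con (Base f s) r) = (finite s \<longrightarrow> con (Base g s) r)" by auto
  next
    fix s and E :: "'i set \<Rightarrow> nat \<Rightarrow> 'b"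
    assume IH: "\<And>t. (t, s) \<in> finite_psubset \<Longrightarrow> finite t \<longrightarrow> con (Base E t) (E t)"
    show "\<exists>e. finite s \<longrightarrow> con (Base E s) e"
    proof (cases "finite s")
      case True
      have "{x. supp (Lf x) \<subseteq> s} \<subseteq> range Inl \<union> Inr ` s"
      proof
        fix x assume "x \<in> {x. supp (Lf x) \<subseteq> s}"
        then show "x \<in> range Inl \<union> Inr ` s" by (cases x) auto
      qed
      then have "countable {x :: nat + 'i. supp (Lf x) \<subseteq> s}"
        by (rule countable_subset) (use True in \<open>auto intro: countable_finite\<close>)
      moreover have "countable {t. t \<subset> s}"
        by (rule countable_finite, rule finite_subset[of _ "Pow s"]) (use True in auto)
      ultimately have "countable (Base E s)" unfolding Base_def by auto
      moreover have "Base E s \<noteq> {}"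
      proof -
        have "a (Inl 0) \<in> Base E s" by (auto simp: Base_def)
        then show ?thesis by blast
      qed
      moreover have "Base E s \<subseteq> U"
      proof -
        have "E t n \<in> U" if "t \<subset> s" for t n
          using IH[of t] that True finite_subset[of t s] by (auto simp: con_def)
        then show ?thesis using a_in by (auto simp: Base_def)
      qed
      ultimately show ?thesis using constructible_ex[of "Base E s"] unfolding con_def by blast
    qed auto
  qed simp
  then obtain E where E: "\<And>s. finite s \<Longrightarrow> con (Base E s) (E s)" by blast
  define val where "val d = (case d of Lf x \<Rightarrow> a x | Wt s n \<Rightarrow> if finite s then E s n else a (Inl 0))" for d
  have sub: "{Lf x | x. supp (Lf x) \<subseteq> s} = Lf ` {x. supp (Lf x) \<subseteq> s}" for s :: "'i set" by auto
  have Bel: "val ` Bel s n = Base E s \<union> E s ` {..<n}" if s: "finite s" for s n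
  proof -
    have "val ` {Wt t m | t m. t \<subset> s} = (\<Union>t\<in>{t. t \<subset> s}. range (E t))"
    proof -
      have "val (Wt t m) = E t m" if "t \<subset> s" for t m
        using that s finite_subset[of t s] by (auto simp: val_def)
      moreover have "{Wt t m | t m. t \<subset> s} = (\<Union>t\<in>{t. t \<subset> s}. Wt t ` UNIV)" by auto
      ultimately show ?thesis by (simp add: image_UN image_image)
    qed
    moreover have "val ` {Wt s m | m. m < n} = E s ` {..<n}"
    proof -
      have "{Wt s m | m. m < n} = Wt s ` {..<n}" by auto
      then show ?thesis using s by (simp add: image_image val_def)
    qed
    moreover have "val ` {Lf x | x. supp (Lf x) \<subseteq> s} = a ` {x. supp (Lf x) \<subseteq> s}"
      unfolding sub by (simp add: image_image val_def)
    ultimately show ?thesis by (simp add: Bel_def Base_def image_Un)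
  qed
  have all: "val ` {d. supp d \<subseteq> s} = Base E s \<union> range (E s)" if s: "finite s" for s
  proof -
    have "{d. supp d \<subseteq> s} = (\<Union>n. Bel s n)"
    proof (intro set_eqI iffI)
      fix d assume "d \<in> {d. supp d \<subseteq> s}"
      then show "d \<in> (\<Union>n. Bel s n)" by (cases d) (auto simp: Bel_def)
    qed (auto dest: supp_Bel)
    then have "val ` {d. supp d \<subseteq> s} = (\<Union>n. val ` Bel s n)" by auto
    also have "\<dots> = Base E s \<union> range (E s)" unfolding Bel[OF s] by auto
    finally show ?thesis .
  qed
  have "system L M a val"
  proof
    show "val (Lf x) = a x" for x by (simp add: val_def)
    show "val d \<in> U" for d
      using a_in E by (auto simp: val_def con_def split: code.split)
    show "isolated L M (val (Wt s n)) (val ` Bel s n)" if "finite s" for s n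
      using E[OF that] that Bel by (simp add: con_def val_def)
    show "\<exists>d. supp d \<subseteq> s \<and> sat M (w(0 := val d)) \<phi>"
      if "finite s" "wf_fm L \<phi>" "range w \<subseteq> val ` {d. supp d \<subseteq> s}" "x \<in> U" "sat M (w(0 := x)) \<phi>"
      for s \<phi> w x
    proof -
      have "\<exists>y\<in>Base E s \<union> range (E s). sat M (w(0 := y)) \<phi>"
        using E[OF that(1)] that unfolding con_def all[OF that(1)] by blast
      then show ?thesis unfolding all[OF that(1), symmetric] by blast
    qed
  qed
  then show ?thesis by blast
qed

section \<open>Independence in the system of models\<close>

definition below :: "(('i set \<times> nat) \<times> ('i set \<times> nat)) set" where
  "below = finite_psubset <*lex*> less_than"

lemma wf_below: "wf below"
  unfolding below_def by (intro wf_lex_prod) auto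

lemma below_iff: "((t, m), (s, n)) \<in> below \<longleftrightarrow> t \<subset> s \<and> finite s \<or> t = s \<and> m < n"
  by (auto simp: below_def)

lemma trans_below: "trans below"
  unfolding below_def by (intro trans_lex_prod trans_finite_psubset trans_less_than)

text \<open>\<open>d\<close> is neither \<open>Wt s n\<close> nor above it in the order of the construction.\<close>

definition nabove :: "'i set \<Rightarrow> nat \<Rightarrow> 'i code \<Rightarrow> bool" where
  "nabove s n d \<longleftrightarrow> (case d of Lf _ \<Rightarrow> True | Wt t m \<Rightarrow> \<not> s \<subset> t \<and> (t = s \<longrightarrow> m < n))"

text \<open>The constructed elements still to be eliminated: \<open>A = {}\<close> counts all of
  them, \<open>A = Pow J\<close> only those outside the model for \<open>J\<close>.\<close>

definition wits :: "'i set set \<Rightarrow> 'i code set \<Rightarrow> ('i set \<times> nat) set" where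
  "wits A F = {(s, n). Wt s n \<in> F \<and> s \<notin> A}"

lemma finite_wits: "finite F \<Longrightarrow> finite (wits A F)"
proof -
  assume "finite F"
  moreover have "wits A F \<subseteq> (\<lambda>(s, n). Wt s n) -` F" by (auto simp: wits_def)
  moreover have "inj (\<lambda>(s, n). Wt s n)" by (auto simp: inj_on_def)
  ultimately show ?thesis using finite_vimageI finite_subset by metis
qed

text \<open>The measure of both elimination arguments. One element is traded for finitely many
  earlier ones, possibly more than one, so a multiset order is needed instead of a number.\<close>

lemma wits_mult1:
  assumes "finite F" "finite G" "G \<subseteq> Bel s n" "Wt s n \<in> F" "s \<notin> A" "finite s"
  shows "(mset_set (wits A ((F - {Wt s n}) \<union> G)), mset_set (wits A F)) \<in> mult1 below"
proof -
  let ?F' = "wits A (F - {Wt s n})"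
  have "wits A F = insert (s, n) ?F'" using assms(4,5) by (auto simp: wits_def)
  moreover have "(s, n) \<notin> ?F'" by (auto simp: wits_def)
  ultimately have 1: "mset_set (wits A F) = add_mset (s, n) (mset_set ?F')"
    using assms(1) by (simp add: finite_wits)
  have "wits A ((F - {Wt s n}) \<union> G) = ?F' \<union> (wits A G - ?F')" by (auto simp: wits_def)
  then have 2: "mset_set (wits A ((F - {Wt s n}) \<union> G)) = mset_set ?F' + mset_set (wits A G - ?F')"
    using assms(1,2) by (simp only:) (rule mset_set_Union, auto simp: finite_wits)
  have "(p, (s, n)) \<in> below" if "p \<in># mset_set (wits A G - ?F')" for p
  proof -
    have "p \<in> wits A G" using that assms(2) by (simp add: finite_wits)
    then show ?thesis using assms(3,6) by (cases p) (auto simp: wits_def Bel_def below_iff)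
  qed
  then show ?thesis unfolding mult1_def using 1 2 by blast
qed

text \<open>Isolation concerns the predecessors of an element; it reaches the other elements in
  \<open>F\<close> only if none of them lies above the one chosen for elimination.\<close>

lemma wits_maximal:
  assumes "finite F" "wits A F \<noteq> {}" "\<And>d. d \<in> F \<Longrightarrow> finite (supp d)"
  shows "\<exists>s n. Wt s n \<in> F \<and> s \<notin> A \<and> (\<forall>t m. Wt t m \<in> F - {Wt s n} \<longrightarrow> t \<notin> A \<longrightarrow> nabove s n (Wt t m))"
proof -
  have "\<exists>p\<in>wits A F. \<forall>q\<in>wits A F. q \<noteq> p \<longrightarrow> (p, q) \<notin> below"
  proof (rule Finite_Set.bex_max_element)
    show "asymp_on (wits A F) (\<lambda>p q. (p, q) \<in> below)"
      using wf_below by (auto intro!: asymp_onI dest: wf_asym)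
    show "transp_on (wits A F) (\<lambda>p q. (p, q) \<in> below)"
      using trans_below by (auto intro!: transp_onI dest: transD)
  qed (use assms finite_wits in auto)
  then obtain s n where sn: "(s, n) \<in> wits A F"
    "\<And>t m. (t, m) \<in> wits A F \<Longrightarrow> (t, m) \<noteq> (s, n) \<Longrightarrow> ((s, n), (t, m)) \<notin> below" by auto
  have "nabove s n (Wt t m)" if "Wt t m \<in> F - {Wt s n}" "t \<notin> A" for t m
  proof -
    have "finite t" using assms(3)[of "Wt t m"] that by simp
    moreover have "(t, m) \<in> wits A F" "(t, m) \<noteq> (s, n)" using that by (auto simp: wits_def)
    then have "((s, n), (t, m)) \<notin> below" by (rule sn(2))
    ultimately show ?thesis using that by (auto simp: below_iff nabove_def)
  qed
  then show ?thesis using sn(1) by (auto simp: wits_def)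
qed

lemma isolatedE:
  assumes "isolated L M e B" "wf_fm L \<phi>"
  obtains \<psi> u where "wf_fm L \<psi>" "range u \<subseteq> B" "sat M (u(0 := e)) \<psi>"
    "\<forall>w. range w \<subseteq> B \<longrightarrow>
        (\<forall>x\<in>universe M. sat M (u(0 := x)) \<psi> \<longrightarrow> sat M (w(0 := x)) \<phi>) \<or>
        (\<forall>x\<in>universe M. sat M (u(0 := x)) \<psi> \<longrightarrow> \<not> sat M (w(0 := x)) \<phi>)"
  using spec[OF assms(1)[unfolded isolated_def], THEN mp, OF assms(2)] by (elim exE conjE)

context system
begin

text \<open>Isolation of \<open>val (Wt s n)\<close> in terms of definable predicates; \<open>x0\<close> is its coordinate in \<open>Q\<close>.\<close>

definition decides ::
    "'i set \<Rightarrow> nat \<Rightarrow> (('i code \<Rightarrow> 'b) \<Rightarrow> bool) \<Rightarrow> 'x \<Rightarrow> (('x \<Rightarrow> 'b) \<Rightarrow> bool) \<Rightarrow> ('x \<Rightarrow> 'i code) \<Rightarrow> bool" where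
  "decides s n R x0 Q \<sigma> \<longleftrightarrow>
     (\<forall>x\<in>U. R (val(Wt s n := x)) \<longrightarrow> Q ((val \<circ> \<sigma>)(x0 := x))) \<or>
     (\<forall>x\<in>U. R (val(Wt s n := x)) \<longrightarrow> \<not> Q ((val \<circ> \<sigma>)(x0 := x)))"

text \<open>Local isolation supplies a single formula for all tuples of predecessors. This
  uniformity in \<open>\<sigma>\<close> is what allows the parameters of \<open>Q\<close> to be
  moved while \<open>R\<close> stays.\<close>

lemma isolating_predicate:
  fixes Q :: "('x \<Rightarrow> 'b) \<Rightarrow> bool"
  assumes "finite s" "dfn L M F Q"
  shows "\<exists>R G. finite G \<and> G \<subseteq> Bel s n \<and> dfn L M (insert (Wt s n) G) R \<and> R val \<and>
    (\<forall>\<sigma>. \<sigma> ` (F - {x0}) \<subseteq> Bel s n \<longrightarrow> decides s n R x0 Q \<sigma>)"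
proof -
  let ?c = "Wt s n"
  obtain \<phi> g where \<phi>: "wf_fm L \<phi>" "g ` (fv \<phi> - {0}) \<subseteq> F - {x0}"
    "\<And>v a. Q (v(x0 := a)) \<longleftrightarrow> sat M ((v \<circ> g)(0 := a)) \<phi>"
    using dfn_coord[OF assms(2), of x0] by blast
  obtain \<psi> u where \<psi>: "wf_fm L \<psi>" "range u \<subseteq> val ` Bel s n" "sat M (u(0 := val ?c)) \<psi>"
    and dec: "\<forall>w. range w \<subseteq> val ` Bel s n \<longrightarrow>
        (\<forall>x\<in>U. sat M (u(0 := x)) \<psi> \<longrightarrow> sat M (w(0 := x)) \<phi>) \<or>
        (\<forall>x\<in>U. sat M (u(0 := x)) \<psi> \<longrightarrow> \<not> sat M (w(0 := x)) \<phi>)"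
    by (rule isolatedE[OF val_isolated[OF assms(1), of n] \<phi>(1)])
  have "\<exists>d. d \<in> Bel s n \<and> val d = u k" for k
  proof -
    have "u k \<in> val ` Bel s n" using \<psi>(2) by (meson rangeI subsetD)
    then obtain d where "u k = val d" "d \<in> Bel s n" by (rule imageE)
    then show ?thesis by (intro exI[of _ d]) simp
  qed
  then obtain k where k: "\<And>i. k i \<in> Bel s n \<and> val (k i) = u i" by metis
  define R where "R v = sat M (v \<circ> k(0 := ?c)) \<psi>" for v
  have R: "R (val(?c := x)) = sat M (u(0 := x)) \<psi>" for x
  proof -
    have "k i \<noteq> ?c" for i using k Wt_notin_Bel by metis
    then have "val(?c := x) \<circ> k(0 := ?c) = u(0 := x)" using k by (intro ext) simp
    then show ?thesis by (simp only: R_def)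
  qed
  have "dfn L M (insert ?c (k ` fv \<psi>)) R"
    unfolding R_def by (rule dfn_sat[OF \<psi>(1)]) auto
  moreover have "R val" using R[of "val ?c"] \<psi>(3) by simp
  moreover have "decides s n R x0 Q \<sigma>" if \<sigma>: "\<sigma> ` (F - {x0}) \<subseteq> Bel s n" for \<sigma>
  proof -
    define w where "w i = (if i \<in> fv \<phi> - {0} then val (\<sigma> (g i)) else u 0)" for i
    have "w i \<in> val ` Bel s n" for i
    proof (cases "i \<in> fv \<phi> - {0}")
      case True
      then have "\<sigma> (g i) \<in> Bel s n" using \<phi>(2) \<sigma> by blast
      then show ?thesis using True by (auto simp: w_def)
    qed (use \<psi>(2) in \<open>auto simp: w_def\<close>)
    then have "range w \<subseteq> val ` Bel s n" by blast
    note dec[THEN spec, THEN mp, OF this]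
    moreover have "sat M (w(0 := x)) \<phi> = Q ((val \<circ> \<sigma>)(x0 := x))" for x
      unfolding \<phi>(3) by (rule sat_cong) (auto simp: w_def)
    ultimately show ?thesis by (simp add: decides_def R)
  qed
  moreover have "finite (k ` fv \<psi>)" "k ` fv \<psi> \<subseteq> Bel s n" using k by (auto simp: finite_fv)
  ultimately show ?thesis by blast
qed

text \<open>
  Any relation between finitely many codes also holds after moving their supports out of \<open>K\<close>,
  the codes disjoint from \<open>K\<close> being fixed.
\<close>

definition retraction :: "'i set \<Rightarrow> 'i code set \<Rightarrow> ('i code \<Rightarrow> 'i code) \<Rightarrow> bool" where
  "retraction K F \<tau> \<longleftrightarrow> (\<forall>d\<in>F. (supp d \<inter> K = {} \<longrightarrow> \<tau> d = d) \<and> supp (\<tau> d) \<subseteq> supp d - K \<and>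
     (\<forall>x. d = Lf x \<longrightarrow> (\<exists>y. \<tau> d = Lf y)))"

lemma retractionD:
  assumes "retraction K F \<tau>" "d \<in> F"
  shows "supp d \<inter> K = {} \<Longrightarrow> \<tau> d = d" "supp (\<tau> d) \<subseteq> supp d - K" "d = Lf x \<Longrightarrow> \<exists>y. \<tau> d = Lf y"
  using assms by (auto simp: retraction_def)

definition retracts :: "'i set \<Rightarrow> 'i code set \<Rightarrow> bool" where
  "retracts K F \<longleftrightarrow>
     (\<forall>Q. dfn L M F Q \<longrightarrow> Q val \<longrightarrow> (\<exists>\<tau>. retraction K F \<tau> \<and> Q (val \<circ> \<tau>)))"

lemma retractsD:
  "retracts K F \<Longrightarrow> dfn L M F Q \<Longrightarrow> Q val \<Longrightarrow> \<exists>\<tau>. retraction K F \<tau> \<and> Q (val \<circ> \<tau>)"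
  unfolding retracts_def by blast

text \<open>A failure to decide \<open>Q\<close> at \<open>\<sigma>\<close> is itself a definable
  relation between the parameters. A retraction into \<open>s\<close> fixes \<open>G\<close> and
  sends every code not above \<open>Wt s n\<close> to a predecessor of it, where \<open>R\<close>
  does decide.\<close>

lemma decides_nabove:
  fixes Q :: "('x \<Rightarrow> 'b) \<Rightarrow> bool"
  assumes G: "G \<subseteq> Bel s n" and R: "dfn L M (insert (Wt s n) G) R" and Q: "dfn L M F Q"
    and dec: "\<And>\<sigma>. \<sigma> ` (F - {x0}) \<subseteq> Bel s n \<Longrightarrow> decides s n R x0 Q \<sigma>"
    and \<sigma>: "\<And>y. y \<in> F - {x0} \<Longrightarrow> nabove s n (\<sigma> y)"
    and ret: "retracts (- s) (\<sigma> ` (F - {x0}) \<union> G)"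
  shows "decides s n R x0 Q \<sigma>"
proof (rule ccontr)
  let ?c = "Wt s n"
  assume neg: "\<not> decides s n R x0 Q \<sigma>"
  define Q1 where "Q1 v = Q (v \<circ> \<sigma>(x0 := ?c))" for v
  have \<sigma>c: "\<sigma> y \<noteq> ?c" if "y \<in> F - {x0}" for y using \<sigma>[OF that] by (auto simp: nabove_def)
  have Q1: "Q1 (v(?c := x)) = Q ((v \<circ> \<sigma>)(x0 := x))" for v x
    unfolding Q1_def by (rule dfn_cong[OF Q]) (use \<sigma>c in auto)
  let ?H = "\<sigma> ` (F - {x0}) \<union> G"
  have dQ1: "dfn L M (insert ?c (\<sigma> ` (F - {x0}))) Q1"
    unfolding Q1_def by (rule dfn_mono[OF dfn_reindex[OF Q]]) auto
  have d1: "dfn L M ?H (\<lambda>v. \<exists>x\<in>U. R (v(?c := x)) \<and> Q1 (v(?c := x)))"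
    by (rule dfn_mono[OF dfn_ex[OF dfn_conj[OF R dQ1]]]) auto
  have d2: "dfn L M ?H (\<lambda>v. \<exists>x\<in>U. R (v(?c := x)) \<and> \<not> Q1 (v(?c := x)))"
    by (rule dfn_mono[OF dfn_ex[OF dfn_conj[OF R dfn_neg[OF dQ1]]]]) auto
  have d12: "dfn L M ?H (\<lambda>v. (\<exists>x\<in>U. R (v(?c := x)) \<and> Q1 (v(?c := x))) \<and>
      (\<exists>x\<in>U. R (v(?c := x)) \<and> \<not> Q1 (v(?c := x))))"
    using dfn_conj[OF d1 d2] by simp
  have v12: "(\<exists>x\<in>U. R (val(?c := x)) \<and> Q1 (val(?c := x))) \<and>
      (\<exists>x\<in>U. R (val(?c := x)) \<and> \<not> Q1 (val(?c := x)))"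
    using neg unfolding decides_def Q1 by blast
  obtain \<tau> where \<tau>: "retraction (- s) ?H \<tau>"
    and ex: "\<exists>x\<in>U. R ((val \<circ> \<tau>)(?c := x)) \<and> Q1 ((val \<circ> \<tau>)(?c := x))"
      "\<exists>x\<in>U. R ((val \<circ> \<tau>)(?c := x)) \<and> \<not> Q1 ((val \<circ> \<tau>)(?c := x))"
    using retractsD[OF ret d12 v12] by (elim exE conjE)
  have \<tau>G: "\<tau> d = d" if "d \<in> G" for d
    using retractionD(1)[OF \<tau>, of d] that supp_Bel[of d s n] G by auto
  have Rv: "R ((val \<circ> \<tau>)(?c := x)) = R (val(?c := x))" for x
    by (rule dfn_cong[OF R]) (use \<tau>G in auto)
  \<comment> \<open>That leaves go to leaves matters for \<open>s = {}\<close>: a witness with empty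
    support could be \<open>Wt s m\<close> with \<open>m \<ge> n\<close>. A witness for
    \<open>t\<close> not inside \<open>s\<close> lands in \<open>t \<inter> s\<close>, a proper
    subset of \<open>s\<close> as \<open>s \<subset> t\<close> is excluded.\<close>
  have "\<tau> d \<in> Bel s n" if d: "d \<in> ?H" "nabove s n d" for d
  proof (cases d)
    case (Lf x)
    then obtain y where "\<tau> d = Lf y" using retractionD(3)[OF \<tau> d(1)] by blast
    then show ?thesis using retractionD(2)[OF \<tau> d(1)] by (auto simp: Bel_def)
  next
    case (Wt t m)
    show ?thesis
    proof (cases "t \<subseteq> s")
      case True
      then have "\<tau> d = d" using retractionD(1)[OF \<tau> d(1)] Wt by auto
      then show ?thesis using True d(2) Wt by (auto simp: Bel_def nabove_def)
    next
      case False
      then have "supp (\<tau> d) \<subset> s" using retractionD(2)[OF \<tau> d(1)] d(2) Wt by (auto simp: nabove_def)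
      then show ?thesis by (cases "\<tau> d") (auto simp: Bel_def)
    qed
  qed
  then have "(\<tau> \<circ> \<sigma>) ` (F - {x0}) \<subseteq> Bel s n" using \<sigma> by fastforce
  from dec[OF this] show False
    using ex unfolding Q1 Rv decides_def by (auto simp: comp_assoc)
qed

lemma retracts_leaves:
  assumes "finite Z" "Z \<subseteq> K" "finite F" "F \<subseteq> range Lf" "dfn L M F Q" "Q val"
    "\<And>i. i \<in> K \<Longrightarrow> Lf (Inr i) \<in> F \<Longrightarrow> i \<in> Z"
  shows "\<exists>\<tau>. retraction K F \<tau> \<and> Q (val \<circ> \<tau>)"
  using assms
proof (induction Z arbitrary: F Q rule: finite_induct)
  case empty
  have "supp d \<inter> K = {}" if "d \<in> F" for d
    using that empty by (cases d) (auto split: sum.splits)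
  then have "retraction K F id" unfolding retraction_def by auto
  then show ?case using empty.prems(5) by (metis comp_id)
next
  case (insert i Z)
  have "finite ((\<lambda>j::nat. Lf (Inl j)) -` F)"
    by (rule finite_vimageI[OF insert.prems(2)]) (auto simp: inj_on_def)
  then obtain j where j: "Lf (Inl j) \<notin> F" using ex_new_if_finite[OF infinite_UNIV_nat] by blast
  let ?d0 = "Lf (Inr i) :: 'i code" and ?d1 = "Lf (Inl j) :: 'i code"
  define Q1 where "Q1 v = Q (v(?d0 := v ?d1))" for v
  let ?F1 = "insert ?d1 (F - {?d0})"
  have dQ1: "dfn L M ?F1 Q1" unfolding Q1_def by (rule dfn_subst[OF insert.prems(4)])
  define h where "h d = (case d of Lf x \<Rightarrow> x | Wt _ _ \<Rightarrow> Inl 0)" for d :: "'i code"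
  have ah: "a (h d) = val d" if "d \<in> F" for d
    using that insert.prems(3) val_Lf by (auto simp: h_def)
  have "Q ((a \<circ> h)(?d0 := a (Inr i))) = Q ((a \<circ> h)(?d0 := a (Inl j)))"
    by (rule indiscernible_dfn[OF insert.prems(4)])
      (use insert.prems(3) j in \<open>auto simp: h_def\<close>)
  moreover have "Q ((a \<circ> h)(?d0 := a (Inr i))) = Q val"
    by (rule dfn_cong[OF insert.prems(4)]) (use ah val_Lf in auto)
  moreover have "Q ((a \<circ> h)(?d0 := a (Inl j))) = Q1 val"
    unfolding Q1_def by (rule dfn_cong[OF insert.prems(4)]) (use ah val_Lf in auto)
  ultimately have "Q1 val" using insert.prems(5) by blast
  then have "\<exists>\<tau>. retraction K ?F1 \<tau> \<and> Q1 (val \<circ> \<tau>)"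
    using insert.prems dQ1 by (intro insert.IH) auto
  then obtain \<tau> where \<tau>: "retraction K ?F1 \<tau>" "Q1 (val \<circ> \<tau>)" by (elim exE conjE)
  have "\<tau> ?d1 = ?d1" using retractionD(1)[OF \<tau>(1), of ?d1] by simp
  then have eq: "val \<circ> \<tau>(?d0 := ?d1) = (val \<circ> \<tau>)(?d0 := (val \<circ> \<tau>) ?d1)" by auto
  have "Q (val \<circ> \<tau>(?d0 := ?d1))" unfolding eq using \<tau>(2) unfolding Q1_def .
  moreover have "retraction K F (\<tau>(?d0 := ?d1))"
    using \<tau>(1) insert.prems(1) unfolding retraction_def by auto
  ultimately show ?case by blast
qed

lemma model_dfn:
  fixes R :: "('x \<Rightarrow> 'b) \<Rightarrow> bool"
  assumes "finite t" "dfn L M F R" "v ` (F - {y}) \<subseteq> val ` {d. supp d \<subseteq> t}" "x \<in> U" "R (v(y := x))"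
  shows "\<exists>d. supp d \<subseteq> t \<and> R (v(y := val d))"
proof -
  obtain \<phi> g where \<phi>: "wf_fm L \<phi>" "g ` (fv \<phi> - {0}) \<subseteq> F - {y}"
    "\<And>v a. R (v(y := a)) \<longleftrightarrow> sat M ((v \<circ> g)(0 := a)) \<phi>"
    using dfn_coord[OF assms(2), of y] by blast
  define w where "w i = (if i \<in> fv \<phi> - {0} then v (g i) else val (Lf (Inl 0)))" for i
  have wv: "sat M (w(0 := z)) \<phi> = R (v(y := z))" for z
    unfolding \<phi>(3) by (rule sat_cong) (auto simp: w_def)
  have "w i \<in> val ` {d. supp d \<subseteq> t}" for i
  proof (cases "i \<in> fv \<phi> - {0}")
    case True
    then have "v (g i) \<in> v ` (F - {y})" using \<phi>(2) by blast
    then show ?thesis using True assms(3) by (auto simp: w_def)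
  qed (auto simp: w_def)
  then have "range w \<subseteq> val ` {d. supp d \<subseteq> t}" by blast
  then show ?thesis
    using val_elementary[OF assms(1) \<phi>(1) _ assms(4), of w] assms(5) unfolding wv by blast
qed

text \<open>The latest witness gives way to the parameters \<open>G\<close> of its isolating
  predicate \<open>R\<close>. The induction hypothesis is used twice: with \<open>- s\<close>, to
  see that \<open>R\<close> implies \<open>Q\<close>, and with \<open>K\<close>, to move the
  remaining codes. The moved \<open>R\<close> is then solved in the model for \<open>s - K\<close>,
  or by the witness itself if \<open>s\<close> misses \<open>K\<close>.\<close>

lemma retracts_finite:
  assumes "finite F" "\<And>d. d \<in> F \<Longrightarrow> finite (supp d)"
  shows "retracts K F"
proof -
  have "wf (inv_image (mult1 below) (\<lambda>F. mset_set (wits {} (F :: 'i code set))))"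
    by (intro wf_inv_image wf_mult1 wf_below)
  then show ?thesis
    using assms
  proof (induction F arbitrary: K rule: wf_induct_rule)
    case (less F)
    show ?case
    proof (cases "wits {} F = {}")
      case True
      then have leaves: "F \<subseteq> range Lf"
      proof -
        have "d \<in> range Lf" if "d \<in> F" for d using True that by (cases d) (auto simp: wits_def)
        then show ?thesis by blast
      qed
      have "finite {i \<in> K. Lf (Inr i) \<in> F}"
      proof (rule finite_subset)
        show "finite ((\<lambda>i. Lf (Inr i)) -` F)"
          by (rule finite_vimageI[OF less.prems(1)]) (auto simp: inj_on_def)
      qed auto
      then show ?thesis
        unfolding retracts_def using retracts_leaves[of "{i \<in> K. Lf (Inr i) \<in> F}" K F] less.prems leaves
        by blast
    next
      case False
      obtain s n where c: "Wt s n \<in> F" and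
        max: "\<And>t m. Wt t m \<in> F - {Wt s n} \<Longrightarrow> nabove s n (Wt t m)"
        using wits_maximal[OF less.prems(1) False less.prems(2)] by auto
      have max': "nabove s n d" if "d \<in> F - {Wt s n}" for d
        using max that by (cases d) (auto simp: nabove_def)
      let ?c = "Wt s n"
      have fs: "finite s" using less.prems(2)[OF c] by simp
      show ?thesis
        unfolding retracts_def
      proof (intro allI impI)
        fix Q :: "('i code \<Rightarrow> 'b) \<Rightarrow> bool" assume Q: "dfn L M F Q" "Q val"
        obtain R G where G: "finite G" "G \<subseteq> Bel s n" and R: "dfn L M (insert ?c G) R" "R val"
          and dec: "\<And>\<sigma>. \<sigma> ` (F - {?c}) \<subseteq> Bel s n \<Longrightarrow> decides s n R ?c Q \<sigma>"
          using isolating_predicate[OF fs Q(1), of n ?c] by blast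
        let ?H = "(F - {?c}) \<union> G"
        have H: "(?H, F) \<in> inv_image (mult1 below) (\<lambda>F. mset_set (wits {} F))"
          using wits_mult1[OF less.prems(1) G c _ fs, of "{}"] by simp
        have ret: "retracts K' ?H" for K'
        proof (rule less.IH[OF H])
          show "finite ?H" using G less.prems by simp
          show "finite (supp d)" if "d \<in> ?H" for d
          proof (cases "d \<in> G")
            case True
            then have "supp d \<subseteq> s" using supp_Bel G(2) by blast
            then show ?thesis using fs finite_subset by blast
          qed (use that less.prems(2) in blast)
        qed
        have "decides s n R ?c Q id"
          by (rule decides_nabove[OF G(2) R(1) Q(1) dec]) (use max' ret in auto)
        then have RQ: "\<forall>x\<in>U. R (val(?c := x)) \<longrightarrow> Q (val(?c := x))"
        proof -
          have "R (val(?c := val ?c))" "Q (val(?c := val ?c))" using R(2) Q(2) by simp_all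
          then show ?thesis
            using \<open>decides s n R ?c Q id\<close> val_in[of ?c] unfolding decides_def comp_id by blast
        qed
        have cH: "?c \<notin> ?H" using G(2) Wt_notin_Bel by blast
        have dRQ: "dfn L M ?H (\<lambda>v. \<forall>x\<in>U. R (v(?c := x)) \<longrightarrow> Q (v(?c := x)))"
          by (rule dfn_mono[OF dfn_all[OF dfn_imp[OF R(1) Q(1)]]]) auto
        have dR: "dfn L M ?H (\<lambda>v. \<exists>x\<in>U. R (v(?c := x)))"
          by (rule dfn_mono[OF dfn_ex[OF R(1)]]) auto
        have d12: "dfn L M ?H (\<lambda>v. (\<exists>x\<in>U. R (v(?c := x))) \<and> (\<forall>x\<in>U. R (v(?c := x)) \<longrightarrow> Q (v(?c := x))))"
          using dfn_conj[OF dR dRQ] by simp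
        have "R (val(?c := val ?c))" using R(2) by simp
        then have v12: "(\<exists>x\<in>U. R (val(?c := x))) \<and> (\<forall>x\<in>U. R (val(?c := x)) \<longrightarrow> Q (val(?c := x)))"
          using RQ val_in[of ?c] by blast
        obtain \<tau> where \<tau>: "retraction K ?H \<tau>"
          and \<tau>R: "\<exists>x\<in>U. R ((val \<circ> \<tau>)(?c := x))"
          and \<tau>Q: "\<forall>x\<in>U. R ((val \<circ> \<tau>)(?c := x)) \<longrightarrow> Q ((val \<circ> \<tau>)(?c := x))"
          using retractsD[OF ret[of K] d12 v12] by (elim exE conjE)
        have "\<exists>e. (s \<inter> K = {} \<longrightarrow> e = ?c) \<and> supp e \<subseteq> s - K \<and> R ((val \<circ> \<tau>)(?c := val e))"
        proof (cases "s \<inter> K = {}")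
          case True
          have "R ((val \<circ> \<tau>)(?c := val ?c)) = R val"
          proof (rule dfn_cong[OF R(1)])
            fix d assume "d \<in> insert ?c G"
            moreover have "supp d \<inter> K = {}" if "d \<in> G" using that supp_Bel[of d s n] G True by blast
            ultimately show "((val \<circ> \<tau>)(?c := val ?c)) d = val d"
              using retractionD(1)[OF \<tau>, of d] by auto
          qed
          then show ?thesis using R(2) True by (intro exI[of _ ?c]) auto
        next
          case False
          obtain x where x: "x \<in> U" "R ((val \<circ> \<tau>)(?c := x))" using \<tau>R by (elim bexE)
          have G': "(val \<circ> \<tau>) ` (insert ?c G - {?c}) \<subseteq> val ` {d. supp d \<subseteq> s - K}"
          proof (rule image_subsetI)
            fix d assume "d \<in> insert ?c G - {?c}"
            then have "d \<in> G" by blast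
            then have "supp (\<tau> d) \<subseteq> s - K" using retractionD(2)[OF \<tau>, of d] supp_Bel[of d s n] G by blast
            then show "(val \<circ> \<tau>) d \<in> val ` {d. supp d \<subseteq> s - K}" by auto
          qed
          have "\<exists>e. supp e \<subseteq> s - K \<and> R ((val \<circ> \<tau>)(?c := val e))"
            by (rule model_dfn[OF _ R(1) G' x]) (use fs in simp)
          then show ?thesis using False by blast
        qed
        then obtain e where e: "s \<inter> K = {} \<longrightarrow> e = ?c" "supp e \<subseteq> s - K" "R ((val \<circ> \<tau>)(?c := val e))"
          by blast
        have "val \<circ> \<tau>(?c := e) = (val \<circ> \<tau>)(?c := val e)" by auto
        then have "Q (val \<circ> \<tau>(?c := e))" using \<tau>Q e(3) val_in[of e] by simp
        moreover have "retraction K F (\<tau>(?c := e))"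
          using \<tau> e(1,2) unfolding retraction_def by auto
        ultimately show "\<exists>\<tau>. retraction K F \<tau> \<and> Q (val \<circ> \<tau>)" by blast
      qed
    qed
  qed
qed

section \<open>The closure of a model inside the system\<close>

abbreviation N where "N s \<equiv> val ` {d. supp d \<subseteq> s}"

text \<open>Induction along the construction: the earlier witnesses lie in the closure of the terms
  other than \<open>a (Inr i)\<close>. If the new one were generic over these terms, it would stay
  generic over all its predecessors, which isolation forbids.\<close>

lemma val_closure: "finite (supp d) \<Longrightarrow> i \<notin> supp d \<Longrightarrow> d \<notin> range Lf \<Longrightarrow> \<not> gen (val d) (a ` (UNIV - {Inr i}))"
proof -
  let ?A = "a ` (UNIV - {Inr i})"
  have A: "range (a \<circ> Inl) \<subseteq> ?A" by auto
  have AU: "?A \<subseteq> U" using a_in by auto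
  have "finite s \<Longrightarrow> i \<notin> s \<Longrightarrow> \<not> gen (val (Wt s n)) ?A" for s n
    using wf_below
  proof (induction "(s, n)" arbitrary: s n rule: wf_induct_rule)
    case less
    show ?case
    proof
      assume g: "gen (val (Wt s n)) ?A"
      let ?X = "{val (Wt t m) | t m. Wt t m \<in> Bel s n}"
      have "b \<in> U \<and> \<not> gen b ?A" if b: "b \<in> ?X" for b
      proof -
        obtain t m where tm: "b = val (Wt t m)" "Wt t m \<in> Bel s n" using b by blast
        then have "((t, m), (s, n)) \<in> below" using less by (auto simp: Bel_def below_iff)
        moreover have "t \<subseteq> s" using supp_Bel[OF tm(2)] by simp
        ultimately show ?thesis using less tm finite_subset[of t s] val_in by auto
      qed
      then have "gen (val (Wt s n)) (?A \<union> ?X)"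
        by (intro gen_absorb[OF g A AU val_in])
      moreover have "val ` Bel s n \<subseteq> ?A \<union> ?X"
      proof (rule image_subsetI)
        fix d assume d: "d \<in> Bel s n"
        show "val d \<in> ?A \<union> ?X"
        proof (cases d)
          case (Lf x)
          then have "x \<noteq> Inr i" using supp_Bel[OF d] less by auto
          then show ?thesis using Lf val_Lf by auto
        qed (use d in auto)
      qed
      ultimately have "gen (val (Wt s n)) (val ` Bel s n)" by (rule generic_mono)
      moreover have "\<not> gen (val (Wt s n)) (val ` Bel s n)"
      proof (rule isolated_not_generic[OF val_isolated])
        show "range (a \<circ> Inl) \<subseteq> val ` Bel s n"
        proof (rule image_subsetI)
          fix j
          have "Lf (Inl j) \<in> Bel s n" by (auto simp: Bel_def)
          then show "(a \<circ> Inl) j \<in> val ` Bel s n" using val_Lf by (metis comp_apply image_eqI)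
        qed
      qed (use less val_in in auto)
      ultimately show False by blast
    qed
  qed
  then show "finite (supp d) \<Longrightarrow> i \<notin> supp d \<Longrightarrow> d \<notin> range Lf \<Longrightarrow> \<not> gen (val d) ?A"
    by (cases d) auto
qed

lemma leaf_generic: "gen (a (Inr i)) (val ` {d. finite (supp d) \<and> i \<notin> supp d})"
proof -
  let ?A = "a ` (UNIV - {Inr i})"
  let ?X = "val ` {d. finite (supp d) \<and> i \<notin> supp d \<and> d \<notin> range Lf}"
  have "gen (a (Inr i)) (?A \<union> ?X)"
    by (rule gen_absorb[OF a_generic _ _ a_in]) (use a_in val_in val_closure in auto)
  moreover have "val ` {d. finite (supp d) \<and> i \<notin> supp d} \<subseteq> ?A \<union> ?X"
  proof (rule image_subsetI)
    fix d assume d: "d \<in> {d. finite (supp d) \<and> i \<notin> supp d}"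
    show "val d \<in> ?A \<union> ?X"
    proof (cases d)
      case (Lf x)
      then have "x \<noteq> Inr i" using d by auto
      then show ?thesis using Lf val_Lf by auto
    qed (use d in auto)
  qed
  ultimately show ?thesis by (rule generic_mono)
qed

text \<open>The coordinate \<open>None\<close> stands for \<open>q\<close>. By strong regularity a
  leaf outside \<open>J\<close> is generic over \<open>q\<close> and the other parameters, so almost
  every base term can replace it. Base terms lie in \<open>N J\<close>; after \<open>q\<close> is
  reflected, enough of them still satisfy \<open>Q\<close>, and genericity of the leaf over the
  reflected element restores \<open>Q\<close>.\<close>

lemma closure_leaves:
  assumes J: "finite J" and q: "q \<in> U" "\<not> gen q (N J)"
    and "finite Z" "finite F" "\<And>d. d \<in> F \<Longrightarrow> finite (supp d)" "\<And>d. d \<in> F \<Longrightarrow> d \<in> range Lf \<or> supp d \<subseteq> J"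
    "\<And>i. Lf (Inr i) \<in> F \<Longrightarrow> i \<in> J \<union> Z" "Z \<inter> J = {}"
    "dfn L M (insert None (Some ` F)) Q" "Q (case_option q val)"
  shows "\<exists>d. supp d \<subseteq> J \<and> Q (case_option (val d) val)"
  using assms(4-)
proof (induction Z arbitrary: F Q rule: finite_induct)
  case empty
  have FJ: "supp d \<subseteq> J" if "d \<in> F" for d
    using empty.prems(3,4) that by (cases d) (force split: sum.splits)+
  have upd: "(case_option q val)(None := z) = case_option z val" for z
    by (auto split: option.split)
  have "\<exists>d. supp d \<subseteq> J \<and> Q ((case_option q val)(None := val d))"
  proof (rule model_dfn[OF J empty.prems(6) _ q(1)])
    show "Q ((case_option q val)(None := q))" unfolding upd by (rule empty.prems(7))
  qed (use FJ in auto)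
  then show ?case unfolding upd .
next
  case (insert i Z)
  let ?d0 = "Lf (Inr i) :: 'i code"
  let ?y = "Some ?d0"
  let ?B = "val ` {d. finite (supp d) \<and> i \<notin> supp d}"
  have iJ: "i \<notin> J" using insert.prems by blast
  have NB: "N J \<subseteq> ?B" using iJ J finite_subset by blast
  have gB: "gen (a (Inr i)) (insert q ?B)"
  proof (rule regular[OF _ _ q(1) a_in leaf_generic])
    show "range (a \<circ> Inl) \<subseteq> ?B"
    proof (rule image_subsetI)
      fix j
      have "(a \<circ> Inl) j = val (Lf (Inl j))" using val_Lf by simp
      then show "(a \<circ> Inl) j \<in> ?B" by auto
    qed
    show "\<not> gen q ?B" using q(2) generic_mono[OF _ NB] by blast
  qed (use val_in in auto)
  have FB: "val ` (F - {?d0}) \<subseteq> ?B"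
  proof (rule image_subsetI)
    fix d assume d: "d \<in> F - {?d0}"
    then have "i \<notin> supp d" using insert.prems(3)[of d] iJ by (auto split: sum.splits)
    then show "val d \<in> ?B" using d insert.prems(2) by auto
  qed
  obtain n where n: "\<And>v. range v \<subseteq> U \<Longrightarrow>
      (finite {x. \<not> Q (v(?y := a x))} \<and> card {x. \<not> Q (v(?y := a x))} \<le> n) \<or>
      (finite {x. Q (v(?y := a x))} \<and> card {x. Q (v(?y := a x))} \<le> n)"
    using definition_dfn[OF insert.prems(6), of ?y] by blast
  let ?v = "case_option q val"
  have vU: "range (case_option z val) \<subseteq> U" if "z \<in> U" for z
    using that val_in by (auto split: option.split)
  have vB: "case_option z val ` (insert None (Some ` F) - {?y}) \<subseteq> insert z ?B" for z
    using FB by auto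
  have upd: "(case_option z val)(?y := a (Inr i)) = case_option z val" for z
    using val_Lf[of "Inr i"] by (auto split: option.split)
  have "\<not> finite {x. Q (?v(?y := a x))}"
  proof
    assume fin: "finite {x. Q (?v(?y := a x))}"
    have "\<not> Q (?v(?y := a (Inr i)))"
      by (rule gen_dfn[OF gB dfn_neg[OF insert.prems(6)] vU[OF q(1)] vB]) (simp only: not_not fin)
    then show False using insert.prems(7) unfolding upd by blast
  qed
  then have "finite {x. \<not> Q (?v(?y := a x))}" using n[OF vU[OF q(1)]] by blast
  then have "finite (Inl -` {x. \<not> Q (?v(?y := a x))} :: nat set)" by (rule finite_vimageI) simp
  then have inf: "infinite (- (Inl -` {x. \<not> Q (?v(?y := a x))}) :: nat set)"
    by (simp only: finite_compl infinite_UNIV_nat not_False_eq_True)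
  define X where "X = (- (Inl -` {x. \<not> Q (?v(?y := a x))}) :: nat set)"
  \<comment> \<open>\<open>Suc n\<close> terms exceed the bound \<open>n\<close>, so whenever all of
    them satisfy \<open>Q\<close>, all but finitely many terms do.\<close>
  obtain S where S: "S \<subseteq> X" "finite S" "card S = Suc n"
    using infinite_arbitrarily_large[OF inf, of "Suc n"] unfolding X_def[symmetric] by blast
  define Q1 where "Q1 v \<longleftrightarrow> (\<forall>j\<in>S. Q (v(?y := v (Some (Lf (Inl j))))))" for v
  let ?F1 = "(F - {?d0}) \<union> (\<lambda>j. Lf (Inl j)) ` S"
  have "dfn L M (\<Union>j\<in>S. insert (Some (Lf (Inl j))) (insert None (Some ` F) - {?y})) Q1"
    unfolding Q1_def
    by (rule dfn_ball[OF S(2) dfn_subst[OF insert.prems(6)]]) (use S(3) in auto)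
  then have dQ1: "dfn L M (insert None (Some ` ?F1)) Q1" by (rule dfn_mono) auto
  have "Q1 ?v" using S(1) val_Lf by (auto simp: Q1_def X_def)
  have "\<exists>d. supp d \<subseteq> J \<and> Q1 (case_option (val d) val)"
  proof (rule insert.IH[OF _ _ _ _ _ dQ1 \<open>Q1 ?v\<close>])
    show "finite ?F1" using insert.prems(1) S(2) by simp
    show "finite (supp d)" if "d \<in> ?F1" for d using that insert.prems(2) by auto
    show "d \<in> range Lf \<or> supp d \<subseteq> J" if "d \<in> ?F1" for d using that insert.prems(3) by blast
    show "l \<in> J \<union> Z" if "Lf (Inr l) \<in> ?F1" for l using that insert.prems(4)[of l] by auto
    show "Z \<inter> J = {}" using insert.prems(5) by blast
  qed
  then obtain d where d: "supp d \<subseteq> J" "Q1 (case_option (val d) val)" by blast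
  let ?w = "case_option (val d) val"
  have "Inl ` S \<subseteq> {x. Q (?w(?y := a x))}" using d(2) val_Lf by (auto simp: Q1_def)
  moreover have "card (Inl ` S :: (nat + 'i) set) = Suc n" using S(3) by (simp add: card_image)
  ultimately have "Suc n \<le> card {x. Q (?w(?y := a x))}" if "finite {x. Q (?w(?y := a x))}"
    using card_mono[OF that] by metis
  then have "\<not> (finite {x. Q (?w(?y := a x))} \<and> card {x. Q (?w(?y := a x))} \<le> n)"
    using Suc_n_not_le_n order_trans by blast
  then have fin: "finite {x. \<not> Q (?w(?y := a x))}" using n[OF vU[OF val_in]] by blast
  have dB: "val d \<in> ?B" using d(1) NB by blast
  have gB': "gen (a (Inr i)) ?B" by (rule leaf_generic)
  have vB': "?w ` (insert None (Some ` F) - {?y}) \<subseteq> ?B"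
    using vB[of "val d"] unfolding insert_absorb[OF dB] .
  have "Q (?w(?y := a (Inr i)))"
    by (rule gen_dfn[OF gB' insert.prems(6) vU[OF val_in] vB' fin])
  then show ?case using d(1) unfolding upd by blast
qed

text \<open>Nothing outside \<open>N J\<close> is in the closure of \<open>N J\<close>.\<close>

lemma closure_reflects:
  assumes J: "finite J" and q: "q \<in> U" "\<not> gen q (N J)"
    and "finite F" "\<And>d. d \<in> F \<Longrightarrow> finite (supp d)"
    "dfn L M (insert None (Some ` F)) Q" "Q (case_option q val)"
  shows "\<exists>d. supp d \<subseteq> J \<and> Q (case_option (val d) val)"
proof -
  have "wf (inv_image (mult1 below) (\<lambda>F. mset_set (wits (Pow J) F)))"
    by (intro wf_inv_image wf_mult1 wf_below)
  then show ?thesis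
    using assms(4-)
  proof (induction F arbitrary: Q rule: wf_induct_rule)
    case (less F)
    show ?case
    proof (cases "wits (Pow J) F = {}")
      case True
      let ?Z = "{i. Lf (Inr i) \<in> F \<and> i \<notin> J}"
      have "finite ?Z"
      proof (rule finite_subset)
        show "finite ((\<lambda>i. Lf (Inr i)) -` F)"
          by (rule finite_vimageI[OF less.prems(1)]) (auto simp: inj_on_def)
      qed auto
      moreover have "d \<in> range Lf \<or> supp d \<subseteq> J" if "d \<in> F" for d
        using True that by (cases d) (auto simp: wits_def)
      ultimately show ?thesis
        using less.prems by (intro closure_leaves[OF J q, of ?Z F]) auto
    next
      case False
      obtain s n where c: "Wt s n \<in> F" "\<not> s \<subseteq> J" and
        max: "\<And>t m. Wt t m \<in> F - {Wt s n} \<Longrightarrow> \<not> t \<subseteq> J \<Longrightarrow> nabove s n (Wt t m)"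
        using wits_maximal[OF less.prems(1) False less.prems(2)] by auto
      have nJ: "nabove s n d" if "supp d \<subseteq> J" for d
        using that c(2) by (cases d) (auto simp: nabove_def)
      have max': "nabove s n d" if "d \<in> F - {Wt s n}" for d
      proof (cases "supp d \<subseteq> J")
        case False
        then show ?thesis using that max by (cases d) (simp add: nabove_def, simp)
      qed (rule nJ)
      let ?c = "Wt s n"
      have fs: "finite s" using less.prems(2)[OF c(1)] by simp
      obtain R G where G: "finite G" "G \<subseteq> Bel s n" and R: "dfn L M (insert ?c G) R" "R val"
        and dec: "\<And>\<sigma>. \<sigma> ` (insert None (Some ` F) - {Some ?c}) \<subseteq> Bel s n \<Longrightarrow> decides s n R (Some ?c) Q \<sigma>"
        using isolating_predicate[OF fs less.prems(3), of n "Some ?c"] by blast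
      let ?H = "(F - {?c}) \<union> G"
      have H: "(?H, F) \<in> inv_image (mult1 below) (\<lambda>F. mset_set (wits (Pow J) F))"
        using wits_mult1[OF less.prems(1) G c(1) _ fs, of "Pow J"] c(2) by simp
      have Hfin: "finite ?H" "\<And>d. d \<in> ?H \<Longrightarrow> finite (supp d)"
      proof -
        show "finite ?H" using G less.prems(1) by simp
        show "finite (supp d)" if "d \<in> ?H" for d
        proof (cases "d \<in> G")
          case True
          then have "supp d \<subseteq> s" using supp_Bel G(2) by blast
          then show ?thesis using fs finite_subset by blast
        qed (use that less.prems(2) in blast)
      qed
      \<comment> \<open>The witness is quantified away under \<open>R\<close>. Once \<open>q\<close>
        is reflected to \<open>val d\<close>, \<open>R\<close> still decides \<open>Q\<close>,
        because a code supported in \<open>J\<close> is not above \<open>Wt s n\<close>; hence the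
        original witness satisfies \<open>Q\<close> again.\<close>
      define Q1 where "Q1 v \<longleftrightarrow> (\<exists>x\<in>U. R ((v(Some ?c := x)) \<circ> Some) \<and> Q (v(Some ?c := x)))" for v
      have "dfn L M ((Some ` insert ?c G \<union> insert None (Some ` F)) - {Some ?c}) Q1"
        unfolding Q1_def by (rule dfn_ex[OF dfn_conj[OF dfn_reindex[OF R(1)] less.prems(3)]])
      then have dQ1: "dfn L M (insert None (Some ` ?H)) Q1" by (rule dfn_mono) auto
      have comp: "((case_option z val)(Some ?c := x)) \<circ> Some = val(?c := x)" for z x by auto
      have triv: "(case_option z val)(Some ?c := val ?c) = case_option z val" for z by auto
      have "Q1 (case_option q val)"
        unfolding Q1_def comp using R(2) less.prems(4) triv[of q]
        by (intro bexI[of _ "val ?c"] val_in) auto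
      then obtain d where d: "supp d \<subseteq> J" "Q1 (case_option (val d) val)"
        using less.IH[OF H Hfin dQ1] by blast
      let ?\<sigma> = "case_option d id"
      have v\<sigma>: "val \<circ> ?\<sigma> = case_option (val d) val" by (auto split: option.split)
      have im: "?\<sigma> ` (insert None (Some ` F) - {Some ?c}) \<union> G = insert d ?H"
      proof -
        have "insert None (Some ` F) - {Some ?c} = insert None (Some ` (F - {?c}))" by auto
        then show ?thesis by (simp add: image_image)
      qed
      have "decides s n R (Some ?c) Q ?\<sigma>"
      proof (rule decides_nabove[OF G(2) R(1) less.prems(3) dec])
        show "nabove s n (?\<sigma> y)" if "y \<in> insert None (Some ` F) - {Some ?c}" for y
        proof (cases y)
          case (Some e)
          then have "e \<in> F - {?c}" using that by auto
          then show ?thesis using max' Some by simp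
        qed (use nJ[OF d(1)] in simp)
        show "retracts (- s) (?\<sigma> ` (insert None (Some ` F) - {Some ?c}) \<union> G)"
          unfolding im using Hfin d(1) J finite_subset by (intro retracts_finite) blast+
      qed
      then have "\<forall>x\<in>U. R (val(?c := x)) \<longrightarrow> Q ((case_option (val d) val)(Some ?c := x))"
        using d(2) unfolding decides_def v\<sigma> Q1_def comp by blast
      then have "Q ((case_option (val d) val)(Some ?c := val ?c))" using R(2) val_in by simp
      then show ?thesis using d(1) unfolding triv by blast
    qed
  qed
qed

section \<open>The union of the system\<close>

definition carrier where "carrier = val ` {d. finite (supp d)}"

lemma N_subset_carrier: "finite J \<Longrightarrow> N J \<subseteq> carrier"
  unfolding carrier_def using finite_subset by blast

lemma finite_support:
  assumes "range w \<subseteq> carrier" "finite I"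
  shows "\<exists>J. finite J \<and> w ` I \<subseteq> N J"
proof -
  have "\<exists>d. finite (supp d) \<and> w i = val d" for i using assms(1) by (auto simp: carrier_def)
  then obtain k where k: "\<And>i. finite (supp (k i)) \<and> w i = val (k i)" by metis
  have "w ` I \<subseteq> N (\<Union>i\<in>I. supp (k i))" using k by fastforce
  moreover have "finite (\<Union>i\<in>I. supp (k i))" using k assms(2) by blast
  ultimately show ?thesis by blast
qed

lemma carrier_elementary:
  assumes "wf_fm L \<phi>" "range w \<subseteq> carrier" "x \<in> U" "sat M (w(0 := x)) \<phi>"
  shows "\<exists>y\<in>carrier. sat M (w(0 := y)) \<phi>"
proof -
  obtain J where J: "finite J" "w ` (fv \<phi> - {0}) \<subseteq> N J"
    using finite_support[OF assms(2), of "fv \<phi> - {0}"] by (auto simp: finite_fv)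
  have d: "dfn L M (fv \<phi>) (\<lambda>v. sat M (v \<circ> id) \<phi>)" by (rule dfn_sat[OF assms(1)]) simp
  have "\<exists>d. supp d \<subseteq> J \<and> sat M (w(0 := val d) \<circ> id) \<phi>"
    by (rule model_dfn[OF J(1) d J(2) assms(3)]) (simp add: assms(4))
  then show ?thesis using N_subset_carrier[OF J(1)] by auto
qed

lemma carrier_quasiminimal:
  assumes \<phi>: "wf_fm L \<phi>" and w: "range w \<subseteq> carrier"
  shows "countable {y \<in> carrier. sat M (w(0 := y)) \<phi>} \<or> countable {y \<in> carrier. \<not> sat M (w(0 := y)) \<phi>}"
proof -
  obtain J where J: "finite J" "w ` (fv \<phi> - {0}) \<subseteq> N J"
    using finite_support[OF w, of "fv \<phi> - {0}"] by (auto simp: finite_fv)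
  have wU: "range w \<subseteq> U" using w val_in by (auto simp: carrier_def)
  have cN: "countable (N J)" using countable_supp[OF J(1)] by simp
  have *: "countable {y \<in> carrier. \<not> sat M (w(0 := y)) \<psi>}"
    if \<psi>: "wf_fm L \<psi>" "fv \<psi> = fv \<phi>" and fin: "finite {x. \<not> sat M (w(0 := a x)) \<psi>}" for \<psi>
  proof -
    have "y \<in> N J" if y: "y \<in> carrier" "\<not> sat M (w(0 := y)) \<psi>" for y
    proof -
      obtain c where c: "finite (supp c)" "y = val c" using y(1) by (auto simp: carrier_def)
      have "\<not> gen y (N J)" using J(2) \<psi> fin wU y(2) unfolding generic_def by blast
      \<comment> \<open>Reflecting the relation \<open>y = val c\<close> shows that \<open>y\<close>
        has a code supported in \<open>J\<close>.\<close>
      moreover have "dfn L M (insert None (Some ` {c})) (\<lambda>v. v None = v (Some c))"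
        using dfn_eq[of L M None "Some c"] by simp
      ultimately have "\<exists>d. supp d \<subseteq> J \<and> case_option (val d) val None = case_option (val d) val (Some c)"
        using c by (intro closure_reflects[OF J(1), of y "{c}"]) (auto simp: val_in)
      then obtain d where "supp d \<subseteq> J" "val d = y" using c by auto
      then show ?thesis by blast
    qed
    then show ?thesis using cN countable_subset by (metis (no_types, lifting) mem_Collect_eq subsetI)
  qed
  have "finite {x. \<not> sat M (w(0 := a x)) \<phi>} \<or> finite {x. \<not> sat M (w(0 := a x)) (Neg \<phi>)}"
    using definition_a[OF \<phi>] wU by auto
  then show ?thesis using *[OF \<phi>] *[of "Neg \<phi>"] \<phi> by auto
qed

lemma a_carrier: "a x \<in> carrier"
  unfolding carrier_def using val_Lf[of x] by (auto intro!: image_eqI[of _ val "Lf x"] split: sum.split)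

end

section \<open>Stability yields locally isolated elements\<close>

text \<open>Countably many members of \<open>F\<close> realise all separations of finite sets that
  \<open>F\<close> can realise, and only countably many sets are Boolean combinations of finitely
  many of these. A member \<open>S\<close> beyond them has, for every finite stage, a point inside
  and a point outside that the stage cannot distinguish. This fixes half of the incidence pattern;
  Ramsey makes the other half constant.\<close>

lemma erdos_makkai:
  fixes F :: "'e::countable set set"
  assumes "uncountable F"
  shows "\<exists>(x :: nat \<Rightarrow> 'e) A. range A \<subseteq> F \<and> ((\<forall>i j. x i \<in> A j \<longleftrightarrow> i \<le> j) \<or> (\<forall>i j. x i \<in> A j \<longleftrightarrow> j < i))"
proof -
  define pick where "pick = (\<lambda>(X, Y). SOME A. A \<in> F \<and> X \<subseteq> A \<and> Y \<inter> A = {})"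
  define F' where "F' = pick ` ({X. finite X} \<times> {Y. finite Y})"
  have cF': "countable F'" unfolding F'_def by (intro countable_image countable_SIGMA countable_Collect_finite)
  have pick: "pick (X, Y) \<in> F \<and> X \<subseteq> pick (X, Y) \<and> Y \<inter> pick (X, Y) = {}"
    if "A \<in> F" "X \<subseteq> A" "Y \<inter> A = {}" for X Y A
    unfolding pick_def prod.case by (rule someI[of _ A]) (use that in blast)
  \<comment> \<open>The sets in the Boolean algebra generated by \<open>G\<close>, described as the
    unions of its atoms when \<open>G\<close> is finite.\<close>
  define D where "D G = {S :: 'e set. \<forall>x y. (\<forall>A\<in>G. x \<in> A \<longleftrightarrow> y \<in> A) \<longrightarrow> (x \<in> S \<longleftrightarrow> y \<in> S)}" for G :: "'e set set"
  have finD: "finite (D G)" if "finite G" for G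
  proof (rule finite_subset)
    let ?t = "\<lambda>x. {A \<in> G. x \<in> A}"
    show "D G \<subseteq> (\<lambda>T. ?t -` T) ` Pow (Pow G)"
    proof
      fix S assume S: "S \<in> D G"
      have "y \<in> S" if "x \<in> S" "?t y = ?t x" for x y
      proof -
        have "\<forall>A\<in>G. x \<in> A \<longleftrightarrow> y \<in> A" using that(2) by blast
        then show ?thesis using S that(1) unfolding D_def by blast
      qed
      then have "S = ?t -` (?t ` S)" by blast
      moreover have "?t ` S \<in> Pow (Pow G)" by blast
      ultimately show "S \<in> (\<lambda>T. ?t -` T) ` Pow (Pow G)" by (rule image_eqI)
    qed
    show "finite ((\<lambda>T. ?t -` T) ` Pow (Pow G))" using that by simp
  qed
  have "countable (\<Union>G\<in>{G. finite G \<and> G \<subseteq> F'}. D G)"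
    by (intro countable_UN countable_Collect_finite_subset cF') (auto intro: countable_finite finD)
  then have "\<not> F \<subseteq> (\<Union>G\<in>{G. finite G \<and> G \<subseteq> F'}. D G)"
    using assms countable_subset by metis
  then obtain S where S: "S \<in> F" "\<And>G. finite G \<Longrightarrow> G \<subseteq> F' \<Longrightarrow> S \<notin> D G"
    by blast
  define Q where "Q n f r \<longleftrightarrow> (case r of (a, b, A) \<Rightarrow> a \<in> S \<and> b \<notin> S \<and> A \<in> F' \<and> A \<in> F \<and> a \<in> A \<and> b \<notin> A \<and>
      (\<forall>m<n. case f m of (a', b', A') \<Rightarrow> a' \<in> A \<and> b' \<notin> A \<and> (a \<in> A' \<longleftrightarrow> b \<in> A')))"
    for n :: nat and f :: "nat \<Rightarrow> 'e \<times> 'e \<times> 'e set" and r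
  have "\<exists>f. \<forall>n. Q n f (f n)"
  proof (rule seq_choice)
    fix n and f :: "nat \<Rightarrow> 'e \<times> 'e \<times> 'e set"
    assume IH: "\<And>m. m < n \<Longrightarrow> Q m f (f m)"
    have IH': "fst (f m) \<in> S" "fst (snd (f m)) \<notin> S" "snd (snd (f m)) \<in> F'" if "m < n" for m
      using IH[OF that] by (auto simp: Q_def split: prod.splits)
    let ?G = "(\<lambda>m. snd (snd (f m))) ` {..<n}"
    have "?G \<subseteq> F'" using IH' by auto
    then have "S \<notin> D ?G" by (intro S(2)) auto
    then obtain x y where xy: "\<forall>A\<in>?G. x \<in> A \<longleftrightarrow> y \<in> A" "(x \<in> S) \<noteq> (y \<in> S)"
      unfolding D_def by (simp only: mem_Collect_eq not_all not_imp) (elim exE conjE)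
    obtain a b where ab: "a \<in> S" "b \<notin> S" "\<forall>A\<in>?G. a \<in> A \<longleftrightarrow> b \<in> A"
    proof (cases "x \<in> S")
      case True
      then show ?thesis using xy by (intro that[of x y]) simp_all
    next
      case False
      then show ?thesis using xy by (intro that[of y x]) simp_all
    qed
    let ?X = "insert a ((\<lambda>m. fst (f m)) ` {..<n})"
    let ?Y = "insert b ((\<lambda>m. fst (snd (f m))) ` {..<n})"
    have XY: "?X \<subseteq> S" "?Y \<inter> S = {}" using IH' ab by auto
    have P: "pick (?X, ?Y) \<in> F" "?X \<subseteq> pick (?X, ?Y)" "?Y \<inter> pick (?X, ?Y) = {}"
      using pick[OF S(1) XY] by simp_all
    have "pick (?X, ?Y) \<in> F'" unfolding F'_def by (rule imageI) simp
    moreover have "fst (f m) \<in> pick (?X, ?Y)" "fst (snd (f m)) \<notin> pick (?X, ?Y)"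
      "a \<in> snd (snd (f m)) \<longleftrightarrow> b \<in> snd (snd (f m))" if "m < n" for m
      using P(2,3) ab(3) that by blast+
    ultimately have "Q n f (a, b, pick (?X, ?Y))"
      unfolding Q_def case_prod_unfold fst_conv snd_conv using ab(1,2) P by simp
    then show "\<exists>r. Q n f r" by blast
  next
    fix n and f g :: "nat \<Rightarrow> 'e \<times> 'e \<times> 'e set" and x
    assume "\<And>m. m < n \<Longrightarrow> f m = g m"
    then show "Q n f x = Q n g x" by (auto simp: Q_def case_prod_unfold)
  qed
  then obtain f where f: "\<And>n. Q n f (f n)" by blast
  define a b A where "a n = fst (f n)" and "b n = fst (snd (f n))" and "A n = snd (snd (f n))" for n
  have AF: "A n \<in> F" for n
    using f[of n] by (simp add: Q_def A_def case_prod_unfold)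
  have le: "a i \<in> A j \<and> b i \<notin> A j" if "i \<le> j" for i j
    using f[of j] that by (cases "i = j") (auto simp: Q_def a_def b_def A_def case_prod_unfold)
  have gt: "a i \<in> A j \<longleftrightarrow> b i \<in> A j" if "j < i" for i j
    using f[of i] that by (auto simp: Q_def a_def b_def A_def case_prod_unfold)
  \<comment> \<open>For \<open>j < i\<close> it is open whether \<open>a i\<close> lies in
    \<open>A j\<close>, but \<open>b i\<close> behaves in the same way; this common answer colours
    the pair.\<close>
  define h where "h X = (if a (Max X) \<in> A (Min X) then 1 else 0 :: nat)" for X :: "nat set"
  have "\<forall>x\<in>UNIV. \<forall>y\<in>UNIV. x \<noteq> y \<longrightarrow> h {x, y} < 2" by (simp add: h_def)
  from Ramsey2[OF infinite_UNIV_nat this]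
  obtain Y t where Y: "infinite Y" "\<forall>x\<in>Y. \<forall>y\<in>Y. x \<noteq> y \<longrightarrow> h {x, y} = t" by blast
  define e where "e = enumerate Y"
  have em: "strict_mono e" unfolding e_def by (rule strict_mono_enumerate[OF Y(1)])
  have eY: "e i \<in> Y" for i unfolding e_def by (rule enumerate_in_set[OF Y(1)])
  have gt': "a (e i) \<in> A (e j) \<longleftrightarrow> t = 1" if "j < i" for i j
  proof -
    have "e j < e i" using em that by (simp add: strict_mono_def)
    then have "h {e i, e j} = (if a (e i) \<in> A (e j) then 1 else 0)"
      by (simp add: h_def max_def min_def)
    moreover have "h {e i, e j} = t" using Y(2) eY \<open>e j < e i\<close> by (metis less_irrefl)
    ultimately show ?thesis by (simp split: if_splits)
  qed
  have le': "a (e i) \<in> A (e j) \<and> b (e i) \<notin> A (e j)" if "i \<le> j" for i j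
    using le em that by (simp add: strict_mono_less_eq)
  show ?thesis
  proof (cases "t = 1")
    case True
    have "b (e i) \<in> A (e j) \<longleftrightarrow> j < i" for i j
    proof (cases "j < i")
      case T: True
      then have "e j < e i" using em by (simp add: strict_mono_def)
      then show ?thesis using gt gt'[OF T] T \<open>t = 1\<close> by blast
    qed (use le' in auto)
    then show ?thesis using AF by (intro exI[of _ "b \<circ> e"] exI[of _ "A \<circ> e"]) auto
  next
    case False
    have "a (e i) \<in> A (e j) \<longleftrightarrow> i \<le> j" for i j
      using gt'[of j i] le'[of i j] False by (cases "i \<le> j") auto
    then show ?thesis using AF by (intro exI[of _ "a \<circ> e"] exI[of _ "A \<circ> e"]) auto
  qed
qed

lemma uncountable_bool_seq: "uncountable (UNIV :: (nat \<Rightarrow> bool) set)"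
proof
  assume "countable (UNIV :: (nat \<Rightarrow> bool) set)"
  then have s: "range (from_nat_into (UNIV :: (nat \<Rightarrow> bool) set)) = UNIV"
    by (intro range_from_nat_into) auto
  then obtain k where "from_nat_into UNIV k = (\<lambda>n. \<not> from_nat_into (UNIV :: (nat \<Rightarrow> bool) set) n n)"
    by (metis UNIV_I imageE)
  then show False by (metis (full_types))
qed

section \<open>Countably compact structures elementarily equivalent to the monster\<close>

locale compact_extension = regular_type L T \<kappa> C p
    for L :: "('f, 'r) lang" and T :: "('f, 'r) fm set" and \<kappa> :: "'k rel"
    and C :: "('f, 'r, 'm) fo_struct" and p +
  fixes M :: "('f, 'r, 'b) fo_struct"
  assumes struct_M: "is_struct L M"
    and equiv_M: "\<lbrakk>wf_fm L \<phi>; fv \<phi> = {}\<rbrakk> \<Longrightarrow> sat M V \<phi> = sat C v \<phi>"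
    and compact_M: "\<lbrakk>\<And>n::nat. wf_fm L (\<psi> n); \<And>n. range (u n) \<subseteq> universe M;
      \<And>n. \<exists>x\<in>universe M. \<forall>m\<le>n. sat M ((u m)(0 := x)) (\<psi> m)\<rbrakk>
      \<Longrightarrow> \<exists>x\<in>universe M. \<forall>m. sat M ((u m)(0 := x)) (\<psi> m)"
begin

abbreviation UM where "UM \<equiv> universe M"

lemma copy:
  fixes V :: "nat \<Rightarrow> 'b"
  assumes "range V \<subseteq> UM"
  shows "\<exists>V'. range V' \<subseteq> U \<and> (\<forall>\<phi> g. wf_fm L \<phi> \<longrightarrow> sat M (V \<circ> g) \<phi> = sat C (V' \<circ> g) \<phi>)"
proof -
  obtain V' where "range V' \<subseteq> U" "\<And>\<phi>. wf_fm L \<phi> \<Longrightarrow> sat M V \<phi> = sat C V' \<phi>"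
    using copy_in_monster[OF struct_M assms equiv_M] by blast
  then show ?thesis by (metis sat_ren wf_ren)
qed

lemma no_order_M:
  assumes "wf_fm L \<phi>" "range c \<subseteq> UM" "\<And>j. range (w j) \<subseteq> UM"
    and "\<And>i j. sat M ((w j)(0 := c i)) \<phi> \<longleftrightarrow> i < (j :: nat)"
  shows False
proof -
  \<comment> \<open>The supposed order is packed into one sequence, with second component 0 for the
    elements \<open>c i\<close> and positive ones for the parameters, so that a single copy in the
    monster carries all of it.\<close>
  define V where "V k = (case prod_decode k of (i, n) \<Rightarrow> if n = 0 then c i else w i n)" for k
  have "V k \<in> UM" for k using assms(2,3) by (auto simp: V_def image_subset_iff split: prod.split)
  then have "range V \<subseteq> UM" by blast
  from copy[OF this] obtain V' where V': "range V' \<subseteq> U"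
    "\<And>\<phi> g. wf_fm L \<phi> \<Longrightarrow> sat M (V \<circ> g) \<phi> = sat C (V' \<circ> g) \<phi>" by blast
  have "sat C (\<lambda>n. if n \<in> {0} then V' (prod_encode (i, 0)) else V' (prod_encode (j, n))) \<phi> \<longleftrightarrow> i < j" for i j
  proof -
    define g where "g n = (if n = 0 then prod_encode (i, 0) else prod_encode (j, n))" for n
    have "(\<lambda>n. if n \<in> {0} then V' (prod_encode (i, 0)) else V' (prod_encode (j, n))) = V' \<circ> g"
      by (auto simp: g_def)
    moreover have "V \<circ> g = (w j)(0 := c i)" by (auto simp: V_def g_def)
    ultimately show ?thesis using V'(2)[OF assms(1), of g] assms(4) by simp
  qed
  then show False
    using no_order_property[OF assms(1), of "\<lambda>i _. V' (prod_encode (i, 0))" "\<lambda>j n. V' (prod_encode (j, n))" "{0}"]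
      V'(1) by blast
qed

text \<open>All values of \<open>u\<close> lie in \<open>B\<close>, even at variables that do not
  occur, to match \<open>isolated\<close>.\<close>

definition DB :: "'b set \<Rightarrow> 'b set set" where
  "DB B = {sol M \<psi> u | \<psi> u. wf_fm L \<psi> \<and> range u \<subseteq> B}"

lemma DB_sol: "wf_fm L \<psi> \<Longrightarrow> range u \<subseteq> B \<Longrightarrow> sol M \<psi> u \<in> DB B"
  by (auto simp: DB_def)

lemma DB_inter:
  assumes "D \<in> DB B" "E \<in> DB B"
  shows "D \<inter> E \<in> DB B"
proof -
  obtain \<phi> u \<psi> w where *: "wf_fm L \<phi>" "range u \<subseteq> B" "D = sol M \<phi> u" "wf_fm L \<psi>" "range w \<subseteq> B" "E = sol M \<psi> w"
    using assms by (auto simp: DB_def)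
  define v where "v k = (if even k then u (k div 2) else w (k div 2))" for k
  define f g where "f n = (if n = 0 then 0 else 2 * n)" and "g n = (if n = 0 then 0 else 2 * n + 1)" for n :: nat
  have "v(0 := x) \<circ> f = u(0 := x)" "v(0 := x) \<circ> g = w(0 := x)" for x
    by (auto simp: v_def f_def g_def fun_eq_iff)
  then have "D \<inter> E = sol M (Conj (ren \<phi> f) (ren \<psi> g)) v"
    by (auto simp: * sol_def sat_ren simp del: comp_apply fun_upd_apply)
  moreover have "range v \<subseteq> B" using * by (auto simp: v_def)
  ultimately show ?thesis using * by (auto simp: wf_ren intro!: DB_sol)
qed

lemma DB_compl: "D \<in> DB B \<Longrightarrow> UM - D \<in> DB B"
  unfolding DB_def using sol_Neg by (smt (verit, best) mem_Collect_eq wf_fm.simps(3))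

lemma DB_compact:
  assumes "\<And>n::nat. E n \<in> DB B" "B \<subseteq> UM" "\<And>n. E n \<noteq> {}" "\<And>n. E (Suc n) \<subseteq> E n"
  shows "\<exists>x. \<forall>n. x \<in> E n"
proof -
  have "\<forall>n. \<exists>\<psi> u. wf_fm L \<psi> \<and> range u \<subseteq> B \<and> E n = sol M \<psi> u"
    using assms(1) unfolding DB_def by blast
  then obtain \<psi> u where *: "\<And>n. wf_fm L (\<psi> n)" "\<And>n. range (u n) \<subseteq> B" "\<And>n. E n = sol M (\<psi> n) (u n)"
    by metis
  have mono: "E n \<subseteq> E m" if "m \<le> n" for m n
    using lift_Suc_antimono_le[of E, OF assms(4) that] .
  have "\<exists>x\<in>UM. \<forall>m. sat M ((u m)(0 := x)) (\<psi> m)"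
  proof (rule compact_M[OF *(1)])
    show "range (u n) \<subseteq> UM" for n using *(2) assms(2) by blast
    fix n
    obtain x where "x \<in> E n" using assms(3) by blast
    then have "\<forall>m\<le>n. x \<in> E m" using mono by blast
    then show "\<exists>x\<in>UM. \<forall>m\<le>n. sat M ((u m)(0 := x)) (\<psi> m)"
      unfolding *(3) sol_def by blast
  qed
  then show ?thesis unfolding *(3) sol_def by blast
qed

text \<open>If no smaller set decides \<open>\<phi>\<close> over \<open>B\<close>, then a full binary tree of instances of \<open>\<phi>\<close> appears.\<close>

lemma deciding_subset:
  assumes B: "B \<subseteq> UM" and D: "D \<in> DB B" "D \<noteq> {}" and \<phi>: "wf_fm L \<phi>"
  shows "\<exists>E\<in>DB B. E \<subseteq> D \<and> E \<noteq> {} \<and> (\<forall>w. range w \<subseteq> B \<longrightarrow> E \<subseteq> sol M \<phi> w \<or> E \<inter> sol M \<phi> w = {})"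
proof (rule ccontr)
  assume contr: "\<not> ?thesis"
  have split: "\<exists>w. range w \<subseteq> B \<and> \<not> E \<subseteq> sol M \<phi> w \<and> E \<inter> sol M \<phi> w \<noteq> {}"
    if E: "E \<in> DB B" "E \<subseteq> D" "E \<noteq> {}" for E
  proof -
    have "\<not> (\<forall>w. range w \<subseteq> B \<longrightarrow> E \<subseteq> sol M \<phi> w \<or> E \<inter> sol M \<phi> w = {})"
      using contr E by meson
    then show ?thesis by blast
  qed
  have "\<exists>w. E \<in> DB B \<longrightarrow> E \<subseteq> D \<longrightarrow> E \<noteq> {} \<longrightarrow>
      range w \<subseteq> B \<and> \<not> E \<subseteq> sol M \<phi> w \<and> E \<inter> sol M \<phi> w \<noteq> {}" for E
    using split[of E] by meson
  then obtain w where w: "\<And>E. E \<in> DB B \<Longrightarrow> E \<subseteq> D \<Longrightarrow> E \<noteq> {} \<Longrightarrow>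
      range (w E) \<subseteq> B \<and> \<not> E \<subseteq> sol M \<phi> (w E) \<and> E \<inter> sol M \<phi> (w E) \<noteq> {}"
    by metis
  \<comment> \<open>Nodes are lists of decisions with the latest at the head; each decision
    intersects with the splitting instance of the parent node or with its complement.\<close>
  define tree where "tree = rec_list D (\<lambda>b _ E. E \<inter> (if b then sol M \<phi> (w E) else UM - sol M \<phi> (w E)))"
  have tree_simps: "tree [] = D"
    "tree (b # l) = tree l \<inter> (if b then sol M \<phi> (w (tree l)) else UM - sol M \<phi> (w (tree l)))" for b l
    by (simp_all add: tree_def)
  have DU: "D \<subseteq> UM" using D(1) by (auto simp: DB_def sol_def)
  have tree: "tree l \<in> DB B \<and> tree l \<subseteq> D \<and> tree l \<noteq> {}" for l
  proof (induction l)
    case (Cons b l)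
    note wl = w[of "tree l"]
    have "sol M \<phi> (w (tree l)) \<in> DB B" using wl Cons by (intro DB_sol \<phi>) auto
    then have "(if b then sol M \<phi> (w (tree l)) else UM - sol M \<phi> (w (tree l))) \<in> DB B"
      using DB_compl by auto
    then have "tree (b # l) \<in> DB B" unfolding tree_simps using Cons DB_inter by blast
    moreover have "tree (b # l) \<noteq> {}" using wl Cons DU unfolding tree_simps by auto
    ultimately show ?case using Cons by (auto simp: tree_simps)
  qed (use D in \<open>simp add: tree_simps\<close>)
  define path where "path \<eta> n = rec_nat [] (\<lambda>k l. \<eta> k # l) n" for \<eta> :: "nat \<Rightarrow> bool" and n
  have path: "path \<eta> 0 = []" "path \<eta> (Suc n) = \<eta> n # path \<eta> n" for \<eta> n by (simp_all add: path_def)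
  have "\<exists>x. \<forall>n. x \<in> tree (path \<eta> n)" for \<eta>
    by (rule DB_compact[OF _ B]) (use tree in \<open>auto simp: path tree_simps\<close>)
  then obtain c where c: "\<And>\<eta> n. c \<eta> \<in> tree (path \<eta> n)" by metis
  \<comment> \<open>The nodes of the whole tree whose instance holds of the branch element. Along
    its own path they spell out \<open>\<eta>\<close>, so these sets form an uncountable family on
    the countable set of nodes, in which an order can be found.\<close>
  define Tr where "Tr \<eta> = {l. c \<eta> \<in> sol M \<phi> (w (tree l))}" for \<eta>
  have branch: "path \<eta> n \<in> Tr \<eta> \<longleftrightarrow> \<eta> n" for \<eta> n
    using c[of \<eta> "Suc n"] by (auto simp: path tree_simps Tr_def split: if_splits)
  have "inj Tr"
  proof (rule injI, rule ext)
    fix \<eta> \<theta> n assume eq: "Tr \<eta> = Tr \<theta>"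
    have "path \<eta> n = path \<theta> n" for n
    proof (induction n)
      case (Suc n)
      then show ?case using branch[of \<eta> n] branch[of \<theta> n] eq by (simp add: path)
    qed (simp add: path)
    then show "\<eta> n = \<theta> n" using branch[of \<eta> n] branch[of \<theta> n] eq by simp
  qed
  then have "uncountable (range Tr)"
    using uncountable_bool_seq countable_image_inj_eq by blast
  from erdos_makkai[OF this] obtain x :: "nat \<Rightarrow> bool list" and A :: "nat \<Rightarrow> bool list set" where xA: "range A \<subseteq> range Tr"
    "(\<forall>i j. x i \<in> A j \<longleftrightarrow> i \<le> j) \<or> (\<forall>i j. x i \<in> A j \<longleftrightarrow> j < i)" by (elim exE conjE)
  have "A j \<in> range Tr" for j using xA(1) by (meson rangeI subsetD)
  then have "\<exists>\<eta>. A j = Tr \<eta>" for j unfolding image_iff by simp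
  then have "\<exists>\<eta>. \<forall>j. A j = Tr (\<eta> j)" by (intro choice allI)
  then obtain \<eta> where \<eta>: "\<And>j. A j = Tr (\<eta> j)" by (elim exE) simp
  have cU: "c \<eta> \<in> UM" for \<eta> using c[of \<eta> 0] DU by (auto simp: path tree_simps)
  have wU: "range (w (tree l)) \<subseteq> UM" for l
  proof -
    have "tree l \<in> DB B" "tree l \<subseteq> D" "tree l \<noteq> {}" using tree[of l] by simp_all
    then have "range (w (tree l)) \<subseteq> B" using w by simp
    then show ?thesis using B by (rule order_trans)
  qed
  have mem: "x i \<in> A j \<longleftrightarrow> sat M ((w (tree (x i)))(0 := c (\<eta> j))) \<phi>" for i j
    using cU by (simp add: \<eta> Tr_def sol_def)
  from xA(2) show False
  proof
    assume "\<forall>i j. x i \<in> A j \<longleftrightarrow> i \<le> j"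
    then have "sat M ((w (tree (x j)))(0 := c (\<eta> i))) (Neg \<phi>) \<longleftrightarrow> i < j" for i j
      by (simp add: mem not_le)
    then show False
      by (intro no_order_M[of "Neg \<phi>" "\<lambda>i. c (\<eta> i)" "\<lambda>j. w (tree (x j))"]) (use \<phi> cU wU in auto)
  next
    assume "\<forall>i j. x i \<in> A j \<longleftrightarrow> j < i"
    then have "sat M ((w (tree (x j)))(0 := c (\<eta> i))) \<phi> \<longleftrightarrow> i < j" for i j
      by (simp add: mem)
    then show False
      by (intro no_order_M[of \<phi> "\<lambda>i. c (\<eta> i)" "\<lambda>j. w (tree (x j))"]) (use \<phi> cU wU in auto)
  qed
qed

text \<open>The formulas are treated one after another, each shrinking a nonempty definable set
  until it decides that formula; countable compactness gives an element common to all these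
  sets.\<close>

lemma isolated_exists:
  assumes B: "B \<subseteq> UM" and \<chi>: "wf_fm L \<chi>" "range u \<subseteq> B" "x \<in> UM" "sat M (u(0 := x)) \<chi>"
  shows "\<exists>e\<in>UM. sat M (u(0 := e)) \<chi> \<and> isolated L M e B"
proof -
  define \<phi> where "\<phi> = from_nat_into {\<phi>. wf_fm L \<phi>}"
  have ne: "{\<phi>. wf_fm L \<phi>} \<noteq> {}" using \<chi>(1) by blast
  have wf\<phi>: "wf_fm L (\<phi> k)" for k using from_nat_into[OF ne, of k] by (simp add: \<phi>_def)
  define decided where "decided k E \<longleftrightarrow>
    (\<forall>w. range w \<subseteq> B \<longrightarrow> E \<subseteq> sol M (\<phi> k) w \<or> E \<inter> sol M (\<phi> k) w = {})" for k E
  have "\<exists>E. \<forall>n. (E n \<in> DB B \<and> E n \<noteq> {} \<and> E n \<subseteq> sol M \<chi> u) \<and> E (Suc n) \<subseteq> E n \<and> decided n (E (Suc n))"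
  proof (rule dependent_nat_choice)
    have "x \<in> sol M \<chi> u" using \<chi> by (simp add: sol_def)
    then show "\<exists>E. E \<in> DB B \<and> E \<noteq> {} \<and> E \<subseteq> sol M \<chi> u" using DB_sol[OF \<chi>(1,2)] by blast
  next
    fix E n assume "E \<in> DB B \<and> E \<noteq> {} \<and> E \<subseteq> sol M \<chi> u"
    then show "\<exists>E'. (E' \<in> DB B \<and> E' \<noteq> {} \<and> E' \<subseteq> sol M \<chi> u) \<and> E' \<subseteq> E \<and> decided n E'"
      using deciding_subset[OF B _ _ wf\<phi>, of E n] unfolding decided_def by (meson order_trans)
  qed
  then obtain E where E: "\<And>n. E n \<in> DB B" "\<And>n. E n \<noteq> {}" "\<And>n. E n \<subseteq> sol M \<chi> u"
    "\<And>n. E (Suc n) \<subseteq> E n" "\<And>n. decided n (E (Suc n))" by blast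
  obtain e where e: "\<And>n. e \<in> E n" using DB_compact[of E, OF E(1) B E(2,4)] by blast
  have "e \<in> sol M \<chi> u" using e E(3) by blast
  moreover have "isolated L M e B"
    unfolding isolated_def
  proof (intro allI impI)
    fix \<psi> assume "wf_fm L \<psi>"
    then obtain k where k: "\<psi> = \<phi> k"
      using from_nat_into_surj[OF countable_wf_fm[OF countable_L]] unfolding \<phi>_def by blast
    obtain \<theta> v where \<theta>: "wf_fm L \<theta>" "range v \<subseteq> B" "E (Suc k) = sol M \<theta> v"
      using E(1)[of "Suc k"] by (auto simp: DB_def)
    have "sat M (v(0 := e)) \<theta>" using e[of "Suc k"] by (simp add: \<theta> sol_def)
    moreover have "(\<forall>x\<in>UM. sat M (v(0 := x)) \<theta> \<longrightarrow> sat M (w(0 := x)) \<psi>) \<or>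
        (\<forall>x\<in>UM. sat M (v(0 := x)) \<theta> \<longrightarrow> \<not> sat M (w(0 := x)) \<psi>)" if "range w \<subseteq> B" for w
    proof -
      have "sol M \<theta> v \<subseteq> sol M (\<phi> k) w \<or> sol M \<theta> v \<inter> sol M (\<phi> k) w = {}"
        using E(5)[of k] that unfolding decided_def \<theta>(3) by blast
      then show ?thesis unfolding k sol_def by blast
    qed
    ultimately show "\<exists>\<theta> v. wf_fm L \<theta> \<and> range v \<subseteq> B \<and> sat M (v(0 := e)) \<theta> \<and>
     (\<forall>w. range w \<subseteq> B \<longrightarrow>
        (\<forall>x\<in>UM. sat M (v(0 := x)) \<theta> \<longrightarrow> sat M (w(0 := x)) \<psi>) \<or>
        (\<forall>x\<in>UM. sat M (v(0 := x)) \<theta> \<longrightarrow> \<not> sat M (w(0 := x)) \<psi>))"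
      using \<theta>(1,2) by blast
  qed
  ultimately show ?thesis by (auto simp: sol_def)
qed

end

section \<open>A long Morley sequence in an ultrapower\<close>

text \<open>
  The new terms \<open>seq (Inr i)\<close> of the Morley sequence are represented by functions picking terms of
  \<open>\<alpha>\<close>, distinct for distinct \<open>i\<close>, whose indices eventually exceed every natural number.
\<close>

definition pos :: "'i set \<Rightarrow> nat + 'i \<Rightarrow> nat" where
  "pos F x = (case x of Inl j \<Rightarrow> j | Inr i \<Rightarrow> card F + to_nat_on F i)"

locale regular_ultrapower = regular_type L T \<kappa> C p + ultrapower W L C
    for L :: "('f, 'r) lang" and T :: "('f, 'r) fm set" and \<kappa> :: "'k rel"
    and C :: "('f, 'r, 'm) fo_struct" and p and W :: "'i set filter" +
  fixes \<alpha> :: "nat \<Rightarrow> 'm"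
  assumes W_le: "W \<le> finite_subsets_at_top UNIV"
    and infinite_index: "infinite (UNIV :: 'i set)"
    and morley_\<alpha>: "morley \<alpha>"
begin

definition seq :: "nat + 'i \<Rightarrow> ('i set \<Rightarrow> 'm) set" where
  "seq x = cls (\<lambda>F. \<alpha> (pos F x))"

lemma eventually_superset:
  assumes "finite X" "\<And>F. finite F \<Longrightarrow> X \<subseteq> F \<Longrightarrow> A F"
  shows "eventually A W"
  by (rule filter_leD[OF W_le]) (use assms in \<open>auto simp: eventually_finite_subsets_at_top\<close>)

lemma eventually_card: "eventually (\<lambda>F. k \<le> card F) W"
proof -
  obtain X :: "'i set" where "finite X" "card X = k"
    using infinite_arbitrarily_large[OF infinite_index] by blast
  then show ?thesis by (intro eventually_superset[of X]) (auto intro: card_mono)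
qed

lemma eventually_pos_neq:
  assumes "x \<noteq> y"
  shows "eventually (\<lambda>F. pos F x \<noteq> pos F y) W"
proof (cases x; cases y)
  fix i k assume "x = Inr i" "y = Inr k"
  show ?thesis
  proof (rule eventually_superset[of "{i, k}"])
    fix F :: "'i set" assume "finite F" "{i, k} \<subseteq> F"
    then show "pos F x \<noteq> pos F y"
      using assms inj_on_to_nat_on[of F] \<open>x = Inr i\<close> \<open>y = Inr k\<close>
      by (auto simp: pos_def countable_finite dest: inj_onD)
  qed simp
next
  fix i j assume "x = Inr i" "y = Inl j"
  then show ?thesis using eventually_card[of "Suc j"] by (auto simp: pos_def elim!: eventually_mono)
next
  fix i j assume "x = Inl j" "y = Inr i"
  then show ?thesis using eventually_card[of "Suc j"] by (auto simp: pos_def elim!: eventually_mono)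
qed (use assms in \<open>auto simp: pos_def\<close>)

lemma eventually_pos_inj:
  assumes "finite Y"
  shows "eventually (\<lambda>F. inj_on (pos F) Y) W"
proof -
  have "eventually (\<lambda>F. \<forall>x\<in>Y. \<forall>y\<in>Y. x \<noteq> y \<longrightarrow> pos F x \<noteq> pos F y) W"
  proof (intro eventually_ball_finite ballI assms)
    fix x y
    show "eventually (\<lambda>F. x \<noteq> y \<longrightarrow> pos F x \<noteq> pos F y) W"
      using eventually_pos_neq[of x y] by (cases "x = y") (auto elim: eventually_mono)
  qed
  then show ?thesis by eventually_elim (auto simp: inj_on_def)
qed

lemma \<alpha>_in_U: "range (\<lambda>F. \<alpha> (f F)) \<subseteq> U"
  using morley_in_U[OF morley_\<alpha>] by auto

lemma seq_in: "seq x \<in> Us"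
  unfolding seq_def by (rule cls_in[OF \<alpha>_in_U])

lemma seq_inj: "inj seq"
proof (rule injI, rule ccontr)
  fix x y assume eq: "seq x = seq y" "x \<noteq> y"
  have "eventually (\<lambda>F. \<alpha> (pos F x) = \<alpha> (pos F y)) W"
    using eq(1) cls_eq[OF \<alpha>_in_U[of "\<lambda>F. pos F x"] \<alpha>_in_U[of "\<lambda>F. pos F y"]]
    unfolding seq_def by blast
  then have "eventually (\<lambda>F. pos F x = pos F y) W"
    by eventually_elim (use morley_inj[OF morley_\<alpha>] in \<open>auto dest: injD\<close>)
  then show False using eventually_pos_neq[OF eq(2)] by (simp add: eventually_not)
qed

lemma sat_seq:
  assumes "range w \<subseteq> Us" "wf_fm L \<phi>"
  shows "sat (upow W C) (w(0 := seq x)) \<phi> \<longleftrightarrow>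
    eventually (\<lambda>F. sat C ((\<lambda>k. urep (w k) F)(0 := \<alpha> (pos F x))) \<phi>) W"
  unfolding seq_def by (rule los_upd[OF \<alpha>_in_U assms])

lemma urep_in_U: "range w \<subseteq> Us \<Longrightarrow> range (\<lambda>k. urep (w k) F) \<subseteq> U"
  using urep_Us by (auto simp: subset_iff)

text \<open>\<open>Suc n\<close> exceptions in the ultrapower would sit at distinct positions in
  almost every factor, so the uniform bound passes up unchanged.\<close>

lemma few_exceptions:
  assumes \<phi>: "wf_fm L \<phi>" and w: "range w \<subseteq> Us"
    and n: "eventually (\<lambda>F. finite {i. \<not> sat C ((\<lambda>k. urep (w k) F)(0 := \<alpha> i)) \<phi>} \<and>
       card {i. \<not> sat C ((\<lambda>k. urep (w k) F)(0 := \<alpha> i)) \<phi>} \<le> n) W"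
  shows "finite {x. \<not> sat (upow W C) (w(0 := seq x)) \<phi>} \<and> card {x. \<not> sat (upow W C) (w(0 := seq x)) \<phi>} \<le> n"
proof -
  let ?X = "{x. \<not> sat (upow W C) (w(0 := seq x)) \<phi>}"
  have no: False if Y: "Y \<subseteq> ?X" "finite Y" "card Y = Suc n" for Y
  proof -
    have "eventually (\<lambda>F. \<forall>x\<in>Y. \<not> sat C ((\<lambda>k. urep (w k) F)(0 := \<alpha> (pos F x))) \<phi>) W"
    proof (intro eventually_ball_finite ballI Y(2))
      fix x assume "x \<in> Y"
      then have "\<not> sat (upow W C) (w(0 := seq x)) \<phi>" using Y(1) by blast
      then show "eventually (\<lambda>F. \<not> sat C ((\<lambda>k. urep (w k) F)(0 := \<alpha> (pos F x))) \<phi>) W"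
        unfolding sat_seq[OF w \<phi>] eventually_not .
    qed
    then have "eventually (\<lambda>F. False) W"
      using n eventually_pos_inj[OF Y(2)]
    proof eventually_elim
      case (elim F)
      let ?E = "{i. \<not> sat C ((\<lambda>k. urep (w k) F)(0 := \<alpha> i)) \<phi>}"
      have "pos F ` Y \<subseteq> ?E" using elim(1) by auto
      then have "card (pos F ` Y) \<le> card ?E" using elim(2) by (intro card_mono) auto
      then show False using elim(2,3) Y(3) by (simp add: card_image)
    qed
    then show False using proper by (simp add: trivial_limit_def)
  qed
  have fin: "finite ?X"
  proof (rule ccontr)
    assume "infinite ?X"
    from infinite_arbitrarily_large[OF this, of "Suc n"]
    obtain Y where "finite Y" "card Y = Suc n" "Y \<subseteq> ?X" by (elim exE conjE)
    then show False using no by blast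
  qed
  moreover have "card ?X \<le> n"
  proof (rule ccontr)
    assume "\<not> card ?X \<le> n"
    then have "Suc n \<le> card ?X" by simp
    then obtain Y where "Y \<subseteq> ?X" "card Y = Suc n" "finite Y"
      by (rule obtain_subset_with_card_n)
    then show False using no by blast
  qed
  ultimately show ?thesis ..
qed

lemma seq_definition:
  assumes \<phi>: "wf_fm L \<phi>"
  shows "\<exists>n. \<forall>w. range w \<subseteq> Us \<longrightarrow>
      (finite {x. \<not> sat (upow W C) (w(0 := seq x)) \<phi>} \<and> card {x. \<not> sat (upow W C) (w(0 := seq x)) \<phi>} \<le> n) \<or>
      (finite {x. sat (upow W C) (w(0 := seq x)) \<phi>} \<and> card {x. sat (upow W C) (w(0 := seq x)) \<phi>} \<le> n)"
proof -
  obtain n where n: "\<And>w. range w \<subseteq> U \<Longrightarrow>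
    (P \<phi> w \<longrightarrow> finite {i. \<not> sat C (w(0 := \<alpha> i)) \<phi>} \<and> card {i. \<not> sat C (w(0 := \<alpha> i)) \<phi>} \<le> n) \<and>
    (\<not> P \<phi> w \<longrightarrow> finite {i. sat C (w(0 := \<alpha> i)) \<phi>} \<and> card {i. sat C (w(0 := \<alpha> i)) \<phi>} \<le> n)"
    using morley_definition[OF morley_\<alpha> \<phi>] by blast
  show ?thesis
  proof (intro exI[of _ n] allI impI)
    fix w :: "nat \<Rightarrow> ('i set \<Rightarrow> 'm) set" assume w: "range w \<subseteq> Us"
    note nF = n[OF urep_in_U[OF w]]
    have neg: "wf_fm L (Neg \<phi>)" using \<phi> by simp
    consider "eventually (\<lambda>F. P \<phi> (\<lambda>k. urep (w k) F)) W" | "eventually (\<lambda>F. \<not> P \<phi> (\<lambda>k. urep (w k) F)) W"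
      using ultra by blast
    then show "(finite {x. \<not> sat (upow W C) (w(0 := seq x)) \<phi>} \<and> card {x. \<not> sat (upow W C) (w(0 := seq x)) \<phi>} \<le> n) \<or>
      (finite {x. sat (upow W C) (w(0 := seq x)) \<phi>} \<and> card {x. sat (upow W C) (w(0 := seq x)) \<phi>} \<le> n)"
    proof cases
      case 1
      show ?thesis
        by (rule disjI1, rule few_exceptions[OF \<phi> w], rule eventually_mono[OF 1]) (use nF in blast)
    next
      case 2
      have "finite {x. \<not> sat (upow W C) (w(0 := seq x)) (Neg \<phi>)} \<and>
          card {x. \<not> sat (upow W C) (w(0 := seq x)) (Neg \<phi>)} \<le> n"
        by (rule few_exceptions[OF neg w], rule eventually_mono[OF 2])
          (simp only: sat.simps not_not, use nF in blast)
      then show ?thesis by (simp only: sat.simps not_not simp_thms)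
    qed
  qed
qed

text \<open>In almost every factor the relevant positions are distinct, and symmetry of the Morley
  sequence evaluates the formula to a value of \<open>P\<close> in which \<open>seq x\<close> and
  \<open>seq y\<close> no longer appear.\<close>

lemma seq_indiscernible:
  assumes \<phi>: "wf_fm L \<phi>" and x: "x \<notin> h ` (fv \<phi> - {0})" and y: "y \<notin> h ` (fv \<phi> - {0})"
  shows "sat (upow W C) ((seq \<circ> h)(0 := seq x)) \<phi> = sat (upow W C) ((seq \<circ> h)(0 := seq y)) \<phi>"
proof -
  have *: "sat (upow W C) ((seq \<circ> h)(0 := seq z)) \<phi> \<longleftrightarrow> eventually (\<lambda>F. P \<phi> (\<alpha> \<circ> (pos F \<circ> h))) W"
    if z: "z \<notin> h ` (fv \<phi> - {0})" for z
  proof -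
    define v where "v n F = \<alpha> (if n = 0 then pos F z else pos F (h n))" for n F
    have "v 0 = (\<lambda>F. \<alpha> (pos F z))" "n \<noteq> 0 \<Longrightarrow> v n = (\<lambda>F. \<alpha> (pos F (h n)))" for n
      by (auto simp: v_def fun_eq_iff)
    then have "(seq \<circ> h)(0 := seq z) = (\<lambda>n. cls (v n))"
      by (intro ext) (simp add: seq_def)
    moreover have "range (v n) \<subseteq> U" for n unfolding v_def by (rule \<alpha>_in_U)
    ultimately have "sat (upow W C) ((seq \<circ> h)(0 := seq z)) \<phi> \<longleftrightarrow> eventually (\<lambda>F. sat C (\<lambda>n. v n F) \<phi>) W"
      using los_cls[OF _ \<phi>, of v] by simp
    also have "\<dots> \<longleftrightarrow> eventually (\<lambda>F. P \<phi> (\<alpha> \<circ> (pos F \<circ> h))) W"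
    proof (rule eventually_cong[OF eventually_pos_inj[of "insert z (h ` (fv \<phi> - {0}))"]])
      show "finite (insert z (h ` (fv \<phi> - {0})))" by (simp add: finite_fv)
      fix F assume inj: "inj_on (pos F) (insert z (h ` (fv \<phi> - {0})))"
      have "pos F z \<notin> (pos F \<circ> h) ` (fv \<phi> - {0})"
      proof
        assume "pos F z \<in> (pos F \<circ> h) ` (fv \<phi> - {0})"
        then obtain k where k: "k \<in> fv \<phi> - {0}" "pos F z = pos F (h k)"
          unfolding comp_def by blast
        then have "z = h k" by (intro inj_onD[OF inj k(2)]) auto
        then show False using z k(1) by blast
      qed
      then have "sat C ((\<alpha> \<circ> (pos F \<circ> h))(0 := \<alpha> (pos F z))) \<phi> \<longleftrightarrow> P \<phi> (\<alpha> \<circ> (pos F \<circ> h))"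
        by (rule morley_symmetric[OF morley_\<alpha> \<phi>])
      moreover have "(\<lambda>n. v n F) = (\<alpha> \<circ> (pos F \<circ> h))(0 := \<alpha> (pos F z))" by (auto simp: v_def)
      ultimately show "sat C (\<lambda>n. v n F) \<phi> = P \<phi> (\<alpha> \<circ> (pos F \<circ> h))" by simp
    qed
    finally show ?thesis .
  qed
  show ?thesis using *[OF x] *[OF y] by simp
qed

sublocale compact_extension L T \<kappa> C p "upow W C"
proof
  show "is_struct L (upow W C)" by (rule struct_upow)
next
  fix \<phi> V v assume \<phi>: "wf_fm L \<phi>" "fv \<phi> = {}"
  obtain u where u: "u \<in> U" using U_ne by blast
  have "sat (upow W C) V \<phi> = sat (upow W C) (\<lambda>n. cls (\<lambda>_. u)) \<phi>"
    by (rule sat_cong) (simp add: \<phi>)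
  also have "\<dots> \<longleftrightarrow> eventually (\<lambda>F. sat C (\<lambda>n. u) \<phi>) W"
    using los_cls[of "\<lambda>_ _. u", OF _ \<phi>(1)] u by auto
  also have "\<dots> \<longleftrightarrow> sat C (\<lambda>n. u) \<phi>" using proper by simp
  also have "\<dots> \<longleftrightarrow> sat C v \<phi>" by (rule sat_cong) (simp add: \<phi>)
  finally show "sat (upow W C) V \<phi> = sat C v \<phi>" .
next
  fix \<psi> :: "nat \<Rightarrow> ('f, 'r) fm" and u :: "nat \<Rightarrow> nat \<Rightarrow> ('i set \<Rightarrow> 'm) set"
  assume "\<And>n. wf_fm L (\<psi> n)" "\<And>n. range (u n) \<subseteq> Us"
    "\<And>n. \<exists>x\<in>Us. \<forall>m\<le>n. sat (upow W C) ((u m)(0 := x)) (\<psi> m)"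
  then show "\<exists>x\<in>Us. \<forall>m. sat (upow W C) ((u m)(0 := x)) (\<psi> m)"
    by (rule countably_compact[OF eventually_card])
qed

text \<open>
  Strong regularity passes to the ultrapower: a counterexample, together with the constants
  \<open>seq (Inl j)\<close>, would have a copy in the monster with \<open>\<alpha>\<close> in place of these constants.
\<close>

lemma seq_regular:
  assumes B: "range (seq \<circ> Inl) \<subseteq> B" "B \<subseteq> Us" and q: "q \<in> Us" and c: "c \<in> Us"
    and gc: "generic L (upow W C) seq c B" and gq: "\<not> generic L (upow W C) seq q B"
  shows "generic L (upow W C) seq c (insert q B)"
  unfolding generic_def
proof (intro allI impI)
  fix \<phi> v
  assume \<phi>: "wf_fm L \<phi>" and v: "range v \<subseteq> Us" "v ` (fv \<phi> - {0}) \<subseteq> insert q B"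
    and fin: "finite {x. \<not> sat (upow W C) (v(0 := seq x)) \<phi>}"
  let ?M = "upow W C"
  obtain \<theta> u where \<theta>: "wf_fm L \<theta>" "range u \<subseteq> Us" "u ` (fv \<theta> - {0}) \<subseteq> B"
    "finite {x. \<not> sat ?M (u(0 := seq x)) \<theta>}" "\<not> sat ?M (u(0 := q)) \<theta>"
    using gq unfolding generic_def by blast
  \<comment> \<open>The base terms, both parameter tuples, \<open>c\<close> and \<open>q\<close>
    form one sequence, tagged by the first component of the decoded pair, so that one copy preserves
    all relations between them.\<close>
  define V where "V m = (case prod_decode m of (t, k) \<Rightarrow>
    if t = 0 then seq (Inl k) else if t = 1 then v k else if t = 2 then u k else if t = 3 then c else q)" for m
  define ia iv iu where "ia k = prod_encode (0, k)" and "iv k = prod_encode (1, k)" and "iu k = prod_encode (2, k)"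
    for k :: nat
  define ic iq where "ic = prod_encode (3, 0)" and "iq = prod_encode (4, 0)"
  have V: "V (ia k) = seq (Inl k)" "V (iv k) = v k" "V (iu k) = u k" "V ic = c" "V iq = q" for k
    by (simp_all add: V_def ia_def iv_def iu_def ic_def iq_def)
  have "V m \<in> Us" for m
    using v(1) \<theta>(2) seq_in c q by (auto simp: V_def image_subset_iff split: prod.split)
  then have "range V \<subseteq> Us" by blast
  from copy[OF this] obtain V0 where V0: "range V0 \<subseteq> U"
    "\<And>\<chi> g. wf_fm L \<chi> \<Longrightarrow> sat ?M (V \<circ> g) \<chi> = sat C (V0 \<circ> g) \<chi>" by blast
  have "\<exists>g. is_aut L C g \<and> (\<forall>k\<in>UNIV. g ((V0 \<circ> ia) k) = \<alpha> k)"
  proof (rule homogeneous)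
    show "range (V0 \<circ> ia) \<subseteq> U" using V0(1) by auto
    show "range \<alpha> \<subseteq> U" using morley_in_U[OF morley_\<alpha>] by auto
    fix \<chi> :: "('f, 'r) fm" assume \<chi>: "wf_fm L \<chi>"
    have Via: "V \<circ> ia = (\<lambda>k. cls (\<lambda>F. \<alpha> k))" by (auto simp: V seq_def pos_def)
    have "sat C (V0 \<circ> ia) \<chi> = sat ?M (\<lambda>k. cls (\<lambda>F. \<alpha> k)) \<chi>" using V0(2)[OF \<chi>, of ia] unfolding Via by simp
    also have "\<dots> \<longleftrightarrow> eventually (\<lambda>F. sat C (\<lambda>k. \<alpha> k) \<chi>) W"
      by (rule los_cls[OF \<alpha>_in_U \<chi>])
    also have "\<dots> \<longleftrightarrow> sat C \<alpha> \<chi>" using proper by simp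
    finally show "sat C (V0 \<circ> ia) \<chi> = sat C \<alpha> \<chi>" .
  qed
  then obtain g where g: "is_aut L C g" "\<And>k. g (V0 (ia k)) = \<alpha> k" by auto
  define V' where "V' = g \<circ> V0"
  have V'U: "V' m \<in> U" for m
    using V0(1) g(1) by (auto simp: V'_def is_aut_def bij_betw_def)
  have V': "sat C (V' \<circ> f) \<chi> = sat ?M (V \<circ> f) \<chi>" if "wf_fm L \<chi>" for \<chi> f
  proof -
    have "range (V0 \<circ> f) \<subseteq> U" using V0(1) by auto
    then have "sat C (g \<circ> (V0 \<circ> f)) \<chi> = sat C (V0 \<circ> f) \<chi>"
      using sat_aut[OF is_struct_C g(1) _ that] by blast
    then show ?thesis using V0(2)[OF that] by (simp add: V'_def comp_assoc)
  qed
  have V'eq: "V' m = V' k" if "V m = V k" for m k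
    using V'[of "Eq (Var 0) (Var 1)" "\<lambda>n. if n = 0 then m else k"] that by simp
  have upd: "sat C ((V' \<circ> f)(0 := V' m)) \<chi> = sat ?M ((V \<circ> f)(0 := V m)) \<chi>" if "wf_fm L \<chi>" for \<chi> f m
    using V'[OF that, of "f(0 := m)"] by (simp only: fun_upd_comp)
  \<comment> \<open>Every formula has finitely many exceptions along \<open>seq\<close> or holds for
    finitely many terms. Which case occurs is visible on the base, where the copy agrees with
    \<open>\<alpha>\<close>, and there it is decided by \<open>p\<close>.\<close>
  have large: "P \<chi> (V' \<circ> f) \<longleftrightarrow> finite {x. \<not> sat ?M ((V \<circ> f)(0 := seq x)) \<chi>}" if \<chi>: "wf_fm L \<chi>" for \<chi> f
  proof -
    have eq: "sat C ((V' \<circ> f)(0 := \<alpha> j)) \<chi> = sat ?M ((V \<circ> f)(0 := seq (Inl j))) \<chi>" for j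
      using upd[OF \<chi>, of f "ia j"] g(2) by (simp add: V V'_def)
    have fU: "range (V' \<circ> f) \<subseteq> U" "range (V \<circ> f) \<subseteq> Us" using V'U \<open>range V \<subseteq> Us\<close> by auto
    have Inl_fin: "finite {j. A (seq (Inl j))}" if "finite {x. A (seq x)}" for A
      using finite_vimageI[OF that, of "Inl :: nat \<Rightarrow> nat + 'i"] by (simp add: vimage_def)
    have nfin: "\<not> (finite {j::nat. A j} \<and> finite {j. \<not> A j})" for A
    proof
      assume "finite {j::nat. A j} \<and> finite {j. \<not> A j}"
      then have "finite ({j. A j} \<union> {j. \<not> A j})" by blast
      moreover have "{j. A j} \<union> {j. \<not> A j} = UNIV" by blast
      ultimately show False using infinite_UNIV_nat by simp
    qed
    obtain n where n: "(P \<chi> (V' \<circ> f) \<longrightarrow> finite {i. \<not> sat C ((V' \<circ> f)(0 := \<alpha> i)) \<chi>}) \<and>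
       (\<not> P \<chi> (V' \<circ> f) \<longrightarrow> finite {i. sat C ((V' \<circ> f)(0 := \<alpha> i)) \<chi>})"
      using morley_definition[OF morley_\<alpha> \<chi>] fU(1) by blast
    have "finite {x. \<not> sat ?M ((V \<circ> f)(0 := seq x)) \<chi>} \<or> finite {x. sat ?M ((V \<circ> f)(0 := seq x)) \<chi>}"
      using seq_definition[OF \<chi>] fU(2) by blast
    then show ?thesis
    proof
      assume f1: "finite {x. \<not> sat ?M ((V \<circ> f)(0 := seq x)) \<chi>}"
      then have "finite {i. \<not> sat C ((V' \<circ> f)(0 := \<alpha> i)) \<chi>}"
        unfolding eq by (rule Inl_fin[of "\<lambda>e. \<not> sat ?M ((V \<circ> f)(0 := e)) \<chi>"])
      then show ?thesis using f1 n nfin[of "\<lambda>i. sat C ((V' \<circ> f)(0 := \<alpha> i)) \<chi>"] by blast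
    next
      assume f1: "finite {x. sat ?M ((V \<circ> f)(0 := seq x)) \<chi>}"
      then have f2: "finite {i. sat C ((V' \<circ> f)(0 := \<alpha> i)) \<chi>}"
        unfolding eq by (rule Inl_fin[of "\<lambda>e. sat ?M ((V \<circ> f)(0 := e)) \<chi>"])
      then have "\<not> P \<chi> (V' \<circ> f)"
        using n nfin[of "\<lambda>i. sat C ((V' \<circ> f)(0 := \<alpha> i)) \<chi>"] by blast
      moreover have "infinite {x. \<not> sat ?M ((V \<circ> f)(0 := seq x)) \<chi>}"
      proof
        assume "finite {x. \<not> sat ?M ((V \<circ> f)(0 := seq x)) \<chi>}"
        then have "finite {i. \<not> sat C ((V' \<circ> f)(0 := \<alpha> i)) \<chi>}"
          unfolding eq by (rule Inl_fin[of "\<lambda>e. \<not> sat ?M ((V \<circ> f)(0 := e)) \<chi>"])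
        then show False using f2 nfin[of "\<lambda>i. sat C ((V' \<circ> f)(0 := \<alpha> i)) \<chi>"] by blast
      qed
      ultimately show ?thesis by blast
    qed
  qed
  \<comment> \<open>Only the part of \<open>B\<close> occurring in the copied sequence is kept; it
    is countable, hence small in the monster.\<close>
  define B' where "B' = V' ` {m. V m \<in> B}"
  have B': "countable B'" "B' \<subseteq> U" unfolding B'_def using V'U by auto
  have "R (V' ic) B'"
    unfolding R_def
  proof (intro conjI ballI impI V'U)
    fix D assume D: "D \<in> Def L C B'" "pp D"
    obtain \<chi> w where \<chi>: "wf_fm L \<chi>" "w ` (fv \<chi> - {0}) \<subseteq> B'" "D = sol C \<chi> w"
      using Def_sol[OF D(1) B'(2) U_ne] by blast
    have "\<exists>m. k \<in> fv \<chi> - {0} \<longrightarrow> V m \<in> B \<and> w k = V' m" for k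
    proof (cases "k \<in> fv \<chi> - {0}")
      case True
      then have "w k \<in> B'" using \<chi>(2) by blast
      then show ?thesis by (auto simp: B'_def)
    qed blast
    then obtain f where f: "\<And>k. k \<in> fv \<chi> - {0} \<Longrightarrow> V (f k) \<in> B \<and> w k = V' (f k)" by metis
    have D': "D = sol C \<chi> (V' \<circ> f)" unfolding \<chi>(3) by (rule sol_cong) (use f in auto)
    then have "finite {x. \<not> sat ?M ((V \<circ> f)(0 := seq x)) \<chi>}" using large[OF \<chi>(1)] D(2) by blast
    moreover have "(V \<circ> f) ` (fv \<chi> - {0}) \<subseteq> B" using f unfolding comp_def by blast
    moreover have "range (V \<circ> f) \<subseteq> Us" using \<open>range V \<subseteq> Us\<close> by auto
    ultimately have "sat ?M ((V \<circ> f)(0 := c)) \<chi>"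
      using gc \<chi>(1) unfolding generic_def by blast
    then have "sat C ((V' \<circ> f)(0 := V' ic)) \<chi>" unfolding upd[OF \<chi>(1)] V .
    then show "V' ic \<in> D" unfolding D' sol_def using V'U by blast
  qed
  moreover have "\<not> R (V' iq) B'"
  proof
    assume Rq: "R (V' iq) B'"
    have "(V' \<circ> iu) ` (fv \<theta> - {0}) \<subseteq> B'"
      using \<theta>(3) V(3) by (auto simp: B'_def image_subset_iff)
    then have "sat C ((V' \<circ> iu)(0 := V' iq)) \<theta> \<longleftrightarrow> P \<theta> (V' \<circ> iu)"
      by (rule R_sat[OF Rq \<theta>(1) _ B'(2)])
    moreover have "V \<circ> iu = u" using V(3) by auto
    ultimately show False
      using \<theta>(4,5) unfolding upd[OF \<theta>(1)] large[OF \<theta>(1)] V by simp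
  qed
  ultimately have "R (V' ic) (insert (V' iq) B')"
    by (intro R_strongly_regular[OF B' V'U])
  moreover have "(V' \<circ> iv) ` (fv \<phi> - {0}) \<subseteq> insert (V' iq) B'"
  proof (rule image_subsetI)
    fix k assume "k \<in> fv \<phi> - {0}"
    then have "v k \<in> insert q B" using v(2) by blast
    then show "(V' \<circ> iv) k \<in> insert (V' iq) B'"
    proof
      assume "v k = q"
      then show ?thesis using V'eq[of "iv k" iq] V by simp
    next
      assume "v k \<in> B"
      then show ?thesis using V(2)[of k] by (auto simp: B'_def)
    qed
  qed
  ultimately have "sat C ((V' \<circ> iv)(0 := V' ic)) \<phi> \<longleftrightarrow> P \<phi> (V' \<circ> iv)"
    by (rule R_sat[OF _ \<phi>]) (use B' V'U in auto)
  moreover have "V \<circ> iv = v" using V(2) by auto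
  ultimately show "sat ?M (v(0 := c)) \<phi>"
    using fin unfolding upd[OF \<phi>] large[OF \<phi>] V by simp
qed

lemma ambient_upow: "ambient L (upow W C) seq"
proof
  show "countable_lang L" by (rule countable_L)
  show "is_struct L (upow W C)" by (rule struct_upow)
  show "seq i \<in> Us" for i by (rule seq_in)
  show "inj seq" by (rule seq_inj)
  show "sat (upow W C) ((seq \<circ> h)(0 := seq i)) \<phi> = sat (upow W C) ((seq \<circ> h)(0 := seq j)) \<phi>"
    if "wf_fm L \<phi>" "i \<notin> h ` (fv \<phi> - {0})" "j \<notin> h ` (fv \<phi> - {0})" for \<phi> h i j
    by (rule seq_indiscernible[OF that])
  show "generic L (upow W C) seq c (insert q B)"
    if "range (seq \<circ> Inl) \<subseteq> B" "B \<subseteq> UM" "q \<in> UM" "c \<in> UM"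
      "generic L (upow W C) seq c B" "\<not> generic L (upow W C) seq q B" for B q c
    by (rule seq_regular[OF that])
qed (blast intro: isolated_exists seq_definition)+

end

section \<open>Transport to the prescribed type\<close>

text \<open>The condition \<open>tv\<close> is the Tarski-Vaught test. Applied to an equation
  \<open>x = t\<close> it also shows that \<open>A\<close> is closed under the functions. The
  structure is moved along \<open>e\<close> because the final model must live on a prescribed
  type.\<close>

lemma transport_elementary:
  assumes M: "is_struct L M" and A: "A \<subseteq> universe M" "A \<noteq> {}" and e: "inj_on e A"
    and tv: "\<And>\<phi> w x. wf_fm L \<phi> \<Longrightarrow> range w \<subseteq> A \<Longrightarrow> x \<in> universe M \<Longrightarrow> sat M (w(0 := x)) \<phi> \<Longrightarrow>
      \<exists>y\<in>A. sat M (w(0 := y)) \<phi>"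
  shows "\<exists>N. is_struct L N \<and> universe N = e ` A \<and>
    (\<forall>\<phi> v. wf_fm L \<phi> \<longrightarrow> range v \<subseteq> A \<longrightarrow> sat N (e \<circ> v) \<phi> = sat M v \<phi>)"
proof -
  define d where "d = the_inv_into A e"
  have de: "d (e x) = x" if "x \<in> A" for x using e that by (simp add: d_def the_inv_into_f_f)
  define N where "N = \<lparr>universe = e ` A, fun_int = (\<lambda>f xs. e (fun_int M f (map d xs))),
    rel_int = (\<lambda>r xs. rel_int M r (map d xs))\<rparr>"
  have N_simps: "universe N = e ` A" "fun_int N f xs = e (fun_int M f (map d xs))"
    "rel_int N r xs = rel_int M r (map d xs)" for f r xs by (simp_all add: N_def)
  have closed: "eval_tm M v t \<in> A" if t: "wf_tm L t" and v: "range v \<subseteq> A" for v t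
  proof -
    define w where "w k = v (k - 1)" for k
    have shift: "w(0 := x) \<circ> Suc = v" for x by (auto simp: w_def)
    have eq: "sat M (w(0 := x)) (Eq (Var 0) (ren_tm Suc t)) \<longleftrightarrow> x = eval_tm M v t" for x
      by (simp only: sat.simps eval_ren_tm shift) simp
    have "eval_tm M v t \<in> universe M" by (rule eval_tm_in_universe[OF M t]) (use v A in blast)
    moreover have "range w \<subseteq> A" using v by (auto simp: w_def)
    moreover have "wf_fm L (Eq (Var 0) (ren_tm Suc t))" using t by (simp add: wf_ren_tm)
    ultimately have "\<exists>y\<in>A. sat M (w(0 := y)) (Eq (Var 0) (ren_tm Suc t))"
      using tv eq by blast
    then show ?thesis unfolding eq by blast
  qed
  have evN: "eval_tm N (e \<circ> v) t = e (eval_tm M v t)" if "wf_tm L t" "range v \<subseteq> A" for v t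
    using that
  proof (induction t)
    case (Fn f ts)
    have "map d (map (eval_tm N (e \<circ> v)) ts) = map (eval_tm M v) ts"
      using Fn de closed by (auto simp: comp_def)
    then show ?case by (simp only: eval_tm.simps N_simps)
  qed simp
  have sN: "sat N (e \<circ> v) \<phi> = sat M v \<phi>" if "wf_fm L \<phi>" "range v \<subseteq> A" for v \<phi>
    using that
  proof (induction \<phi> arbitrary: v)
    case (Eq s t)
    have "e (eval_tm M v s) = e (eval_tm M v t) \<longleftrightarrow> eval_tm M v s = eval_tm M v t"
      by (rule inj_on_eq_iff[OF e]) (use Eq closed in auto)
    moreover have "eval_tm N (e \<circ> v) s = e (eval_tm M v s)" "eval_tm N (e \<circ> v) t = e (eval_tm M v t)"
      by (rule evN; use Eq in simp)+
    ultimately show ?case by (simp only: sat.simps)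
  next
    case (Rel r ts)
    have "map d (map (eval_tm N (e \<circ> v)) ts) = map (eval_tm M v) ts"
      using Rel evN[OF _ Rel.prems(2)] de closed[OF _ Rel.prems(2)] by (auto simp: comp_def)
    then show ?case by (simp only: sat.simps N_simps)
  next
    case (Ex n \<phi>)
    have IH: "sat N ((e \<circ> v)(n := e x)) \<phi> = sat M (v(n := x)) \<phi>" if "x \<in> A" for x
    proof -
      have "sat N (e \<circ> v(n := x)) \<phi> = sat M (v(n := x)) \<phi>"
        by (rule Ex.IH) (use Ex.prems that in auto)
      then show ?thesis by (simp only: fun_upd_comp)
    qed
    have "sat N (e \<circ> v) (fm.Ex n \<phi>) \<longleftrightarrow> (\<exists>x\<in>A. sat M (v(n := x)) \<phi>)"
    proof -
      have "sat N (e \<circ> v) (fm.Ex n \<phi>) \<longleftrightarrow> (\<exists>x\<in>A. sat N ((e \<circ> v)(n := e x)) \<phi>)"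
        unfolding sat.simps by (simp only: N_simps bex_simps)
      then show ?thesis using IH by blast
    qed
    also have "\<dots> \<longleftrightarrow> (\<exists>x\<in>universe M. sat M (v(n := x)) \<phi>)"
    proof
      assume "\<exists>x\<in>universe M. sat M (v(n := x)) \<phi>"
      then obtain x where x: "x \<in> universe M" "sat M (v(n := x)) \<phi>" by blast
      define \<pi> where "\<pi> k = (if k = n then 0 else Suc k)" for k
      define w where "w k = v (k - 1)" for k
      have wu: "w(0 := y) \<circ> \<pi> = v(n := y)" for y by (auto simp: w_def \<pi>_def)
      have eq: "sat M (w(0 := y)) (ren \<phi> \<pi>) = sat M (v(n := y)) \<phi>" for y
        by (simp only: sat_ren wu)
      have "\<exists>y\<in>A. sat M (w(0 := y)) (ren \<phi> \<pi>)"
      proof (rule tv[OF _ _ x(1)])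
        show "wf_fm L (ren \<phi> \<pi>)" using Ex.prems by (simp add: wf_ren)
        show "range w \<subseteq> A" using Ex.prems by (auto simp: w_def)
        show "sat M (w(0 := x)) (ren \<phi> \<pi>)" unfolding eq by (rule x(2))
      qed
      then show "\<exists>x\<in>A. sat M (v(n := x)) \<phi>" unfolding eq .
    qed (use A in blast)
    finally show ?case by (simp only: sat.simps)
  qed auto
  have "is_struct L N"
    unfolding is_struct_def
  proof (intro conjI ballI impI)
    show "universe N \<noteq> {}" using A by (simp add: N_def)
    fix f xs assume f: "f \<in> Funs L" "xs \<in> lists (universe N)" "length xs = fun_ar L f"
    have dA: "d x \<in> A" if "x \<in> set xs" for x using that f(2) de by (auto simp: N_def)
    obtain a0 where a0: "a0 \<in> A" using A by blast
    define v where "v k = (if k < length xs then d (xs ! k) else a0)" for k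
    have "eval_tm M v (Fn f (map Var [0..<length xs])) \<in> A"
      by (rule closed) (use f dA a0 in \<open>auto simp: v_def\<close>)
    moreover have "map (eval_tm M v) (map Var [0..<length xs]) = map d xs"
      by (rule nth_equalityI) (auto simp: v_def)
    ultimately have "fun_int M f (map d xs) \<in> A" by (simp only: eval_tm.simps)
    then show "fun_int N f xs \<in> universe N" by (simp add: N_def)
  qed
  moreover have "universe N = e ` A" by (simp add: N_def)
  ultimately show ?thesis using sN by blast
qed

text \<open>A finite set of subsets of \<open>'d\<close> is listed and coded by a subset of
  \<open>'d \<times> nat\<close>, each member tagged with its place; an infinite \<open>'d\<close>
  absorbs the factor \<open>nat\<close>.\<close>

lemma code_injection:
  assumes "infinite (UNIV :: 'd set)"
  shows "\<exists>e :: 'd set code \<Rightarrow> 'd set. inj_on e {d. finite (supp d)}"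
proof -
  have "|UNIV :: nat set| \<le>o |UNIV :: 'd set|"
    using assms infinite_iff_card_of_nat by blast
  then have "|(UNIV :: 'd set) \<times> (UNIV :: nat set)| =o |UNIV :: 'd set|"
    using card_of_Times_infinite[OF assms] by blast
  then obtain \<iota> where "bij_betw \<iota> ((UNIV :: 'd set) \<times> (UNIV :: nat set)) (UNIV :: 'd set)"
    using card_of_ordIso by blast
  then have \<iota>: "inj \<iota>" by (simp add: bij_betw_def)
  define z0 :: 'd where "z0 = undefined"
  define li where "li s = (SOME xs. set xs = s)" for s :: "'d set set"
  have li: "set (li s) = s" if "finite s" for s
    unfolding li_def by (rule someI_ex) (rule finite_list[OF that])
  \<comment> \<open>The tags 0 to 2 stand for the number \<open>n\<close>, the length of the list
    and its entries, 3 and 4 for the two kinds of leaves. The length is recorded because an empty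
    entry leaves no trace.\<close>
  define enc where "enc d = (case d of
      Lf x \<Rightarrow> (case x of Inl j \<Rightarrow> {(z0, prod_encode (3, j))} | Inr A \<Rightarrow> A \<times> {prod_encode (4, 0)})
    | Wt s n \<Rightarrow> {(z0, prod_encode (0, n)), (z0, prod_encode (1, length (li s)))} \<union>
        {(z, prod_encode (2, k)) | z k. k < length (li s) \<and> z \<in> li s ! k})" for d
  have mem0: "(z0, prod_encode (0, m)) \<in> enc (Wt s n) \<longleftrightarrow> m = n" for s n m by (auto simp: enc_def)
  have mem1: "(z0, prod_encode (1, m)) \<in> enc (Wt s n) \<longleftrightarrow> m = length (li s)" for s n m
    by (auto simp: enc_def)
  have mem2: "(z, prod_encode (2, k)) \<in> enc (Wt s n) \<longleftrightarrow> k < length (li s) \<and> z \<in> li s ! k" for z k s n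
    by (auto simp: enc_def)
  have inj_Wt: "s = t \<and> n = m" if "finite s" "finite t" and eq: "enc (Wt s n) = enc (Wt t m)" for s t n m
  proof -
    have nm: "n = m" using mem0[of n s n] mem0[of n t m] unfolding eq by blast
    have len: "length (li s) = length (li t)"
      using mem1[of "length (li s)" s n] mem1[of "length (li s)" t m] unfolding eq by blast
    have "li s = li t"
    proof (rule nth_equalityI[OF len])
      fix k assume k: "k < length (li s)"
      show "li s ! k = li t ! k"
      proof (rule set_eqI)
        fix z
        have "z \<in> li s ! k \<longleftrightarrow> (z, prod_encode (2, k)) \<in> enc (Wt s n)"
          unfolding mem2 using k by blast
        also have "\<dots> \<longleftrightarrow> z \<in> li t ! k"
          unfolding eq mem2 using k len by (simp only: simp_thms)
        finally show "z \<in> li s ! k \<longleftrightarrow> z \<in> li t ! k" .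
      qed
    qed
    then have "s = t" using li[OF that(1)] li[OF that(2)] by metis
    then show ?thesis using nm by blast
  qed
  have no0: "(z0, prod_encode (0, n)) \<notin> enc (Lf x)" for n x by (cases x) (auto simp: enc_def)
  have mem3: "(z0, prod_encode (3, m)) \<in> enc (Lf x) \<longleftrightarrow> x = Inl m" for m x
    by (cases x) (auto simp: enc_def)
  have mem4: "(z, prod_encode (4, 0)) \<in> enc (Lf (Inr A)) \<longleftrightarrow> z \<in> A" for z A
    by (simp add: enc_def)
  have inj_Lf: "x = y" if eq: "enc (Lf x) = enc (Lf y)" for x y
  proof (cases x)
    case (Inl m)
    then show ?thesis using mem3[of m x] mem3[of m y] unfolding eq by blast
  next
    case (Inr A)
    show ?thesis
    proof (cases y)
      case (Inl m)
      then show ?thesis using mem3[of m x] mem3[of m y] unfolding eq by blast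
    next
      case y: (Inr B)
      have "A = B" using mem4[of _ A] mem4[of _ B] eq unfolding \<open>x = Inr A\<close> y by blast
      then show ?thesis using Inr y by simp
    qed
  qed
  have "inj_on enc {d. finite (supp d)}"
  proof (rule inj_onI)
    fix c d assume "c \<in> {d. finite (supp d)}" "d \<in> {d. finite (supp d)}" "enc c = enc d"
    then show "c = d"
      using inj_Wt inj_Lf no0 mem0 by (cases c; cases d) (auto, metis+)
  qed
  then have "inj_on (\<lambda>d. \<iota> ` enc d) {d. finite (supp d)}"
    using \<iota> by (auto simp: inj_on_def inj_image_eq_iff)
  then show ?thesis by blast
qed

theorem theorem5p10:
  fixes L :: "('f, 'r) lang"
    and T :: "('f, 'r) fm set"
    and \<kappa> :: "'k rel"
    and \<CC> :: "('f, 'r, 'm) fo_struct"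
    and p :: "('f + 'm, 'r) fm set"
  assumes "countable_lang L"
    and "complete_theory L T"
    and "monster L T \<kappa> \<CC>"
    and "stable_theory L \<CC>"
    and "strongly_regular L \<kappa> \<CC> p"
  shows "\<forall>\<mu> :: 'c rel. Card_order \<mu> \<longrightarrow>
           (\<exists>M :: ('f, 'r, ('c + nat) set) fo_struct.
              is_model L T M \<and> quasiminimal L M \<and> (\<mu>, card_of (universe M)) \<in> ordLeq)"
proof (intro allI impI)
  fix \<mu> :: "'c rel" assume \<mu>: "Card_order \<mu>"
  interpret regular_type L T \<kappa> \<CC> p by standard (fact assms)+
  obtain \<alpha> where \<alpha>: "morley \<alpha>" using morley_ex by blast
  \<comment> \<open>The index set consists of all subsets of \<open>'c + nat\<close>: it is
    uncountable whatever \<open>'c\<close> is, and its singletons already provide one index for each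
    element of \<open>'c\<close>.\<close>
  have inf: "infinite (UNIV :: ('c + nat) set)" by simp
  then have inf': "infinite (UNIV :: ('c + nat) set set)" by (simp add: Finite_Set.finite_set)
  obtain W :: "('c + nat) set set filter" where W: "W \<le> finite_subsets_at_top UNIV" "W \<noteq> bot"
    "\<And>P. eventually P W \<or> eventually (\<lambda>x. \<not> P x) W"
    using ultrafilter_ex[of "finite_subsets_at_top (UNIV :: ('c + nat) set set)"] by auto
  interpret regular_ultrapower L T \<kappa> \<CC> p W \<alpha>
    by standard (use W inf' \<alpha> is_struct_C in auto)
  let ?M = "upow W \<CC>"
  interpret amb: ambient L ?M seq by (rule ambient_upow)
  obtain val where "system L ?M seq val" using amb.system_ex by blast
  then interpret sys: system L ?M seq val .
  obtain \<iota> :: "('c + nat) set code \<Rightarrow> ('c + nat) set" where \<iota>: "inj_on \<iota> {d. finite (supp d)}"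
    using code_injection[OF inf] by blast
  \<comment> \<open>Distinct codes may have the same value, so each element of the carrier is
    assigned one of its codes before these are embedded by \<open>\<iota>\<close>.\<close>
  define h where "h y = (SOME d. finite (supp d) \<and> val d = y)" for y
  have h: "finite (supp (h y)) \<and> val (h y) = y" if "y \<in> sys.carrier" for y
    unfolding h_def by (rule someI_ex) (use that in \<open>auto simp: sys.carrier_def\<close>)
  define e where "e = \<iota> \<circ> h"
  have e: "inj_on e sys.carrier"
  proof (rule inj_onI)
    fix x y assume xy: "x \<in> sys.carrier" "y \<in> sys.carrier" "e x = e y"
    then have "h x = h y" using h by (intro inj_onD[OF \<iota>]) (auto simp: e_def)
    then show "x = y" using h xy by metis
  qed
  have cU: "sys.carrier \<subseteq> Us" using sys.val_in by (auto simp: sys.carrier_def)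
  have cne: "sys.carrier \<noteq> {}" using sys.a_carrier by blast
  have e_seq: "x = y" if "e (seq x) = e (seq y)" for x y
    using inj_onD[OF e that] sys.a_carrier seq_inj by (blast dest: injD)
  obtain N where N: "is_struct L N" "universe N = e ` sys.carrier"
    "\<And>\<phi> v. wf_fm L \<phi> \<Longrightarrow> range v \<subseteq> sys.carrier \<Longrightarrow> sat N (e \<circ> v) \<phi> = sat ?M v \<phi>"
    using transport_elementary[OF struct_upow cU cne e] sys.carrier_elementary by blast
  have lift: "\<exists>v. range v \<subseteq> sys.carrier \<and> w = e \<circ> v" if "range w \<subseteq> universe N" for w :: "nat \<Rightarrow> _"
  proof -
    have "\<forall>n. \<exists>x. x \<in> sys.carrier \<and> w n = e x" using that N(2) by blast
    then obtain v where "\<And>n. v n \<in> sys.carrier \<and> w n = e (v n)" by metis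
    then show ?thesis by (intro exI[of _ v]) auto
  qed
  have "is_model L T N"
    unfolding is_model_def
  proof (intro conjI ballI N(1))
    fix \<sigma> assume \<sigma>: "\<sigma> \<in> T"
    then have wf: "wf_fm L \<sigma>" "fv \<sigma> = {}"
      using assms(2) by (auto simp: complete_theory_def sentences_def)
    obtain u where "u \<in> U" using U_ne by blast
    then have "sat \<CC> (\<lambda>_. u) \<sigma>"
      using assms(3) \<sigma> unfolding monster_def is_model_def holds_def by auto
    then have "sat ?M v \<sigma>" for v using equiv_M[OF wf] by blast
    then show "holds N \<sigma>"
      unfolding holds_def using lift N(3)[OF wf(1)] by metis
  qed
  moreover have "quasiminimal L N"
    unfolding quasiminimal_def
  proof (intro conjI ballI)
    have "uncountable (UNIV :: ('c + nat) set set)"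
    proof
      assume "countable (UNIV :: ('c + nat) set set)"
      then have "countable (range (\<lambda>f. Inr ` {n. f n}) :: ('c + nat) set set)"
        by (rule countable_subset[rotated]) simp
      moreover have "inj (\<lambda>f :: nat \<Rightarrow> bool. Inr ` {n. f n} :: ('c + nat) set)"
        by (rule injI) (auto simp: inj_image_eq_iff fun_eq_iff)
      ultimately show False
        using uncountable_bool_seq countable_image_inj_eq by blast
    qed
    moreover have "inj (\<lambda>i. e (seq (Inr i)))"
      by (rule injI) (auto dest!: e_seq)
    ultimately have "uncountable (range (\<lambda>i. e (seq (Inr i))))"
      using countable_image_inj_eq by blast
    moreover have "range (\<lambda>i. e (seq (Inr i))) \<subseteq> universe N" using sys.a_carrier N(2) by auto
    ultimately show "uncountable (universe N)" using countable_subset by blast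
  next
    fix \<chi> assume \<chi>: "\<chi> \<in> fmls1 L (universe N)"
    obtain u where "u \<in> universe N" using cne N(2) by auto
    from fmls1_assignment[OF \<chi> this order_refl] obtain \<phi> w where \<phi>: "wf_fm L \<phi>" "range w \<subseteq> universe N"
      "\<And>x. sat1 N \<chi> x \<longleftrightarrow> sat N (w(0 := x)) \<phi>" by blast
    obtain v where v: "range v \<subseteq> sys.carrier" "w = e \<circ> v" using lift[OF \<phi>(2)] by blast
    have eq: "sat1 N \<chi> (e x) \<longleftrightarrow> sat ?M (v(0 := x)) \<phi>" if "x \<in> sys.carrier" for x
    proof -
      have "sat N (e \<circ> v(0 := x)) \<phi> = sat ?M (v(0 := x)) \<phi>"
        by (rule N(3)[OF \<phi>(1)]) (use v that in auto)
      then show ?thesis unfolding \<phi>(3) v(2) by (simp only: fun_upd_comp)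
    qed
    have 1: "solutions N \<chi> = e ` {x \<in> sys.carrier. sat ?M (v(0 := x)) \<phi>}"
      unfolding solutions_def N(2) using eq by blast
    have 2: "universe N - solutions N \<chi> \<subseteq> e ` {x \<in> sys.carrier. \<not> sat ?M (v(0 := x)) \<phi>}"
      unfolding solutions_def N(2) using eq by blast
    show "countable (solutions N \<chi>) \<or> countable (universe N - solutions N \<chi>)"
      using sys.carrier_quasiminimal[OF \<phi>(1) v(1)]
    proof
      assume "countable {x \<in> sys.carrier. sat ?M (v(0 := x)) \<phi>}"
      then show ?thesis unfolding 1 by (rule disjI1[OF countable_image])
    next
      assume "countable {x \<in> sys.carrier. \<not> sat ?M (v(0 := x)) \<phi>}"
      then show ?thesis by (rule disjI2[OF countable_subset[OF 2 countable_image]])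
    qed
  qed
  moreover have "\<mu> \<le>o |universe N|"
  proof -
    have "\<mu> =o |Field \<mu>|" by (rule ordIso_symmetric[OF card_of_Field_ordIso[OF \<mu>]])
    also have "|Field \<mu>| \<le>o |universe N|"
    proof (rule card_of_ordLeqI)
      show "inj_on (\<lambda>c. e (seq (Inr {Inl c}))) (Field \<mu>)"
        by (rule inj_onI) (auto dest!: e_seq)
      show "e (seq (Inr {Inl c})) \<in> universe N" for c using sys.a_carrier N(2) by auto
    qed
    finally show ?thesis .
  qed
  ultimately show "\<exists>M :: ('f, 'r, ('c + nat) set) fo_struct.
      is_model L T M \<and> quasiminimal L M \<and> (\<mu>, card_of (universe M)) \<in> ordLeq"
    by blast
qed

end
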